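(* Let $\Omega$ be a compact Hausdorff space. Then there exists a family $(n(i))_{i\in\mathbb{I}}$ of positive integers such that, when we define $\mathbb{G}$ to be the group $\prod_{i\in\mathbb{I}}\mathbb{U}_{n(i)}$ with the product topology, there is a continuous injection $\mathbf{j}:\Omega\to\mathbb{G}$ such that $\operatorname{Hel}_{\rm cb}(\mathbf{j}(\Omega))=1$.
   Context: $\mathbb{U}_n$ denotes the usual (compact) group of $n\times n$ complex unitary matrices. For a locally compact group $G$, $\operatorname{VN}(G)\subseteq\mathcal{B}(L^2(G))$ is the group von Neumann algebra (generated by the left regular representation) and $\operatorname{A}(G)$ is the Fourier algebra of $G$ in the sense of Eymard, which is the predual of $\operatorname{VN}(G)$ and carries the operator space structure of this predual (so that its operator space dual is $\operatorname{VN}(G)$ with its $\mathrm{C}^*$-algebra operator space structure). For a closed subset $E\subseteq G$, let $I_G(E)$ be the kernel of the restriction homomorphism $\operatorname{A}(G)\to C_0(E)$, and let $\operatorname{A}_G(E)=\operatorname{A}(G)/I_G(E)$ with the quotient operator space structure. $C_0(E)$ carries its canonical operator space structure as a $\mathrm{C}^*$-algebra. Let $\operatorname{inc}_{G,E}:\operatorname{A}_G(E)\to C_0(E)$ be the injective, completely contractive homomorphism induced by restriction. The closed set $E$ is called a cb-Helson subset of $G$ if $\operatorname{inc}_{G,E}$ is surjective with completely bounded inverse; in that case the cb-Helson constant of $E$ is $\operatorname{Hel}_{\rm cb}(E)=\|\operatorname{inc}_{G,E}^{-1}\|_{cb}$. If the closed set $E$ is not a cb-Helson subset, put $\operatorname{Hel}_{\rm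 cb}(E)=+\infty$. *)

theory Defs
  imports
    "HOL-Analysis.Analysis"
    "HOL-Algebra.Product_Groups"
    "HOL-Algebra.Module"
    "Jordan_Normal_Form.Schur_Decomposition"
begin

section \<open>Operator spaces\<close>

text \<open>An operator space is recorded by its underlying set and its matrix norms: for
  \<open>v k l\<close> in the carrier (\<open>k, l < n\<close>), \<open>mnorm V n v\<close> is the norm of the matrix \<open>[v k l]\<close>
  in \<open>M\<^sub>n(V)\<close>; values of \<open>v\<close> at other indices are irrelevant.  Norms take values in
  \<^typ>\<open>ennreal\<close> so that suprema and infima need no finiteness side conditions.
  The vector space operations are the evident ones in each instance below and are not
  needed to form completely bounded norms.\<close>

record 'v opspace =
  carr :: "'v set"
  mnorm :: "nat \<Rightarrow> (nat \<Rightarrow> nat \<Rightarrow> 'v) \<Rightarrow> ennreal"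

definition mats :: "nat \<Rightarrow> 'v set \<Rightarrow> (nat \<Rightarrow> nat \<Rightarrow> 'v) set" where
  "mats n S = {v. \<forall>k<n. \<forall>l<n. v k l \<in> S}"

definition cb_norm :: "'v opspace \<Rightarrow> 'w opspace \<Rightarrow> ('v \<Rightarrow> 'w) \<Rightarrow> ennreal" where
  "cb_norm V W f =
     (SUP n. SUP v\<in>{v \<in> mats n (carr V). mnorm V n v \<le> 1}. mnorm W n (\<lambda>k l. f (v k l)))"

text \<open>The image of \<open>V\<close> under a linear map \<open>q\<close>, with the operator space structure that makes
  \<open>q\<close> a complete quotient map.\<close>

definition quotient_opspace :: "'v opspace \<Rightarrow> ('v \<Rightarrow> 'w) \<Rightarrow> 'w opspace" where
  "quotient_opspace V q =
     \<lparr>carr = q ` carr V,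
      mnorm = (\<lambda>n w. INF v\<in>{v \<in> mats n (carr V). \<forall>k<n. \<forall>l<n. q (v k l) = w k l}. mnorm V n v)\<rparr>"

text \<open>The norm of a scalar matrix, with rows and columns indexed by a finite set \<open>J\<close>,
  as an operator on \<open>\<ell>\<^sup>2(J)\<close>.\<close>

definition opnorm :: "'j set \<Rightarrow> ('j \<Rightarrow> 'j \<Rightarrow> complex) \<Rightarrow> ennreal" where
  "opnorm J a =
     (SUP z\<in>{z. L2_set (\<lambda>l. cmod (z l)) J \<le> 1}.
        ennreal (L2_set (\<lambda>k. cmod (\<Sum>l\<in>J. a k l * z l)) J))"

definition mat_opspace :: "nat \<Rightarrow> complex mat opspace" where
  "mat_opspace n =
     \<lparr>carr = carrier_mat n n,
      mnorm = (\<lambda>m X. opnorm ({..<m} \<times> {..<n}) (\<lambda>(p, k) (q, l). X p q $$ (k, l)))\<rparr>"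

definition C0_opspace :: "'g topology \<Rightarrow> 'g set \<Rightarrow> ('g \<Rightarrow> complex) opspace" where
  "C0_opspace T E =
     \<lparr>carr = {f \<in> extensional E. continuous_map (subtopology T E) euclidean f \<and>
                (\<forall>\<epsilon>>0. compactin T {x \<in> E. cmod (f x) \<ge> \<epsilon>})},
      mnorm = (\<lambda>n f. SUP x\<in>E. opnorm {..<n} (\<lambda>k l. f k l x))\<rparr>"

section \<open>Operators on a Hilbert space\<close>

text \<open>The ring multiplication and unit inherited from the record type \<open>module\<close> are unused.
  The inner product is linear in the first argument.\<close>

record 'h hilbert = "(complex, 'h) module" +
  hinner :: "'h \<Rightarrow> 'h \<Rightarrow> complex"

definition hnorm :: "'h hilbert \<Rightarrow> 'h \<Rightarrow> real" where
  "hnorm H x = sqrt (Re (hinner H x x))"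

definition bounded_ops :: "'h hilbert \<Rightarrow> ('h \<Rightarrow> 'h) set" where
  "bounded_ops H =
     {A \<in> carrier H \<rightarrow>\<^sub>E carrier H.
        (\<forall>x\<in>carrier H. \<forall>y\<in>carrier H. A (x \<oplus>\<^bsub>H\<^esub> y) = A x \<oplus>\<^bsub>H\<^esub> A y) \<and>
        (\<forall>c. \<forall>x\<in>carrier H. A (c \<odot>\<^bsub>H\<^esub> x) = c \<odot>\<^bsub>H\<^esub> A x) \<and>
        (\<exists>C. \<forall>x\<in>carrier H. hnorm H (A x) \<le> C * hnorm H x)}"

definition commutant :: "'h hilbert \<Rightarrow> ('h \<Rightarrow> 'h) set \<Rightarrow> ('h \<Rightarrow> 'h) set" where
  "commutant H S =
     {A \<in> bounded_ops H. \<forall>B\<in>S. \<forall>x\<in>carrier H. A (B x) = B (A x)}"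

text \<open>A space \<open>N\<close> of bounded operators, with \<open>M\<^sub>m(N)\<close> normed as operators on the
  \<open>m\<close>-fold Hilbert space direct sum of \<open>H\<close>.\<close>

definition operator_opspace :: "'h hilbert \<Rightarrow> ('h \<Rightarrow> 'h) set \<Rightarrow> ('h \<Rightarrow> 'h) opspace" where
  "operator_opspace H N =
     \<lparr>carr = N,
      mnorm = (\<lambda>m A. SUP x\<in>{x. (\<forall>q<m. x q \<in> carrier H) \<and> L2_set (\<lambda>q. hnorm H (x q)) {..<m} \<le> 1}.
        ennreal (L2_set (\<lambda>p. hnorm H (\<Oplus>\<^bsub>H\<^esub>q\<in>{..<m}. A p q (x q))) {..<m}))\<rparr>"

text \<open>The predual of a von Neumann algebra \<open>N\<close> on \<open>H\<close>: the \<open>\<sigma>\<close>-weakly continuous functionals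
  on \<open>N\<close>, that is, the countable sums of vector functionals below.  A matrix \<open>[\<phi> k l]\<close> of such
  functionals is normed as the map \<open>A \<mapsto> [\<phi> k l A]\<close> from \<open>N\<close> to \<open>M\<^sub>n\<close>, the standard operator
  space structure of a (pre)dual.\<close>

definition predual_opspace :: "'h hilbert \<Rightarrow> ('h \<Rightarrow> 'h) set \<Rightarrow> (('h \<Rightarrow> 'h) \<Rightarrow> complex) opspace" where
  "predual_opspace H N =
     \<lparr>carr = {\<phi>. \<exists>x y :: nat \<Rightarrow> 'h. (\<forall>i. x i \<in> carrier H \<and> y i \<in> carrier H) \<and>
                summable (\<lambda>i. (hnorm H (x i))\<^sup>2) \<and> summable (\<lambda>i. (hnorm H (y i))\<^sup>2) \<and>
                \<phi> = (\<lambda>A\<in>N. \<Sum>i. hinner H (A (x i)) (y i))},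
      mnorm = (\<lambda>n \<phi>. cb_norm (operator_opspace H N) (mat_opspace n)
                       (\<lambda>A. mat n n (\<lambda>(k, l). \<phi> k l A)))\<rparr>"

section \<open>Square-integrable functions\<close>

definition sq_integrable :: "'g measure \<Rightarrow> ('g \<Rightarrow> complex) set" where
  "sq_integrable M = {f \<in> borel_measurable M. integrable M (\<lambda>x. (cmod (f x))\<^sup>2)}"

definition ae_class :: "'g measure \<Rightarrow> ('g \<Rightarrow> complex) \<Rightarrow> ('g \<Rightarrow> complex) set" where
  "ae_class M f = {g \<in> sq_integrable M. AE x in M. g x = f x}"

definition rep :: "('g \<Rightarrow> complex) set \<Rightarrow> 'g \<Rightarrow> complex" where
  "rep F = (SOME f. f \<in> F)"

definition L2_space :: "'g measure \<Rightarrow> ('g \<Rightarrow> complex) set hilbert" where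
  "L2_space M =
     \<lparr>carrier = ae_class M ` sq_integrable M,
      mult = undefined,
      one = undefined,
      zero = ae_class M (\<lambda>_. 0),
      add = (\<lambda>F K. ae_class M (\<lambda>x. rep F x + rep K x)),
      smult = (\<lambda>c F. ae_class M (\<lambda>x. c * rep F x)),
      hinner = (\<lambda>F K. LINT x|M. rep F x * cnj (rep K x))\<rparr>"

section \<open>Haar measure, the group von Neumann algebra and the Fourier algebra\<close>

text \<open>Throughout, a locally compact group is given by a group \<open>G\<close>, its topology \<open>T\<close> (with
  \<open>topspace T = carrier G\<close>) and a left Haar measure \<open>\<mu>\<close>; the latter is unique up to a positive
  factor, on which the Fourier algebra and the constants below do not depend.\<close>

definition left_haar_measure ::
    "('g, 'b) monoid_scheme \<Rightarrow> 'g topology \<Rightarrow> 'g measure \<Rightarrow> bool" where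
  "left_haar_measure G T \<mu> \<longleftrightarrow>
     space \<mu> = topspace T \<and>
     sets \<mu> = sigma_sets (topspace T) {U. openin T U} \<and>
     (\<forall>K. compactin T K \<longrightarrow> emeasure \<mu> K < \<infinity>) \<and>
     (\<forall>A\<in>sets \<mu>. emeasure \<mu> A = (INF U\<in>{U. openin T U \<and> A \<subseteq> U}. emeasure \<mu> U)) \<and>
     (\<forall>U. openin T U \<longrightarrow> emeasure \<mu> U = (SUP K\<in>{K. compactin T K \<and> K \<subseteq> U}. emeasure \<mu> K)) \<and>
     emeasure \<mu> (space \<mu>) \<noteq> 0 \<and>
     (\<forall>x\<in>carrier G. \<forall>A\<in>sets \<mu>. emeasure \<mu> (x <#\<^bsub>G\<^esub> A) = emeasure \<mu> A)"

definition left_regular ::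
    "('g, 'b) monoid_scheme \<Rightarrow> 'g measure \<Rightarrow> 'g \<Rightarrow> ('g \<Rightarrow> complex) set \<Rightarrow> ('g \<Rightarrow> complex) set" where
  "left_regular G \<mu> x =
     (\<lambda>F\<in>carrier (L2_space \<mu>). ae_class \<mu> (\<lambda>s. rep F (inv\<^bsub>G\<^esub> x \<otimes>\<^bsub>G\<^esub> s)))"

text \<open>The set of left translations is closed under adjoints, so the von Neumann algebra it
  generates is its bicommutant.\<close>

definition VN :: "('g, 'b) monoid_scheme \<Rightarrow> 'g measure \<Rightarrow>
    (('g \<Rightarrow> complex) set \<Rightarrow> ('g \<Rightarrow> complex) set) set" where
  "VN G \<mu> = commutant (L2_space \<mu>) (commutant (L2_space \<mu>) (left_regular G \<mu> ` carrier G))"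

text \<open>The Fourier algebra is the predual of \<open>VN G \<mu>\<close>, realised as functions on the group by
  evaluating functionals at the left translations.  This map is injective, as the translations
  span a \<open>\<sigma>\<close>-weakly dense subspace, so it merely transports the operator space structure.\<close>

definition fourier_algebra ::
    "('g, 'b) monoid_scheme \<Rightarrow> 'g measure \<Rightarrow> ('g \<Rightarrow> complex) opspace" where
  "fourier_algebra G \<mu> =
     quotient_opspace (predual_opspace (L2_space \<mu>) (VN G \<mu>))
       (\<lambda>\<phi>. \<lambda>x\<in>carrier G. \<phi> (left_regular G \<mu> x))"

section \<open>cb-Helson sets\<close>

definition vanishing_ideal ::
    "('g, 'b) monoid_scheme \<Rightarrow> 'g measure \<Rightarrow> 'g set \<Rightarrow> ('g \<Rightarrow> complex) set" where
  "vanishing_ideal G \<mu> E = {u \<in> carr (fourier_algebra G \<mu>). \<forall>x\<in>E. u x = 0}"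

definition restricted_fourier_algebra ::
    "('g, 'b) monoid_scheme \<Rightarrow> 'g measure \<Rightarrow> 'g set \<Rightarrow> ('g \<Rightarrow> complex) set opspace" where
  "restricted_fourier_algebra G \<mu> E =
     quotient_opspace (fourier_algebra G \<mu>)
       (\<lambda>u. (\<lambda>v. \<lambda>x\<in>carrier G. u x + v x) ` vanishing_ideal G \<mu> E)"

text \<open>All members of a coset of the ideal have the same restriction to \<open>E\<close>.\<close>

definition restriction_inc :: "'g set \<Rightarrow> ('g \<Rightarrow> complex) set \<Rightarrow> 'g \<Rightarrow> complex" where
  "restriction_inc E X = the_elem ((\<lambda>u. restrict u E) ` X)"

definition restriction_inc_inv ::
    "('g, 'b) monoid_scheme \<Rightarrow> 'g measure \<Rightarrow> 'g set \<Rightarrow> ('g \<Rightarrow> complex) \<Rightarrow> ('g \<Rightarrow> complex) set" where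
  "restriction_inc_inv G \<mu> E =
     inv_into (carr (restricted_fourier_algebra G \<mu> E)) (restriction_inc E)"

definition cb_Helson ::
    "('g, 'b) monoid_scheme \<Rightarrow> 'g topology \<Rightarrow> 'g measure \<Rightarrow> 'g set \<Rightarrow> bool" where
  "cb_Helson G T \<mu> E \<longleftrightarrow>
     closedin T E \<and>
     restriction_inc E ` carr (restricted_fourier_algebra G \<mu> E) = carr (C0_opspace T E) \<and>
     cb_norm (C0_opspace T E) (restricted_fourier_algebra G \<mu> E) (restriction_inc_inv G \<mu> E) < \<infinity>"

definition Hel_cb ::
    "('g, 'b) monoid_scheme \<Rightarrow> 'g topology \<Rightarrow> 'g measure \<Rightarrow> 'g set \<Rightarrow> ennreal" where
  "Hel_cb G T \<mu> E =
     (if cb_Helson G T \<mu> E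
      then cb_norm (C0_opspace T E) (restricted_fourier_algebra G \<mu> E) (restriction_inc_inv G \<mu> E)
      else \<infinity>)"

section \<open>Products of unitary groups\<close>

definition unitary_group :: "nat \<Rightarrow> complex mat monoid" where
  "unitary_group n =
     \<lparr>carrier = {A \<in> carrier_mat n n. mat_adjoint A * A = 1\<^sub>m n \<and> A * mat_adjoint A = 1\<^sub>m n},
      mult = (*),
      one = 1\<^sub>m n\<rparr>"

text \<open>The usual topology, in which the matrix entries are the coordinates.\<close>

definition unitary_topology :: "nat \<Rightarrow> complex mat topology" where
  "unitary_topology n =
     pullback_topology (carrier (unitary_group n)) (\<lambda>A. \<lambda>p\<in>{..<n} \<times> {..<n}. A $$ p)
       (product_topology (\<lambda>_. euclidean) ({..<n} \<times> {..<n}))"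

definition unitary_product_group :: "'i set \<Rightarrow> ('i \<Rightarrow> nat) \<Rightarrow> ('i \<Rightarrow> complex mat) monoid" where
  "unitary_product_group I n = product_group I (\<lambda>i. unitary_group (n i))"

definition unitary_product_topology :: "'i set \<Rightarrow> ('i \<Rightarrow> nat) \<Rightarrow> ('i \<Rightarrow> complex mat) topology" where
  "unitary_product_topology I n = product_topology (\<lambda>i. unitary_topology (n i)) I"

end

theory Submission
  imports Defs
begin

text \<open>
  Index the group by all continuous maps \<open>U\<close> from the space to some \<open>\<U>\<^sub>N\<close> and let \<open>j\<close> be evaluation.
  A matrix \<open>F\<close> of continuous functions whose norm is less than \<open>1\<close> dilates to a continuous
  unitary-valued \<open>U\<close>: a Cholesky factor \<open>D\<close> of \<open>1 - F\<^sup>*F\<close> is continuous because it is computed by arithmetic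
  and square roots of positive functions, and then the isometry with blocks \<open>F\<close>, \<open>D\<^sup>*\<close>
  is completed to a unitary by polynomial expressions in its entries. Hence \<open>F\<close> is, along \<open>j\<close>, a corner of a
  coordinate representation \<open>\<pi>\<close> of the group.

  The coefficients of \<open>\<pi>\<close> are \<open>\<pi>\<^sub>k\<^sub>l(x) = \<Sum>\<^sub>s \<langle>\<lambda>(x) f\<^sub>l\<^sub>s, f\<^sub>k\<^sub>s\<rangle>\<close> with \<open>f\<^sub>l\<^sub>s\<close> the
  normalised conjugate of \<open>\<pi>\<^sub>l\<^sub>s\<close>. Summing over \<open>s\<close> makes these vectors orthonormal merely because the rows of a
  unitary matrix are, so neither irreducibility nor Schur orthogonality is needed, and \<open>A \<mapsto> [\<Sum>\<^sub>s \<langle>A f\<^sub>l\<^sub>s, f\<^sub>k\<^sub>s\<rangle>]\<close>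
  is a compression of an amplification, thus completely contractive. So every matrix over \<open>C(E)\<close> of
  norm less than \<open>R\<close> extends to a matrix over the Fourier algebra of norm at most \<open>R\<close>. The constant function
  \<open>1\<close> shows that the constant is not smaller than \<open>1\<close>. That functions in the Fourier algebra are continuous
  is the strong continuity of translation on \<open>L\<^sup>2\<close>.
\<close>

section \<open>Continuous unitary dilations\<close>

text \<open>The norm is kept strictly below 1 because the Cholesky recursion divides by its pivots
  and is continuous only where the matrix is positive definite. Nothing is lost: the bound on the
  inverse is approached through lifts of norm at most 1 + e for every e > 0. All matrix sizes must
  occur in the group because complete boundedness tests all of them: a matrix of size m uses a
  coordinate of size 3m, with m rows for F, m for the defect, and m more to complete the resulting
  2m by m isometry.

  What makes the coefficient formula work is that its integrand, summed over s, is constant on the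
  group: pairing the rows of \<pi>(t) with those of \<pi>(x^{-1} t) gives \<pi>(x) for every t. The
  Haar measure therefore enters this formula only through its total mass. Its invariance makes
  translations isometries, and its regularity makes them strongly continuous; without the latter it
  would not be known that restriction to E lands in C(E), which is half of the surjectivity
  claim.\<close>

lemma continuous_map_mult_complex:
  fixes f g :: "'a \<Rightarrow> complex"
  shows "\<lbrakk>continuous_map X euclidean f; continuous_map X euclidean g\<rbrakk> \<Longrightarrow>
    continuous_map X euclidean (\<lambda>x. f x * g x)"
  by (simp add: continuous_map_atin tendsto_mult)

lemma continuous_map_cnj:
  "continuous_map X euclidean f \<Longrightarrow> continuous_map X euclidean (\<lambda>x. cnj (f x))"
  by (simp add: continuous_map_atin tendsto_cnj)

lemma continuous_map_Re:
  "continuous_map X euclidean f \<Longrightarrow> continuous_map X euclidean (\<lambda>x. Re (f x))"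
  by (simp add: continuous_map_atin tendsto_Re)

lemma continuous_map_complex_of_real:
  "continuous_map X euclidean f \<Longrightarrow> continuous_map X euclidean (\<lambda>x. complex_of_real (f x))"
  by (simp add: continuous_map_atin tendsto_of_real)

text \<open>Induction eliminating the last index: the pivot \<open>a n n\<close> is positive (test
  the form on the last unit vector), and its Schur complement is again positive definite. Only
  pivots and their square roots are inverted, so strict positivity at every point keeps the entries
  of \<open>d\<close> continuous.\<close>

lemma continuous_Cholesky:
  fixes a :: "nat \<Rightarrow> nat \<Rightarrow> 'a \<Rightarrow> complex"
  assumes "\<And>i j. \<lbrakk>i < n; j < n\<rbrakk> \<Longrightarrow> continuous_map X euclidean (a i j)"
    and "\<And>i j w. \<lbrakk>i < n; j < n; w \<in> topspace X\<rbrakk> \<Longrightarrow> a j i w = cnj (a i j w)"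
    and "\<And>w z. \<lbrakk>w \<in> topspace X; \<exists>i<n. z i \<noteq> 0\<rbrakk> \<Longrightarrow>
           0 < Re (\<Sum>i<n. \<Sum>j<n. cnj (z i) * a i j w * z j)"
  shows "\<exists>d. (\<forall>i<n. \<forall>s<n. continuous_map X euclidean (d i s)) \<and>
           (\<forall>i<n. \<forall>j<n. \<forall>w\<in>topspace X. a i j w = (\<Sum>s<n. d i s w * cnj (d j s w)))"
  using assms
proof (induction n arbitrary: a)
  case (Suc n a)
  note cont = Suc.prems(1) and herm = Suc.prems(2) and pos = Suc.prems(3)
  define p where "p = (\<lambda>w. Re (a n n w))"
  have p: "a n n w = complex_of_real (p w)" "p w > 0" if w: "w \<in> topspace X" for w
  proof -
    show "a n n w = complex_of_real (p w)"
      using herm[of n n w] w by (simp add: p_def complex_eq_iff)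
    have "(\<Sum>i<Suc n. \<Sum>j<Suc n. cnj (of_bool (i = n)) * a i j w * of_bool (j = n)) = a n n w"
      by (simp add: of_bool_def if_distrib cong: if_cong)
    then show "p w > 0"
      using pos[of w "\<lambda>i. of_bool (i = n)"] w by (auto simp: p_def)
  qed
  \<comment> \<open>The Schur complement of the last pivot.\<close>
  define b where "b = (\<lambda>i j w. a i j w - a i n w * cnj (a j n w) / complex_of_real (p w))"
  have cp: "continuous_map X euclidean p"
    unfolding p_def by (intro continuous_map_Re cont) auto
  have "\<exists>d. (\<forall>i<n. \<forall>s<n. continuous_map X euclidean (d i s)) \<and>
           (\<forall>i<n. \<forall>j<n. \<forall>w\<in>topspace X. b i j w = (\<Sum>s<n. d i s w * cnj (d j s w)))"
  proof (rule Suc.IH)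
    fix i j assume ij: "i < n" "j < n"
    have "continuous_map X euclidean (\<lambda>w. a i j w - a i n w * cnj (a j n w) * complex_of_real (inverse (p w)))"
      using ij p(2) by (intro continuous_map_diff continuous_map_mult_complex continuous_map_cnj
          continuous_map_complex_of_real continuous_map_real_inverse cont cp) force+
    then show "continuous_map X euclidean (b i j)"
      by (simp add: b_def divide_inverse)
  next
    fix i j w assume "i < n" "j < n" "w \<in> topspace X"
    then show "b j i w = cnj (b i j w)"
      using herm[of i j w] by (simp add: b_def mult.commute)
  next
    fix w z assume w: "w \<in> topspace X" and z: "\<exists>i<n. z i \<noteq> (0::complex)"
    define c where "c = (\<Sum>j<n. a n j w * z j)"
    \<comment> \<open>This last coordinate minimises the form of \<open>a\<close> over all
      extensions of \<open>z\<close>; the minimum is the value of the form of \<open>b\<close> at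
      \<open>z\<close>.\<close>
    define y where "y = - c / complex_of_real (p w)"
    define z' where "z' = z(n := y)"
    have c': "(\<Sum>i<n. cnj (z i) * a i n w) = cnj c"
      using w herm[of n _ w] by (simp add: c_def mult.commute)
    have "(\<Sum>i<Suc n. \<Sum>j<Suc n. cnj (z' i) * a i j w * z' j) =
      (\<Sum>i<n. \<Sum>j<n. cnj (z i) * a i j w * z j) + (\<Sum>i<n. cnj (z i) * a i n w) * y
       + cnj y * c + cnj y * complex_of_real (p w) * y"
      by (simp add: z'_def c_def p(1)[OF w] sum.distrib sum_distrib_left sum_distrib_right mult.assoc)
    also have "\<dots> = (\<Sum>i<n. \<Sum>j<n. cnj (z i) * a i j w * z j) - cnj c * c / complex_of_real (p w)"
      using p(2)[OF w] unfolding c' by (simp add: y_def field_simps)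
    also have "cnj c * c / complex_of_real (p w) =
        (\<Sum>i<n. cnj (z i) * a i n w) * (\<Sum>j<n. cnj (a j n w) * z j) / complex_of_real (p w)"
      unfolding c' using w herm[of _ n w] by (simp add: c_def)
    also have "\<dots> = (\<Sum>i<n. \<Sum>j<n. cnj (z i) * (a i n w * cnj (a j n w) / complex_of_real (p w)) * z j)"
      unfolding sum_product sum_divide_distrib by (intro sum.cong refl) (simp add: field_simps)
    also have "(\<Sum>i<n. \<Sum>j<n. cnj (z i) * a i j w * z j) - \<dots> =
       (\<Sum>i<n. \<Sum>j<n. cnj (z i) * b i j w * z j)"
      unfolding b_def by (simp add: left_diff_distrib right_diff_distrib sum_subtractf)
    finally have "(\<Sum>i<n. \<Sum>j<n. cnj (z i) * b i j w * z j) =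
        (\<Sum>i<Suc n. \<Sum>j<Suc n. cnj (z' i) * a i j w * z' j)" by simp
    moreover have "\<exists>i<Suc n. z' i \<noteq> 0"
      using z by (auto simp: z'_def)
    ultimately show "0 < Re (\<Sum>i<n. \<Sum>j<n. cnj (z i) * b i j w * z j)"
      using pos[OF w, of z'] by simp
  qed
  then obtain d where dc: "\<And>i s. i < n \<Longrightarrow> s < n \<Longrightarrow> continuous_map X euclidean (d i s)"
    and d: "\<And>i j w. i < n \<Longrightarrow> j < n \<Longrightarrow> w \<in> topspace X \<Longrightarrow> b i j w = (\<Sum>s<n. d i s w * cnj (d j s w))"
    by metis
  \<comment> \<open>Columns before \<open>n\<close> carry the factor of \<open>b\<close> and vanish
    in row \<open>n\<close>. Column \<open>n\<close> is \<open>a i n / sqrt (p w)\<close>, whose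
    outer product restores what was subtracted in \<open>b\<close>.\<close>
  define d' where "d' = (\<lambda>i s w. if s < n then if i < n then d i s w else 0
                           else a i n w * complex_of_real (inverse (sqrt (p w))))"
  have "continuous_map X euclidean (d' i s)" if "i < Suc n" "s < Suc n" for i s
  proof (cases "s < n")
    case True
    then show ?thesis
      using dc by (cases "i < n") (auto simp: d'_def)
  next
    case False
    have "continuous_map X euclidean (\<lambda>w. a i n w * complex_of_real (inverse (sqrt (p w))))"
      using that p(2) by (intro continuous_map_mult_complex continuous_map_complex_of_real
          continuous_map_real_inverse continuous_map_sqrt cont cp) force+
    then show ?thesis
      using False by (simp add: d'_def)
  qed
  moreover have "a i j w = (\<Sum>s<Suc n. d' i s w * cnj (d' j s w))"
    if ij: "i < Suc n" "j < Suc n" and w: "w \<in> topspace X" for i j w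
  proof -
    have pw: "complex_of_real (inverse (sqrt (p w))) * complex_of_real (inverse (sqrt (p w))) =
        inverse (complex_of_real (p w))"
      using p(2)[OF w] unfolding of_real_mult[symmetric]
      by (simp flip: inverse_mult_distrib)
    have "d' i n w * cnj (d' j n w) = a i n w * cnj (a j n w) *
       (complex_of_real (inverse (sqrt (p w))) * complex_of_real (inverse (sqrt (p w))))"
      by (simp add: d'_def)
    then have last: "d' i n w * cnj (d' j n w) = a i n w * cnj (a j n w) / complex_of_real (p w)"
      unfolding pw by (simp add: divide_inverse)
    show ?thesis
    proof (cases "i < n \<and> j < n")
      case True
      then have "a i j w = (\<Sum>s<n. d i s w * cnj (d j s w)) + a i n w * cnj (a j n w) / complex_of_real (p w)"
        using d[of i j w] w by (simp add: b_def diff_eq_eq)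
      then show ?thesis
        using True last by (simp add: d'_def)
    next
      case False
      then have "(\<Sum>s<n. d' i s w * cnj (d' j s w)) = 0"
        by (auto simp: d'_def)
      moreover have "a i j w = a i n w * cnj (a j n w) / complex_of_real (p w)"
      proof (cases "j = n")
        case True
        then show ?thesis using p[OF w] by simp
      next
        case nj: False
        then have "i = n" using ij False by auto
        then show ?thesis
          using p[OF w] herm[of j n w] ij w by simp
      qed
      ultimately show ?thesis
        using last by simp
    qed
  qed
  ultimately show ?case by blast
qed auto

section \<open>Adjoints of complex matrices and unitary completion\<close>

lemma dim_mat_adjoint [simp]:
  "dim_row (mat_adjoint A) = dim_col A" "dim_col (mat_adjoint A) = dim_row A"
  by (simp_all add: mat_adjoint_def)

lemma mat_adjoint_carrier [simp]: "A \<in> carrier_mat m n \<Longrightarrow> mat_adjoint A \<in> carrier_mat n m"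
  unfolding carrier_mat_def by simp

lemma index_mat_adjoint [simp]:
  fixes A :: "complex mat"
  shows "\<lbrakk>i < dim_col A; j < dim_row A\<rbrakk> \<Longrightarrow> mat_adjoint A $$ (i, j) = cnj (A $$ (j, i))"
  by (simp add: mat_adjoint_def mat_of_rows_index)

lemma index_mult_mat_sum:
  fixes A B :: "complex mat"
  assumes "A \<in> carrier_mat m n" "B \<in> carrier_mat n k" "i < m" "j < k"
  shows "(A * B) $$ (i, j) = (\<Sum>s<n. A $$ (i, s) * B $$ (s, j))"
  using assms by (simp add: scalar_prod_def atLeast0LessThan)

lemma mat_adjoint_one [simp]: "mat_adjoint (1\<^sub>m n :: complex mat) = 1\<^sub>m n"
  by (intro eq_matI) auto

lemma mat_adjoint_adjoint [simp]: "mat_adjoint (mat_adjoint A) = (A :: complex mat)"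
  by (intro eq_matI) auto

lemma mat_adjoint_mult:
  fixes A B :: "complex mat"
  assumes "A \<in> carrier_mat m n" "B \<in> carrier_mat n k"
  shows "mat_adjoint (A * B) = mat_adjoint B * mat_adjoint A"
proof (rule eq_matI)
  fix i j assume "i < dim_row (mat_adjoint B * mat_adjoint A)" "j < dim_col (mat_adjoint B * mat_adjoint A)"
  with assms have ij: "i < k" "j < m" by auto
  have "mat_adjoint (A * B) $$ (i, j) = cnj ((A * B) $$ (j, i))"
    using ij assms by (intro index_mat_adjoint) auto
  also have "\<dots> = (\<Sum>s<n. mat_adjoint B $$ (i, s) * mat_adjoint A $$ (s, j))"
    unfolding index_mult_mat_sum[OF assms ij(2,1)] cnj_sum
    using ij assms by (intro sum.cong refl) (simp add: mult.commute)
  also have "\<dots> = (mat_adjoint B * mat_adjoint A) $$ (i, j)"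
    using ij assms by (subst index_mult_mat_sum[where m = k and n = n and k = m]) simp_all
  finally show "mat_adjoint (A * B) $$ (i, j) = (mat_adjoint B * mat_adjoint A) $$ (i, j)" .
next
  show "dim_row (mat_adjoint (A * B)) = dim_row (mat_adjoint B * mat_adjoint A)" by simp
next
  show "dim_col (mat_adjoint (A * B)) = dim_col (mat_adjoint B * mat_adjoint A)" by simp
qed

text \<open>A left inverse of a square matrix is also a right inverse.\<close>

lemma unitary_carrier_iff:
  "U \<in> carrier (unitary_group n) \<longleftrightarrow> U \<in> carrier_mat n n \<and> mat_adjoint U * U = 1\<^sub>m n"
  using mat_mult_left_right_inverse[of "mat_adjoint U" n U] mat_adjoint_carrier[of U n n]
  unfolding unitary_group_def by (simp only: partial_object.simps mem_Collect_eq) blast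

text \<open>This is the Halmos unitary dilation of \<open>V\<close>. For an isometry the defect of
  \<open>V\<close> is 0 and the defect of its adjoint is the projection
  \<open>1 - V * mat_adjoint V\<close>, so no square roots remain and the entries are polynomials in
  those of \<open>V\<close> and their conjugates.\<close>

lemma isometry_dilation_unitary:
  fixes V :: "complex mat"
  assumes V: "V \<in> carrier_mat m n" and iso: "mat_adjoint V * V = 1\<^sub>m n"
  shows "four_block_mat V (1\<^sub>m m - V * mat_adjoint V) (0\<^sub>m n n) (- mat_adjoint V)
           \<in> carrier (unitary_group (m + n))"
proof -
  let ?W = "mat_adjoint V" and ?P = "1\<^sub>m m - V * mat_adjoint V"
  let ?U = "four_block_mat V ?P (0\<^sub>m n n) (- ?W)"
  have W: "?W \<in> carrier_mat n m" and VW: "V * ?W \<in> carrier_mat m m" and P: "?P \<in> carrier_mat m m"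
    using V by auto
  have adjP: "mat_adjoint ?P = ?P"
  proof -
    have "mat_adjoint (V * ?W) = V * ?W"
      using mat_adjoint_mult[OF V W] by simp
    then have *: "cnj ((V * ?W) $$ (j, i)) = (V * ?W) $$ (i, j)" if "i < m" "j < m" for i j
      using that V index_mat_adjoint[of i "V * ?W" j] by (simp del: index_mult_mat(1))
    show ?thesis
      using P VW W V by (intro eq_matI) (auto simp: * simp del: index_mult_mat(1))
  qed
  \<comment> \<open>Taking the adjoint moves the cut between the row blocks from \<open>m\<close> to
    \<open>n\<close>, so the product below has diagonal blocks of sizes \<open>n\<close> and
    \<open>m\<close>.\<close>
  have adjU: "mat_adjoint ?U = four_block_mat ?W (0\<^sub>m n n) ?P (- V)"
  proof (intro eq_matI)
    fix i j assume "i < dim_row (four_block_mat ?W (0\<^sub>m n n) ?P (- V))"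
      "j < dim_col (four_block_mat ?W (0\<^sub>m n n) ?P (- V))"
    then have ij: "i < n + m" "j < m + n" using V by auto
    have "cnj (?P $$ (j, i)) = ?P $$ (i, j)" if "i < m" "j < m" for i j
      using adjP V that index_mat_adjoint[of i ?P j] by (simp del: index_mult_mat(1) index_minus_mat(1))
    then show "mat_adjoint ?U $$ (i, j) = four_block_mat ?W (0\<^sub>m n n) ?P (- V) $$ (i, j)"
      using ij V W P by (auto simp del: index_mult_mat index_minus_mat(1))
  qed (use V in auto)
  have VWV: "V * ?W * V = V"
    using assoc_mult_mat[OF V W V] V by (simp add: iso)
  have WVW: "?W * (V * ?W) = ?W"
    using assoc_mult_mat[OF W V W] by (simp add: iso left_mult_one_mat[OF W])
  have PV: "?P * V = 0\<^sub>m m n"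
    using V W VW VWV by (simp add: minus_mult_distrib_mat[OF _ VW V])
  have WP: "?W * ?P = 0\<^sub>m n m"
    using V W VW WVW by (simp add: mult_minus_distrib_mat[OF W _ VW])
  have PP: "?P * ?P = ?P"
  proof -
    have "?P * ?P = ?P * 1\<^sub>m m - ?P * (V * ?W)"
      using P VW by (intro mult_minus_distrib_mat) auto
    also have "?P * (V * ?W) = 0\<^sub>m m m"
      using assoc_mult_mat[OF P V W] by (simp add: PV left_mult_zero_mat[OF W])
    finally show ?thesis
      unfolding right_mult_one_mat[OF P] using P by (intro eq_matI) auto
  qed
  have "mat_adjoint ?U * ?U = four_block_mat (?W * V + 0\<^sub>m n n * 0\<^sub>m n n) (?W * ?P + 0\<^sub>m n n * (- ?W))
       (?P * V + (- V) * 0\<^sub>m n n) (?P * ?P + (- V) * (- ?W))"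
    unfolding adjU using V W P by (intro mult_four_block_mat) auto
  also have "(- V) * (- ?W) = V * ?W"
    using V W by simp
  also have "four_block_mat (?W * V + 0\<^sub>m n n * 0\<^sub>m n n) (?W * ?P + 0\<^sub>m n n * (- ?W))
       (?P * V + (- V) * 0\<^sub>m n n) (?P * ?P + V * ?W) = four_block_mat (1\<^sub>m n) (0\<^sub>m n m) (0\<^sub>m m n) (1\<^sub>m m)"
    using V W VW by (intro cong_four_block_mat; unfold iso WP PV PP) (auto simp: minus_add_minus_mat)
  also have "\<dots> = 1\<^sub>m (m + n)"
    by (intro eq_matI) auto
  finally show ?thesis
    using four_block_carrier_mat[OF V, of "- ?W" n m] W by (simp add: unitary_carrier_iff add.commute)
qed

text \<open>Here \<open>r\<close> bounds the square of the norm, uniformly in the point, so the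
  defect matrix is at least \<open>1 - r\<close> and has a continuous Cholesky factor. The size
  \<open>2 * n + n\<close> comes from completing an isometry with \<open>2 * n\<close> rows and
  \<open>n\<close> columns.\<close>

lemma continuous_unitary_dilation:
  fixes F :: "nat \<Rightarrow> nat \<Rightarrow> 'a \<Rightarrow> complex"
  assumes cont: "\<And>k l. \<lbrakk>k < n; l < n\<rbrakk> \<Longrightarrow> continuous_map X euclidean (F k l)"
    and r: "r < 1"
    and contr: "\<And>w z. w \<in> topspace X \<Longrightarrow>
          (\<Sum>k<n. (cmod (\<Sum>l<n. F k l w * z l))\<^sup>2) \<le> r * (\<Sum>l<n. (cmod (z l))\<^sup>2)"
  obtains U where "\<And>w. w \<in> topspace X \<Longrightarrow> U w \<in> carrier (unitary_group (2 * n + n))"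
    and "\<And>i j. \<lbrakk>i < 2 * n + n; j < 2 * n + n\<rbrakk> \<Longrightarrow> continuous_map X euclidean (\<lambda>w. U w $$ (i, j))"
    and "\<And>k l w. \<lbrakk>k < n; l < n; w \<in> topspace X\<rbrakk> \<Longrightarrow> U w $$ (k, l) = F k l w"
proof -
  define a where "a = (\<lambda>i j w. of_bool (i = j) - (\<Sum>k<n. cnj (F k i w) * F k j w))"
  have "\<exists>d. (\<forall>i<n. \<forall>s<n. continuous_map X euclidean (d i s)) \<and>
           (\<forall>i<n. \<forall>j<n. \<forall>w\<in>topspace X. a i j w = (\<Sum>s<n. d i s w * cnj (d j s w)))"
  proof (rule continuous_Cholesky)
    show "continuous_map X euclidean (a i j)" if "i < n" "j < n" for i j
      unfolding a_def using that
      by (intro continuous_map_diff continuous_map_sum continuous_map_mult_complex continuous_map_cnj cont) auto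
    show "a j i w = cnj (a i j w)" for i j w
      by (auto simp: a_def mult.commute)
    fix w and z :: "nat \<Rightarrow> complex" assume w: "w \<in> topspace X" and z: "\<exists>i<n. z i \<noteq> 0"
    have "(\<Sum>i<n. \<Sum>j<n. cnj (z i) * a i j w * z j) =
        (\<Sum>i<n. \<Sum>j<n. cnj (z i) * of_bool (i = j) * z j) -
        (\<Sum>i<n. \<Sum>j<n. \<Sum>k<n. cnj (F k i w * z i) * (F k j w * z j))"
      by (simp add: a_def left_diff_distrib right_diff_distrib sum_subtractf sum_distrib_left
          sum_distrib_right mult_ac)
    also have "(\<Sum>i<n. \<Sum>j<n. cnj (z i) * of_bool (i = j) * z j) = (\<Sum>i<n. z i * cnj (z i))"
      by (simp add: of_bool_def if_distrib if_distribR mult.commute cong: if_cong)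
    also have "\<dots> = complex_of_real (\<Sum>i<n. (cmod (z i))\<^sup>2)"
      by (simp flip: complex_norm_square)
    also have "(\<Sum>i<n. \<Sum>j<n. \<Sum>k<n. cnj (F k i w * z i) * (F k j w * z j)) =
        (\<Sum>i<n. \<Sum>k<n. \<Sum>j<n. cnj (F k i w * z i) * (F k j w * z j))"
      by (rule sum.cong[OF refl], rule sum.swap)
    also have "\<dots> = (\<Sum>k<n. \<Sum>i<n. \<Sum>j<n. cnj (F k i w * z i) * (F k j w * z j))"
      by (rule sum.swap)
    also have "\<dots> = (\<Sum>k<n. (\<Sum>l<n. F k l w * z l) * cnj (\<Sum>l<n. F k l w * z l))"
      unfolding cnj_sum by (subst mult.commute) (simp only: sum_product)
    also have "\<dots> = complex_of_real (\<Sum>k<n. (cmod (\<Sum>l<n. F k l w * z l))\<^sup>2)"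
      by (simp only: complex_norm_square[symmetric] of_real_sum of_real_power)
    finally have "Re (\<Sum>i<n. \<Sum>j<n. cnj (z i) * a i j w * z j) =
        (\<Sum>i<n. (cmod (z i))\<^sup>2) - (\<Sum>k<n. (cmod (\<Sum>l<n. F k l w * z l))\<^sup>2)"
      by (simp only: minus_complex.simps Re_complex_of_real)
    also have "\<dots> \<ge> (1 - r) * (\<Sum>i<n. (cmod (z i))\<^sup>2)"
      using contr[OF w, of z] by (simp add: algebra_simps)
    moreover have "0 < (\<Sum>i<n. (cmod (z i))\<^sup>2)"
    proof -
      from z obtain i where "i < n" "z i \<noteq> 0" by auto
      then show ?thesis by (intro sum_pos2[of _ i]) auto
    qed
    ultimately show "0 < Re (\<Sum>i<n. \<Sum>j<n. cnj (z i) * a i j w * z j)"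
      using r by (smt (verit) mult_pos_pos)
  qed
  then obtain d where dc: "\<And>i s. \<lbrakk>i < n; s < n\<rbrakk> \<Longrightarrow> continuous_map X euclidean (d i s)"
    and d: "\<And>i j w. \<lbrakk>i < n; j < n; w \<in> topspace X\<rbrakk> \<Longrightarrow> a i j w = (\<Sum>s<n. d i s w * cnj (d j s w))"
    by metis
  \<comment> \<open>The lower block \<open>L\<close> is the adjoint of \<open>d\<close>: the
    factorisation reads \<open>a = d d^*\<close>, while an isometry needs
    \<open>F^* F + L^* L = 1\<close>.\<close>
  define v where "v = (\<lambda>i j w. if i < n then F i j w else cnj (d j (i - n) w))"
  define V where "V = (\<lambda>w. mat (2 * n) n (\<lambda>(i, j). v i j w))"
  define U where "U = (\<lambda>w. four_block_mat (V w) (1\<^sub>m (2 * n) - V w * mat_adjoint (V w))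
      (0\<^sub>m n n) (- mat_adjoint (V w)))"
  have V: "V w \<in> carrier_mat (2 * n) n" for w
    by (simp add: V_def)
  have vc: "continuous_map X euclidean (v i j)" if "i < 2 * n" "j < n" for i j
    using that dc cont by (cases "i < n") (auto simp: v_def intro!: continuous_map_cnj)
  have iso: "mat_adjoint (V w) * V w = 1\<^sub>m n" if w: "w \<in> topspace X" for w
  proof (rule eq_matI)
    fix i j assume "i < dim_row (1\<^sub>m n :: complex mat)" "j < dim_col (1\<^sub>m n :: complex mat)"
    then have ij: "i < n" "j < n" by auto
    have "(mat_adjoint (V w) * V w) $$ (i, j) = (\<Sum>s<2 * n. mat_adjoint (V w) $$ (i, s) * V w $$ (s, j))"
      using ij V by (intro index_mult_mat_sum) auto
    also have "\<dots> = (\<Sum>s<n + n. cnj (v s i w) * v s j w)"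
      using ij V[of w] by (intro sum.cong) (auto simp: V_def)
    also have "\<dots> = (\<Sum>s<n. cnj (v s i w) * v s j w) + (\<Sum>s<n. cnj (v (n + s) i w) * v (n + s) j w)"
      using sum.atLeastLessThan_concat[of 0 n "n + n" "\<lambda>s. cnj (v s i w) * v s j w"]
        sum.shift_bounds_nat_ivl[of "\<lambda>s. cnj (v s i w) * v s j w" 0 n n]
      by (simp add: lessThan_atLeast0 add.commute)
    also have "\<dots> = (\<Sum>k<n. cnj (F k i w) * F k j w) + (\<Sum>s<n. d i s w * cnj (d j s w))"
      by (simp add: v_def)
    also have "\<dots> = of_bool (i = j)"
      using d[OF ij w] by (simp add: a_def algebra_simps)
    finally show "(mat_adjoint (V w) * V w) $$ (i, j) = 1\<^sub>m n $$ (i, j)"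
      using ij by simp
  qed (use V[of w] in auto)
  show thesis
  proof
    show "U w \<in> carrier (unitary_group (2 * n + n))" if "w \<in> topspace X" for w
      unfolding U_def by (rule isometry_dilation_unitary[OF V iso[OF that]])
    show "U w $$ (k, l) = F k l w" if "k < n" "l < n" for k l w
      using that V[of w] by (simp add: U_def) (simp add: V_def v_def)
    fix i j assume ij: "i < 2 * n + n" "j < 2 * n + n"
    \<comment> \<open>In each of the four blocks the entries are polynomials in the functions
      \<open>v\<close> and their conjugates.\<close>
    consider "i < 2 * n" "j < n" | "i < 2 * n" "\<not> j < n" | "\<not> i < 2 * n" "j < n" | "\<not> i < 2 * n" "\<not> j < n"
      by blast
    then show "continuous_map X euclidean (\<lambda>w. U w $$ (i, j))"
    proof cases
      case 1
      then have "U w $$ (i, j) = v i j w" for w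
        using V[of w] by (simp add: U_def) (simp add: V_def)
      then show ?thesis using vc 1 by simp
    next
      case 2
      then have j: "j - n < 2 * n" using ij by auto
      have "U w $$ (i, j) = of_bool (i = j - n) - (\<Sum>s<n. v i s w * cnj (v (j - n) s w))" for w
      proof -
        have "U w $$ (i, j) = of_bool (i = j - n) - (V w * mat_adjoint (V w)) $$ (i, j - n)"
          using 2 ij j V[of w] by (simp add: U_def del: index_mult_mat(1))
        also have "(V w * mat_adjoint (V w)) $$ (i, j - n) = (\<Sum>s<n. V w $$ (i, s) * mat_adjoint (V w) $$ (s, j - n))"
          using 2 j V by (intro index_mult_mat_sum) auto
        also have "\<dots> = (\<Sum>s<n. v i s w * cnj (v (j - n) s w))"
          using 2 j V[of w] by (intro sum.cong) (auto simp: V_def)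
        finally show ?thesis .
      qed
      then show ?thesis
        using 2 j by (simp only:) (intro continuous_map_diff continuous_map_sum continuous_map_mult_complex
            continuous_map_cnj vc continuous_map_canonical_const; simp)
    next
      case 3
      then have "U w $$ (i, j) = 0" for w
        using V[of w] ij by (simp add: U_def)
      then show ?thesis by simp
    next
      case 4
      then have ij': "i - 2 * n < n" "j - n < 2 * n" using ij by auto
      have "U w $$ (i, j) = - cnj (v (j - n) (i - 2 * n) w)" for w
        using V[of w] ij ij' 4 by (simp add: U_def) (simp add: V_def)
      then show ?thesis
        using ij' by (simp only:) (intro continuous_map_minus continuous_map_cnj vc)
    qed
  qed
qed

section \<open>Unitary groups and their products\<close>

text \<open>Unitarity as finitely many polynomial equations in the entries, the form in which the
  unitary matrices are seen to be closed and bounded.\<close>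

lemma unitary_carrier_iff_columns:
  "U \<in> carrier (unitary_group n) \<longleftrightarrow> U \<in> carrier_mat n n \<and>
     (\<forall>i<n. \<forall>j<n. (\<Sum>s<n. cnj (U $$ (s, i)) * U $$ (s, j)) = of_bool (i = j))"
proof -
  have "mat_adjoint U * U = 1\<^sub>m n \<longleftrightarrow>
      (\<forall>i<n. \<forall>j<n. (\<Sum>s<n. cnj (U $$ (s, i)) * U $$ (s, j)) = of_bool (i = j))"
    if U: "U \<in> carrier_mat n n"
  proof -
    have *: "(mat_adjoint U * U) $$ (i, j) = (\<Sum>s<n. cnj (U $$ (s, i)) * U $$ (s, j))"
      if "i < n" "j < n" for i j
    proof -
      have "(mat_adjoint U * U) $$ (i, j) = (\<Sum>s<n. mat_adjoint U $$ (i, s) * U $$ (s, j))"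
        using U that by (intro index_mult_mat_sum) auto
      also have "\<dots> = (\<Sum>s<n. cnj (U $$ (s, i)) * U $$ (s, j))"
        using U that by (intro sum.cong) auto
      finally show ?thesis .
    qed
    have d: "dim_row U = n" "dim_col U = n" using U by auto
    show ?thesis
      unfolding mat_eq_iff using d by (auto simp: * simp del: index_mult_mat(1))
  qed
  then show ?thesis
    unfolding unitary_carrier_iff by blast
qed

lemma cmod_unitary_entry_le_1:
  assumes U: "U \<in> carrier (unitary_group n)" and "k < n" "l < n"
  shows "cmod (U $$ (k, l)) \<le> 1"
proof -
  have "(\<Sum>s<n. cnj (U $$ (s, l)) * U $$ (s, l)) = 1"
    using assms unfolding unitary_carrier_iff_columns by auto
  moreover have "(\<Sum>s<n. cnj (U $$ (s, l)) * U $$ (s, l)) = complex_of_real (\<Sum>s<n. (cmod (U $$ (s, l)))\<^sup>2)"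
    unfolding of_real_sum complex_norm_square by (simp add: mult.commute)
  ultimately have "(\<Sum>s<n. (cmod (U $$ (s, l)))\<^sup>2) = 1"
    by (metis of_real_eq_1_iff)
  moreover have "(cmod (U $$ (k, l)))\<^sup>2 \<le> (\<Sum>s<n. (cmod (U $$ (s, l)))\<^sup>2)"
    using assms by (intro member_le_sum) auto
  ultimately show ?thesis
    by (simp add: power_le_one_iff abs_square_le_1)
qed

lemma unitary_mult_adjoint:
  "U \<in> carrier (unitary_group n) \<Longrightarrow> U * mat_adjoint U = 1\<^sub>m n"
  by (simp add: unitary_group_def)

lemma unitary_carrier_mat: "U \<in> carrier (unitary_group n) \<Longrightarrow> U \<in> carrier_mat n n"
  by (simp add: unitary_group_def)

lemma group_unitary_group: "group (unitary_group n)"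
proof (rule groupI)
  fix A B C assume A: "A \<in> carrier (unitary_group n)" and B: "B \<in> carrier (unitary_group n)"
    and C: "C \<in> carrier (unitary_group n)"
  note [simp] = unitary_carrier_mat[OF A] unitary_carrier_mat[OF B] unitary_carrier_mat[OF C]
  show "A \<otimes>\<^bsub>unitary_group n\<^esub> B \<otimes>\<^bsub>unitary_group n\<^esub> C = A \<otimes>\<^bsub>unitary_group n\<^esub> (B \<otimes>\<^bsub>unitary_group n\<^esub> C)"
    by (simp add: unitary_group_def assoc_mult_mat[of _ n n _ n _ n])
next
  fix A B assume A: "A \<in> carrier (unitary_group n)" and B: "B \<in> carrier (unitary_group n)"
  note c = unitary_carrier_mat[OF A] unitary_carrier_mat[OF B]
  have "mat_adjoint (A * B) * (A * B) = mat_adjoint B * ((mat_adjoint A * A) * B)"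
    using c by (simp add: mat_adjoint_mult[OF c] assoc_mult_mat[of _ n n _ n _ n])
  also have "\<dots> = 1\<^sub>m n"
    using A B left_mult_one_mat[OF c(2)] by (simp add: unitary_carrier_iff)
  finally show "A \<otimes>\<^bsub>unitary_group n\<^esub> B \<in> carrier (unitary_group n)"
    unfolding unitary_carrier_iff using c by (simp add: unitary_group_def)
next
  show "\<one>\<^bsub>unitary_group n\<^esub> \<in> carrier (unitary_group n)"
    by (simp add: unitary_group_def)
next
  fix A assume A: "A \<in> carrier (unitary_group n)"
  then show "\<one>\<^bsub>unitary_group n\<^esub> \<otimes>\<^bsub>unitary_group n\<^esub> A = A"
    using left_mult_one_mat[OF unitary_carrier_mat[OF A]] by (simp add: unitary_group_def)
  have "mat_adjoint A \<in> carrier (unitary_group n)" "mat_adjoint A \<otimes>\<^bsub>unitary_group n\<^esub> A = \<one>\<^bsub>unitary_group n\<^esub>"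
    using A by (simp_all add: unitary_group_def)
  then show "\<exists>B\<in>carrier (unitary_group n). B \<otimes>\<^bsub>unitary_group n\<^esub> A = \<one>\<^bsub>unitary_group n\<^esub>"
    by blast
qed

lemma inv_unitary_group:
  assumes "A \<in> carrier (unitary_group n)"
  shows "inv\<^bsub>unitary_group n\<^esub> A = mat_adjoint A"
  using assms by (intro group.inv_equality[OF group_unitary_group]) (simp_all add: unitary_group_def)

section \<open>The topology of the unitary groups\<close>

lemma topspace_unitary_topology [simp]: "topspace (unitary_topology n) = carrier (unitary_group n)"
  by (auto simp: unitary_topology_def topspace_pullback_topology)

lemma continuous_map_unitary_entry:
  assumes "i < n" "j < n"
  shows "continuous_map (unitary_topology n) euclidean (\<lambda>A. A $$ (i, j))"
proof -
  have "continuous_map (unitary_topology n) euclidean ((\<lambda>v. v (i, j)) \<circ> (\<lambda>A. \<lambda>p\<in>{..<n} \<times> {..<n}. A $$ p))"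
    unfolding unitary_topology_def
    using assms by (intro continuous_map_pullback continuous_map_product_projection) auto
  then show ?thesis
    using assms by (simp add: o_def)
qed

lemma continuous_map_into_unitary:
  assumes "\<And>x. x \<in> topspace X \<Longrightarrow> f x \<in> carrier (unitary_group n)"
    and "\<And>i j. \<lbrakk>i < n; j < n\<rbrakk> \<Longrightarrow> continuous_map X euclidean (\<lambda>x. f x $$ (i, j))"
  shows "continuous_map X (unitary_topology n) f"
  unfolding unitary_topology_def
proof (rule continuous_map_pullback')
  show "continuous_map X (product_topology (\<lambda>_. euclidean) ({..<n} \<times> {..<n}))
          ((\<lambda>A. \<lambda>p\<in>{..<n} \<times> {..<n}. A $$ p) \<circ> f)"
    using assms(2) by (auto simp: continuous_map_componentwise)
qed (use assms(1) in auto)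

lemma Hausdorff_unitary_topology: "Hausdorff_space (unitary_topology n)"
proof (rule Hausdorff_space_injective_preimage)
  let ?f = "\<lambda>A :: complex mat. \<lambda>p\<in>{..<n} \<times> {..<n}. A $$ p"
  let ?P = "product_topology (\<lambda>_. euclidean) ({..<n} \<times> {..<n}) :: (nat \<times> nat \<Rightarrow> complex) topology"
  show "Hausdorff_space ?P"
    by (simp add: Hausdorff_space_product_topology)
  show "continuous_map (unitary_topology n) ?P ?f"
    using continuous_map_unitary_entry by (auto simp: continuous_map_componentwise)
  show "inj_on ?f (topspace (unitary_topology n))"
  proof (rule inj_onI)
    fix A B assume AB: "A \<in> topspace (unitary_topology n)" "B \<in> topspace (unitary_topology n)" and eq: "?f A = ?f B"
    have "A $$ (i, j) = B $$ (i, j)" if "i < n" "j < n" for i j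
      using fun_cong[OF eq, of "(i, j)"] that by simp
    then show "A = B"
      using AB unitary_carrier_mat[of A n] unitary_carrier_mat[of B n] by (intro eq_matI) auto
  qed
qed

text \<open>Heine-Borel: the coordinate vectors of unitary matrices form a closed subset of a
  product of closed unit discs, and the group is a continuous image of this set.\<close>

lemma compact_unitary_topology: "compact_space (unitary_topology n)"
proof -
  let ?P = "product_topology (\<lambda>_. euclidean) ({..<n} \<times> {..<n}) :: (nat \<times> nat \<Rightarrow> complex) topology"
  \<comment> \<open>\<open>h\<close> adds up the defects in the column equations, so it vanishes
    exactly where the coordinates give a unitary matrix.\<close>
  define h :: "(nat \<times> nat \<Rightarrow> complex) \<Rightarrow> real" where
    "h v = (\<Sum>p\<in>{..<n} \<times> {..<n}.
        cmod ((\<Sum>s<n. cnj (v (s, fst p)) * v (s, snd p)) - of_bool (fst p = snd p)))" for v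
  define S where "S = {v \<in> topspace ?P. h v = 0}"
  define C where "C = (\<Pi>\<^sub>E p\<in>{..<n} \<times> {..<n}. cball (0 :: complex) 1)"
  have h0: "h v = 0 \<longleftrightarrow> mat n n v \<in> carrier (unitary_group n)" for v
    unfolding h_def unitary_carrier_iff_columns by (auto simp: sum_nonneg_eq_0_iff)
  have entry: "cmod (v (k, l)) \<le> 1" if "h v = 0" and "k < n" "l < n" for v k l
    using cmod_unitary_entry_le_1[of "mat n n v" n k l] that unfolding h0 by simp
  have "continuous_map ?P euclideanreal h"
    unfolding h_def
    by (intro continuous_map_sum continuous_map_norm continuous_map_diff continuous_map_mult_complex
        continuous_map_cnj continuous_map_canonical_const continuous_map_product_projection) auto
  then have "closedin ?P S"
    unfolding S_def by (intro closedin_continuous_maps_eq[OF Hausdorff_space_euclidean]) auto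
  moreover have "compactin ?P C"
    unfolding C_def by (simp add: compactin_PiE compactin_euclidean_iff)
  moreover have "S \<subseteq> C"
    unfolding S_def C_def using entry by (auto simp: PiE_iff extensional_def)
  ultimately have S: "compactin ?P S"
    by (metis closed_compactin)
  have "continuous_map (subtopology ?P S) (unitary_topology n) (\<lambda>v. mat n n v)"
  proof (rule continuous_map_into_unitary)
    show "mat n n v \<in> carrier (unitary_group n)" if "v \<in> topspace (subtopology ?P S)" for v
      using that by (auto simp: S_def h0)
    show "continuous_map (subtopology ?P S) euclidean (\<lambda>v. mat n n v $$ (i, j))" if "i < n" "j < n" for i j
      using that continuous_map_from_subtopology[OF continuous_map_product_projection[of "(i, j)" "{..<n} \<times> {..<n}"]]
      by simp
  qed
  then have "compactin (unitary_topology n) ((\<lambda>v. mat n n v) ` S)"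
    using S by (intro image_compactin[of "subtopology ?P S"]) (auto simp: compactin_subtopology)
  moreover have "carrier (unitary_group n) \<subseteq> (\<lambda>v. mat n n v) ` S"
  proof
    fix A assume A: "A \<in> carrier (unitary_group n)"
    let ?v = "\<lambda>p\<in>{..<n} \<times> {..<n}. A $$ p"
    have "mat n n ?v = A"
      using unitary_carrier_mat[OF A] by (intro eq_matI) auto
    moreover have "?v \<in> S"
      unfolding S_def using calculation A by (auto simp: h0)
    ultimately show "A \<in> (\<lambda>v. mat n n v) ` S" by (metis image_eqI)
  qed
  ultimately show ?thesis
    unfolding compact_space_def
    by (metis compactin_subset_topspace subset_antisym topspace_unitary_topology)
qed

lemma continuous_map_unitary_mult:
  "continuous_map (prod_topology (unitary_topology n) (unitary_topology n)) (unitary_topology n)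
     (\<lambda>(A, B). A \<otimes>\<^bsub>unitary_group n\<^esub> B)"
proof (rule continuous_map_into_unitary)
  fix x assume "x \<in> topspace (prod_topology (unitary_topology n) (unitary_topology n))"
  then show "(case x of (A, B) \<Rightarrow> A \<otimes>\<^bsub>unitary_group n\<^esub> B) \<in> carrier (unitary_group n)"
    using group.is_monoid[OF group_unitary_group, of n] by (auto intro: monoid.m_closed)
next
  fix i j assume ij: "i < n" "j < n"
  let ?X = "prod_topology (unitary_topology n) (unitary_topology n)"
  have "continuous_map ?X euclidean (\<lambda>x. \<Sum>s<n. fst x $$ (i, s) * snd x $$ (s, j))"
    using ij continuous_map_compose[OF continuous_map_fst continuous_map_unitary_entry]
      continuous_map_compose[OF continuous_map_snd continuous_map_unitary_entry]
    by (intro continuous_map_sum continuous_map_mult_complex) (auto simp: o_def)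
  moreover have "(\<Sum>s<n. fst x $$ (i, s) * snd x $$ (s, j)) = (case x of (A, B) \<Rightarrow> A \<otimes>\<^bsub>unitary_group n\<^esub> B) $$ (i, j)"
    if x: "x \<in> topspace ?X" for x
  proof -
    obtain A B where [simp]: "x = (A, B)" and "A \<in> carrier (unitary_group n)" "B \<in> carrier (unitary_group n)"
      using x by auto
    then have "(A * B) $$ (i, j) = (\<Sum>s<n. A $$ (i, s) * B $$ (s, j))"
      using ij by (intro index_mult_mat_sum) (auto intro: unitary_carrier_mat)
    then show ?thesis
      by (simp add: unitary_group_def del: index_mult_mat)
  qed
  ultimately show "continuous_map ?X euclidean (\<lambda>x. (case x of (A, B) \<Rightarrow> A \<otimes>\<^bsub>unitary_group n\<^esub> B) $$ (i, j))"
    by (rule continuous_map_eq)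
qed

section \<open>Products of unitary groups\<close>

lemma topspace_unitary_product_topology [simp]:
  "topspace (unitary_product_topology I n) = carrier (unitary_product_group I n)"
  by (simp add: unitary_product_topology_def unitary_product_group_def)

lemma group_unitary_product_group: "group (unitary_product_group I n)"
  by (simp add: unitary_product_group_def group_unitary_group)

lemma compact_unitary_product_topology: "compact_space (unitary_product_topology I n)"
  unfolding unitary_product_topology_def
  by (simp add: compact_space_product_topology compact_unitary_topology)

lemma Hausdorff_unitary_product_topology: "Hausdorff_space (unitary_product_topology I n)"
  unfolding unitary_product_topology_def
  by (simp add: Hausdorff_space_product_topology Hausdorff_unitary_topology)

lemma continuous_map_unitary_product_mult:
  "continuous_map (prod_topology (unitary_product_topology I n) (unitary_product_topology I n))
     (unitary_product_topology I n) (\<lambda>(x, y). x \<otimes>\<^bsub>unitary_product_group I n\<^esub> y)"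
proof -
  let ?T = "unitary_product_topology I n"
  have "continuous_map (prod_topology ?T ?T) (unitary_topology (n i))
      (\<lambda>p. (case p of (x, y) \<Rightarrow> x \<otimes>\<^bsub>unitary_product_group I n\<^esub> y) i)" if i: "i \<in> I" for i
  proof -
    have pr: "continuous_map ?T (unitary_topology (n i)) (\<lambda>x. x i)"
      unfolding unitary_product_topology_def using i by (rule continuous_map_product_projection)
    have "continuous_map (prod_topology ?T ?T) (prod_topology (unitary_topology (n i)) (unitary_topology (n i)))
        (\<lambda>p. (fst p i, snd p i))"
      using continuous_map_compose[OF continuous_map_fst pr] continuous_map_compose[OF continuous_map_snd pr]
      by (intro continuous_map_pairedI) (auto simp: o_def)
    from continuous_map_compose[OF this continuous_map_unitary_mult]
    show ?thesis
      using i by (simp add: o_def case_prod_beta unitary_product_group_def)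
  qed
  then show ?thesis
    unfolding unitary_product_topology_def continuous_map_componentwise
    by (auto simp: unitary_product_group_def product_group_def unitary_product_topology_def
        intro: monoid.m_closed[OF group.is_monoid[OF group_unitary_group]])
qed

text \<open>The left side is an entry of \<open>s i * mat_adjoint (mat_adjoint (x i) * s i)\<close>,
  where \<open>s i\<close> cancels because it is unitary. The value is the same for every
  \<open>s\<close>, so integration over \<open>s\<close> contributes only the total mass.\<close>

lemma unitary_coordinate_translate:
  assumes x: "x \<in> carrier (unitary_product_group I n)" and s: "s \<in> carrier (unitary_product_group I n)"
    and i: "i \<in> I" and kl: "k < n i" "l < n i"
  shows "(\<Sum>r<n i. cnj ((inv\<^bsub>unitary_product_group I n\<^esub> x \<otimes>\<^bsub>unitary_product_group I n\<^esub> s) i $$ (l, r)) *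
           s i $$ (k, r)) = x i $$ (k, l)"
proof -
  have xi: "x i \<in> carrier (unitary_group (n i))" and si: "s i \<in> carrier (unitary_group (n i))"
    using x s i by (auto simp: unitary_product_group_def PiE_iff)
  note X = unitary_carrier_mat[OF xi] and S = unitary_carrier_mat[OF si]
  have A: "mat_adjoint (x i) * s i \<in> carrier_mat (n i) (n i)"
    using X S by (intro mult_carrier_mat) auto
  have "(inv\<^bsub>unitary_product_group I n\<^esub> x \<otimes>\<^bsub>unitary_product_group I n\<^esub> s) i = mat_adjoint (x i) * s i"
    using x i xi inv_unitary_group[OF xi]
    by (simp add: unitary_product_group_def group_unitary_group) (simp add: unitary_group_def)
  moreover have "(\<Sum>r<n i. cnj ((mat_adjoint (x i) * s i) $$ (l, r)) * s i $$ (k, r)) =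
      (s i * mat_adjoint (mat_adjoint (x i) * s i)) $$ (k, l)"
  proof -
    have "(s i * mat_adjoint (mat_adjoint (x i) * s i)) $$ (k, l) =
        (\<Sum>r<n i. s i $$ (k, r) * mat_adjoint (mat_adjoint (x i) * s i) $$ (r, l))"
      using A S kl by (intro index_mult_mat_sum) auto
    also have "\<dots> = (\<Sum>r<n i. cnj ((mat_adjoint (x i) * s i) $$ (l, r)) * s i $$ (k, r))"
      using A kl by (intro sum.cong refl) (simp add: carrier_matD mult.commute del: index_mult_mat)
    finally show ?thesis by simp
  qed
  moreover have "s i * mat_adjoint (mat_adjoint (x i) * s i) = x i"
  proof -
    have "s i * mat_adjoint (mat_adjoint (x i) * s i) = s i * (mat_adjoint (s i) * x i)"
      using mat_adjoint_mult[OF mat_adjoint_carrier[OF X] S] by simp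
    also have "\<dots> = (s i * mat_adjoint (s i)) * x i"
      using X S by (intro assoc_mult_mat[symmetric]) auto
    also have "\<dots> = x i"
      using X by (simp add: unitary_mult_adjoint[OF si])
    finally show ?thesis .
  qed
  ultimately show ?thesis by simp
qed

section \<open>Inner product spaces and preduals\<close>

text \<open>A complex semi-inner product on a \<open>hilbert\<close> record, the setting of all
  estimates on vector functionals; \<open>L2_space\<close> is the instance.\<close>

locale inner_space = abelian_group H for H :: "'h hilbert" (structure) +
  assumes smult_closed [simp, intro]: "x \<in> carrier H \<Longrightarrow> c \<odot> x \<in> carrier H"
    and smult_add: "\<lbrakk>x \<in> carrier H; y \<in> carrier H\<rbrakk> \<Longrightarrow> c \<odot> (x \<oplus> y) = c \<odot> x \<oplus> c \<odot> y"
    and hinner_add_left: "\<lbrakk>x \<in> carrier H; y \<in> carrier H; z \<in> carrier H\<rbrakk> \<Longrightarrow>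
          hinner H (x \<oplus> y) z = hinner H x z + hinner H y z"
    and hinner_smult_left: "\<lbrakk>x \<in> carrier H; y \<in> carrier H\<rbrakk> \<Longrightarrow>
          hinner H (c \<odot> x) y = c * hinner H x y"
    and hinner_commute: "\<lbrakk>x \<in> carrier H; y \<in> carrier H\<rbrakk> \<Longrightarrow> hinner H y x = cnj (hinner H x y)"
    and hinner_nonneg: "x \<in> carrier H \<Longrightarrow> 0 \<le> Re (hinner H x x)"
begin

lemma hinner_add_right:
  "\<lbrakk>x \<in> carrier H; y \<in> carrier H; z \<in> carrier H\<rbrakk> \<Longrightarrow>
     hinner H x (y \<oplus> z) = hinner H x y + hinner H x z"
  by (metis a_closed complex_cnj_add hinner_add_left hinner_commute)

lemma hinner_smult_right:
  "\<lbrakk>x \<in> carrier H; y \<in> carrier H\<rbrakk> \<Longrightarrow> hinner H x (c \<odot> y) = cnj c * hinner H x y"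
  by (metis smult_closed complex_cnj_mult hinner_smult_left hinner_commute)

lemma hinner_zero_left [simp]: "y \<in> carrier H \<Longrightarrow> hinner H \<zero> y = 0"
  using hinner_add_left[of \<zero> \<zero> y] by simp

lemma hinner_zero_right [simp]: "y \<in> carrier H \<Longrightarrow> hinner H y \<zero> = 0"
  using hinner_add_right[of y \<zero> \<zero>] by simp

lemma smult_zero [simp]: "c \<odot> \<zero> = \<zero>"
  using smult_add[of \<zero> \<zero> c] by (metis add.r_cancel_one' l_zero smult_closed zero_closed)

lemma smult_finsum:
  assumes "finite J" "\<And>j. j \<in> J \<Longrightarrow> x j \<in> carrier H"
  shows "c \<odot> (\<Oplus>j\<in>J. x j) = (\<Oplus>j\<in>J. c \<odot> x j)"
  using assms
proof (induction J rule: finite_induct)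
  case (insert j J)
  have "x \<in> J \<rightarrow> carrier H" "x j \<in> carrier H" "(\<lambda>j. c \<odot> x j) \<in> J \<rightarrow> carrier H"
    using insert.prems by auto
  then show ?case
    using insert by (simp add: smult_add)
qed simp

lemma hinner_finsum_left:
  assumes "finite J" "\<And>j. j \<in> J \<Longrightarrow> x j \<in> carrier H" "y \<in> carrier H"
  shows "hinner H (\<Oplus>j\<in>J. x j) y = (\<Sum>j\<in>J. hinner H (x j) y)"
  using assms
proof (induction J rule: finite_induct)
  case (insert j J)
  have "x \<in> J \<rightarrow> carrier H" "x j \<in> carrier H"
    using insert.prems by auto
  then show ?case
    using insert by (simp add: hinner_add_left)
qed simp

lemma hinner_finsum_right:
  assumes "finite J" "\<And>j. j \<in> J \<Longrightarrow> x j \<in> carrier H" "y \<in> carrier H"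
  shows "hinner H y (\<Oplus>j\<in>J. x j) = (\<Sum>j\<in>J. hinner H y (x j))"
proof -
  have c: "(\<Oplus>j\<in>J. x j) \<in> carrier H"
    using assms by (intro finsum_closed) auto
  have "hinner H y (\<Oplus>j\<in>J. x j) = cnj (\<Sum>j\<in>J. hinner H (x j) y)"
    using assms c by (metis hinner_commute hinner_finsum_left)
  also have "\<dots> = (\<Sum>j\<in>J. hinner H y (x j))"
    unfolding cnj_sum using assms by (intro sum.cong refl) (metis hinner_commute)
  finally show ?thesis .
qed

lemma hinner_self: "x \<in> carrier H \<Longrightarrow> hinner H x x = complex_of_real ((hnorm H x)\<^sup>2)"
  using hinner_commute[of x x] hinner_nonneg[of x]
  by (simp add: hnorm_def complex_eq_iff)

lemma hnorm_nonneg [simp]: "x \<in> carrier H \<Longrightarrow> 0 \<le> hnorm H x"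
  by (simp add: hnorm_def hinner_nonneg)

lemma hnorm_zero [simp]: "hnorm H \<zero> = 0"
  by (simp add: hnorm_def)

lemma hnorm_smult: "x \<in> carrier H \<Longrightarrow> hnorm H (c \<odot> x) = cmod c * hnorm H x"
proof -
  assume x: "x \<in> carrier H"
  have "hinner H (c \<odot> x) (c \<odot> x) = (c * cnj c) * complex_of_real ((hnorm H x)\<^sup>2)"
    using x by (simp add: hinner_smult_left hinner_smult_right hinner_self[OF x] del: of_real_power)
  also have "\<dots> = complex_of_real ((cmod c * hnorm H x)\<^sup>2)"
    by (simp add: power_mult_distrib flip: complex_norm_square)
  finally show ?thesis
    unfolding hnorm_def[of H "c \<odot> x"] using x by (simp del: of_real_mult of_real_power)
qed

lemma Cauchy_Schwarz:
  assumes x: "x \<in> carrier H" and y: "y \<in> carrier H"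
  shows "cmod (hinner H x y) \<le> hnorm H x * hnorm H y"
proof -
  define a where "a = hinner H x y"
  have pos: "0 \<le> (hnorm H x)\<^sup>2 - 2 * t * (cmod a)\<^sup>2 + t\<^sup>2 * (cmod a)\<^sup>2 * (hnorm H y)\<^sup>2" for t :: real
  proof -
    \<comment> \<open>Shifting \<open>x\<close> by this multiple of \<open>y\<close> makes the cross
      terms real, so positivity becomes a real quadratic inequality in \<open>t\<close>.\<close>
    define c where "c = - complex_of_real t * a"
    have aa: "cnj a * a = complex_of_real ((cmod a)\<^sup>2)"
      by (metis complex_norm_square mult.commute)
    have "hinner H (x \<oplus> c \<odot> y) (x \<oplus> c \<odot> y) =
        hinner H x x + cnj c * a + c * cnj a + c * cnj c * hinner H y y"
      using x y hinner_commute[OF x y]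
      by (simp add: a_def hinner_add_left hinner_add_right hinner_smult_left hinner_smult_right algebra_simps)
    also have "\<dots> = complex_of_real ((hnorm H x)\<^sup>2) - 2 * of_real t * (cnj a * a)
        + (of_real t)\<^sup>2 * (cnj a * a) * complex_of_real ((hnorm H y)\<^sup>2)"
      using x y by (simp add: c_def hinner_self algebra_simps power2_eq_square)
    also have "\<dots> = complex_of_real ((hnorm H x)\<^sup>2 - 2 * t * (cmod a)\<^sup>2 + t\<^sup>2 * (cmod a)\<^sup>2 * (hnorm H y)\<^sup>2)"
      unfolding aa by simp
    finally show ?thesis
      using hinner_nonneg[of "x \<oplus> c \<odot> y"] x y by (metis Re_complex_of_real a_closed smult_closed)
  qed
  have "(cmod a)\<^sup>2 \<le> (hnorm H x)\<^sup>2 * (hnorm H y)\<^sup>2"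
  proof (cases "hnorm H y = 0")
    case True
    \<comment> \<open>The form is only semidefinite, so norm 0 is a case of its own: the inequality
      is then affine in \<open>t\<close>, and unless \<open>a = 0\<close> this \<open>t\<close>
      makes its right side negative.\<close>
    then have "0 \<le> (hnorm H x)\<^sup>2 - 2 * (((hnorm H x)\<^sup>2 + 1) / (cmod a)\<^sup>2) * (cmod a)\<^sup>2"
      using pos[of "((hnorm H x)\<^sup>2 + 1) / (cmod a)\<^sup>2"] by simp
    then have "a = 0"
      by (cases "a = 0") (auto, smt (verit) zero_le_power2)
    then show ?thesis by simp
  next
    case False
    have "0 \<le> (hnorm H x)\<^sup>2 - (cmod a)\<^sup>2 / (hnorm H y)\<^sup>2"
      using pos[of "1 / (hnorm H y)\<^sup>2"] False by (simp add: field_simps power2_eq_square)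
    then show ?thesis
      using False by (simp add: field_simps)
  qed
  then show ?thesis
    using x y by (metis a_def hnorm_nonneg mult_nonneg_nonneg power2_le_imp_le power_mult_distrib)
qed

context
  fixes A assumes A: "A \<in> bounded_ops H"
begin

lemma bounded_op_closed [simp, intro]: "x \<in> carrier H \<Longrightarrow> A x \<in> carrier H"
  using A by (auto simp: bounded_ops_def)

lemma bounded_op_add: "\<lbrakk>x \<in> carrier H; y \<in> carrier H\<rbrakk> \<Longrightarrow> A (x \<oplus> y) = A x \<oplus> A y"
  using A by (auto simp: bounded_ops_def)

lemma bounded_op_smult: "x \<in> carrier H \<Longrightarrow> A (c \<odot> x) = c \<odot> A x"
  using A by (auto simp: bounded_ops_def)

lemma bounded_op_zero [simp]: "A \<zero> = \<zero>"
  using bounded_op_add[of \<zero> \<zero>] by (metis add.r_cancel_one' bounded_op_closed l_zero zero_closed)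

lemma bounded_op_finsum:
  assumes "finite J" "\<And>j. j \<in> J \<Longrightarrow> x j \<in> carrier H"
  shows "A (\<Oplus>j\<in>J. x j) = (\<Oplus>j\<in>J. A (x j))"
  using assms
proof (induction J rule: finite_induct)
  case (insert j J)
  have "x \<in> J \<rightarrow> carrier H" "x j \<in> carrier H" "(\<lambda>j. A (x j)) \<in> J \<rightarrow> carrier H"
    using insert.prems by auto
  then show ?case
    using insert by (simp add: bounded_op_add)
qed simp

end

text \<open>The norm tests vectors of the unit ball only; rescaling by \<open>t\<close> turns it
  into an inequality for all vectors.\<close>

lemma operator_mnorm_le_1D:
  assumes A: "A \<in> mats m (bounded_ops H)" and le: "mnorm (operator_opspace H N) m A \<le> 1"
    and x: "\<And>q. q < m \<Longrightarrow> x q \<in> carrier H"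
  shows "(\<Sum>p<m. (hnorm H (\<Oplus>q\<in>{..<m}. A p q (x q)))\<^sup>2) \<le> (\<Sum>q<m. (hnorm H (x q))\<^sup>2)"
proof -
  have Ab: "A p q \<in> bounded_ops H" if "p < m" "q < m" for p q
    using A that by (auto simp: mats_def)
  have Ac: "A p q y \<in> carrier H" if "p < m" "q < m" "y \<in> carrier H" for p q y
    using bounded_op_closed[OF Ab] that by auto
  define a where "a = (\<Sum>q<m. (hnorm H (x q))\<^sup>2)"
  define b where "b = (\<Sum>p<m. (hnorm H (\<Oplus>q\<in>{..<m}. A p q (x q)))\<^sup>2)"
  have a0: "0 \<le> a" and b0: "0 \<le> b"
    by (simp_all add: a_def b_def sum_nonneg)
  have step: "t\<^sup>2 * b \<le> 1" if t: "t > 0" "t\<^sup>2 * a \<le> 1" for t :: real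
  proof -
    let ?x = "\<lambda>q. complex_of_real t \<odot> x q"
    have 1: "L2_set (\<lambda>q. hnorm H (?x q)) {..<m} \<le> 1"
    proof -
      have "(\<Sum>q<m. (hnorm H (?x q))\<^sup>2) = t\<^sup>2 * a"
        unfolding a_def sum_distrib_left
        using x t(1) by (intro sum.cong refl) (simp add: hnorm_smult power_mult_distrib)
      then show ?thesis
        using t by (simp add: L2_set_def)
    qed
    have s: "(\<Oplus>q\<in>{..<m}. A p q (?x q)) = complex_of_real t \<odot> (\<Oplus>q\<in>{..<m}. A p q (x q))" if p: "p < m" for p
    proof -
      have "(\<Oplus>q\<in>{..<m}. A p q (?x q)) = (\<Oplus>q\<in>{..<m}. complex_of_real t \<odot> A p q (x q))"
        using x p by (intro finsum_cong') (auto simp: bounded_op_smult[OF Ab] Ac)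
      then show ?thesis
        using smult_finsum[of "{..<m}" "\<lambda>q. A p q (x q)" "complex_of_real t"] x p Ac by auto
    qed
    have "ennreal (L2_set (\<lambda>p. hnorm H (\<Oplus>q\<in>{..<m}. A p q (?x q))) {..<m}) \<le>
        mnorm (operator_opspace H N) m A"
      unfolding operator_opspace_def opspace.simps using x 1
      by (intro SUP_upper2[where i = ?x] order_refl) simp
    from order_trans[OF this le]
    have 2: "L2_set (\<lambda>p. hnorm H (\<Oplus>q\<in>{..<m}. A p q (?x q))) {..<m} \<le> 1"
      by (simp only: ennreal_le_1)
    have "(\<Sum>p<m. (hnorm H (\<Oplus>q\<in>{..<m}. A p q (?x q)))\<^sup>2) = t\<^sup>2 * b"
      unfolding b_def sum_distrib_left using t(1)
      by (intro sum.cong refl) (auto simp: s hnorm_smult power_mult_distrib x Ac finsum_closed)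
    then show ?thesis
      using 2 by (simp add: L2_set_def)
  qed
  \<comment> \<open>For \<open>a > 0\<close> take \<open>t = 1 / sqrt a\<close>. For
    \<open>a = 0\<close> every \<open>t > 0\<close> is admissible, and
    \<open>t = sqrt (2 / b)\<close> would give \<open>2 \<le> 1\<close>.\<close>
  have "b \<le> a"
  proof (cases "a = 0")
    case True
    show ?thesis
    proof (rule ccontr)
      assume "\<not> b \<le> a"
      then have "b > 0" using True by simp
      then have "(sqrt (2 / b))\<^sup>2 * b \<le> 1"
        using True by (intro step) auto
      then show False using \<open>b > 0\<close> by simp
    qed
  next
    case False
    then have "a > 0" using a0 by simp
    then have "(sqrt (1 / a))\<^sup>2 * b \<le> 1"
      by (intro step) auto
    then show ?thesis using \<open>a > 0\<close> by (simp add: field_simps)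
  qed
  then show ?thesis by (simp add: a_def b_def)
qed

text \<open>A finite family becomes a sequence by padding with \<open>\<zero>\<close>, which bounded
  operators fix.\<close>

lemma finite_sum_in_predual:
  fixes r :: nat
  assumes N: "N \<subseteq> bounded_ops H"
    and xy: "\<And>s. s < r \<Longrightarrow> x s \<in> carrier H \<and> y s \<in> carrier H"
  shows "(\<lambda>A\<in>N. \<Sum>s<r. hinner H (A (x s)) (y s)) \<in> carr (predual_opspace H N)"
proof -
  let ?x = "\<lambda>s::nat. if s < r then x s else \<zero>" and ?y = "\<lambda>s::nat. if s < r then y s else \<zero>"
  have "(\<Sum>s<r. hinner H (A (x s)) (y s)) = (\<Sum>s. hinner H (A (?x s)) (?y s))" if "A \<in> N" for A
  proof -
    have "A \<in> bounded_ops H" using that N by auto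
    then have "(\<Sum>s. hinner H (A (?x s)) (?y s)) = (\<Sum>s<r. hinner H (A (?x s)) (?y s))"
      by (intro suminf_finite) auto
    then show ?thesis by simp
  qed
  moreover have "summable (\<lambda>s. (hnorm H (?x s))\<^sup>2)" "summable (\<lambda>s. (hnorm H (?y s))\<^sup>2)"
    by (rule summable_finite[of "{..<r}"]; simp)+
  moreover have "?x s \<in> carrier H \<and> ?y s \<in> carrier H" for s
    using xy by auto
  ultimately show ?thesis
    unfolding predual_opspace_def opspace.simps mem_Collect_eq
    by (intro exI[of _ ?x] exI[of _ ?y]) (auto simp: restrict_def fun_eq_iff)
qed

section \<open>Completely contractive matrices of functionals from orthonormal families\<close>

context
  fixes f :: "nat \<Rightarrow> nat \<Rightarrow> 'h" and n r :: nat
  assumes f: "\<And>l s. \<lbrakk>l < n; s < r\<rbrakk> \<Longrightarrow> f l s \<in> carrier H"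
    and orthonormal: "\<And>k l. \<lbrakk>k < n; l < n\<rbrakk> \<Longrightarrow>
          (\<Sum>s<r. hinner H (f l s) (f k s)) = (if k = l then 1 else 0)"
begin

text \<open>Parseval: for fixed \<open>l\<close> the family of all \<open>f l s\<close> is one
  vector of the \<open>r\<close>-fold direct sum of \<open>H\<close>, and these \<open>n\<close>
  vectors are orthonormal. So combining them with coefficients \<open>a\<close> is an isometry
  \<open>J\<close> from \<open>n\<close>-space into that sum.\<close>

lemma sum_hnorm_combination:
  "(\<Sum>s<r. (hnorm H (\<Oplus>l\<in>{..<n}. a l \<odot> f l s))\<^sup>2) = (\<Sum>l<n. (cmod (a l))\<^sup>2)"
proof -
  let ?F = "\<lambda>s. \<Oplus>l\<in>{..<n}. a l \<odot> f l s"
  have F: "?F s \<in> carrier H" if "s < r" for s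
    using f that by (intro finsum_closed) auto
  have "complex_of_real (\<Sum>s<r. (hnorm H (?F s))\<^sup>2) = (\<Sum>s<r. hinner H (?F s) (?F s))"
    unfolding of_real_sum using F by (intro sum.cong refl) (simp add: hinner_self)
  also have "\<dots> = (\<Sum>s<r. \<Sum>l<n. \<Sum>k<n. a l * cnj (a k) * hinner H (f l s) (f k s))"
  proof (intro sum.cong refl)
    fix s assume s: "s \<in> {..<r}"
    have "hinner H (?F s) (?F s) = (\<Sum>l<n. hinner H (a l \<odot> f l s) (?F s))"
      using f s F by (intro hinner_finsum_left) auto
    also have "\<dots> = (\<Sum>l<n. \<Sum>k<n. hinner H (a l \<odot> f l s) (a k \<odot> f k s))"
      using f s F by (intro sum.cong refl hinner_finsum_right) auto
    also have "\<dots> = (\<Sum>l<n. \<Sum>k<n. a l * cnj (a k) * hinner H (f l s) (f k s))"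
      using f s by (intro sum.cong refl) (simp add: hinner_smult_left hinner_smult_right)
    finally show "hinner H (?F s) (?F s) = \<dots>" .
  qed
  also have "\<dots> = (\<Sum>l<n. \<Sum>k<n. \<Sum>s<r. a l * cnj (a k) * hinner H (f l s) (f k s))"
    by (subst sum.swap, intro sum.cong refl sum.swap)
  also have "\<dots> = (\<Sum>l<n. \<Sum>k<n. a l * cnj (a k) * (if k = l then 1 else 0))"
    unfolding sum_distrib_left[symmetric] by (intro sum.cong refl) (simp add: orthonormal)
  also have "\<dots> = (\<Sum>l<n. a l * cnj (a l))"
    by (simp add: if_distrib cong: if_cong)
  also have "\<dots> = complex_of_real (\<Sum>l<n. (cmod (a l))\<^sup>2)"
    by (simp flip: complex_norm_square)
  finally show ?thesis
    using of_real_eq_iff by blast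
qed

text \<open>The matrix of functionals is \<open>A \<mapsto> J^* (A \<otimes> 1) J\<close> for the
  isometry \<open>J\<close> above. The adjoint of \<open>J\<close> need not be formed: the squared
  norm \<open>Y\<close> of the output \<open>y\<close> equals the pairing of the amplified image
  with \<open>J y\<close>, hence \<open>Y \<le> sqrt Y\<close> and so
  \<open>Y \<le> 1\<close>.\<close>

lemma predual_mnorm_le_1:
  assumes N: "N \<subseteq> bounded_ops H"
  shows "mnorm (predual_opspace H N) n
           (\<lambda>k l. \<lambda>A\<in>N. \<Sum>s<r. hinner H (A (f l s)) (f k s)) \<le> 1"
proof -
  define \<phi> where "\<phi> = (\<lambda>k l. \<lambda>A\<in>N. \<Sum>s<r. hinner H (A (f l s)) (f k s))"
  have "L2_set (\<lambda>i. cmod (\<Sum>j\<in>{..<m} \<times> {..<n}.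
           (case i of (p, k) \<Rightarrow> \<lambda>(q, l). mat n n (\<lambda>(k, l). \<phi> k l (A p q)) $$ (k, l)) j * z j))
         ({..<m} \<times> {..<n}) \<le> 1"
    if A: "A \<in> mats m N" and le: "mnorm (operator_opspace H N) m A \<le> 1"
      and z: "L2_set (\<lambda>l. cmod (z l)) ({..<m} \<times> {..<n}) \<le> 1" for m A z
  proof -
    have AN: "A p q \<in> N" if "p < m" "q < m" for p q
      using A that by (auto simp: mats_def)
    then have Ab: "A p q \<in> bounded_ops H" if "p < m" "q < m" for p q
      using N that by auto
    have Am: "A \<in> mats m (bounded_ops H)"
      using Ab by (auto simp: mats_def)
    have Ac: "A p q x \<in> carrier H" if "p < m" "q < m" "x \<in> carrier H" for p q x
      using bounded_op_closed[OF Ab] that by auto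
    \<comment> \<open>\<open>F\<close> is \<open>J z\<close> row by row, \<open>B\<close> its image
      under the operator matrix, \<open>y\<close> the output vector in scalar coordinates, and
      \<open>W\<close> is \<open>J y\<close>.\<close>
    define F where "F = (\<lambda>q s. \<Oplus>l\<in>{..<n}. z (q, l) \<odot> f l s)"
    define B where "B = (\<lambda>p s. \<Oplus>q\<in>{..<m}. A p q (F q s))"
    define y where "y = (\<lambda>p k. \<Sum>s<r. hinner H (B p s) (f k s))"
    define W where "W = (\<lambda>p s. \<Oplus>k\<in>{..<n}. y p k \<odot> f k s)"
    define Y where "Y = (\<Sum>p<m. \<Sum>k<n. (cmod (y p k))\<^sup>2)"
    have F: "F q s \<in> carrier H" if "s < r" for q s
      unfolding F_def using f that by (intro finsum_closed) auto
    have B: "B p s \<in> carrier H" if "p < m" "s < r" for p s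
      unfolding B_def using F Ac that by (intro finsum_closed) auto
    have W: "W p s \<in> carrier H" if "s < r" for p s
      unfolding W_def using f that by (intro finsum_closed) auto
    have y: "(\<Sum>(q, l)\<in>{..<m} \<times> {..<n}. \<phi> k l (A p q) * z (q, l)) = y p k"
      if p: "p < m" and k: "k < n" for p k
    proof -
      have *: "hinner H (B p s) (f k s) =
          (\<Sum>q<m. \<Sum>l<n. hinner H (A p q (f l s)) (f k s) * z (q, l))" if s: "s < r" for s
      proof -
        have "hinner H (B p s) (f k s) = (\<Sum>q<m. hinner H (A p q (F q s)) (f k s))"
          unfolding B_def using p k s F Ac f by (intro hinner_finsum_left) auto
        also have "\<dots> = (\<Sum>q<m. \<Sum>l<n. hinner H (A p q (f l s)) (f k s) * z (q, l))"
        proof (intro sum.cong refl)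
          fix q assume "q \<in> {..<m}"
          then have q: "q < m" by simp
          have "A p q (F q s) = (\<Oplus>l\<in>{..<n}. A p q (z (q, l) \<odot> f l s))"
            unfolding F_def using f s by (intro bounded_op_finsum[OF Ab[OF p q]]) auto
          then have "hinner H (A p q (F q s)) (f k s) =
              (\<Sum>l<n. hinner H (A p q (z (q, l) \<odot> f l s)) (f k s))"
            using f s k Ac[OF p q] hinner_finsum_left[of "{..<n}" "\<lambda>l. A p q (z (q, l) \<odot> f l s)" "f k s"]
            by auto
          also have "\<dots> = (\<Sum>l<n. hinner H (A p q (f l s)) (f k s) * z (q, l))"
            using f s k Ac[OF p q]
            by (intro sum.cong refl) (simp add: bounded_op_smult[OF Ab[OF p q]] hinner_smult_left)
          finally show "hinner H (A p q (F q s)) (f k s) = \<dots>" .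
        qed
        finally show ?thesis .
      qed
      have "y p k = (\<Sum>s<r. \<Sum>q<m. \<Sum>l<n. hinner H (A p q (f l s)) (f k s) * z (q, l))"
        unfolding y_def by (intro sum.cong refl) (simp add: *)
      also have "\<dots> = (\<Sum>q<m. \<Sum>l<n. \<Sum>s<r. hinner H (A p q (f l s)) (f k s) * z (q, l))"
        by (subst sum.swap, intro sum.cong refl sum.swap)
      also have "\<dots> = (\<Sum>q<m. \<Sum>l<n. \<phi> k l (A p q) * z (q, l))"
        using AN p by (intro sum.cong refl) (simp add: \<phi>_def sum_distrib_right)
      finally show ?thesis
        by (simp add: sum.cartesian_product)
    qed
    have "complex_of_real Y = (\<Sum>p<m. \<Sum>k<n. \<Sum>s<r. cnj (y p k) * hinner H (B p s) (f k s))"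
      unfolding Y_def of_real_sum complex_norm_square sum_distrib_left[symmetric]
      by (simp add: y_def mult.commute)
    also have "\<dots> = (\<Sum>p<m. \<Sum>s<r. hinner H (B p s) (W p s))"
    proof (rule sum.cong[OF refl])
      fix p assume p: "p \<in> {..<m}"
      have "(\<Sum>k<n. \<Sum>s<r. cnj (y p k) * hinner H (B p s) (f k s)) =
          (\<Sum>s<r. \<Sum>k<n. hinner H (B p s) (y p k \<odot> f k s))"
        using p B f by (subst sum.swap) (intro sum.cong refl, simp add: hinner_smult_right)
      also have "\<dots> = (\<Sum>s<r. hinner H (B p s) (W p s))"
        unfolding W_def using p B f by (intro sum.cong refl hinner_finsum_right[symmetric]) auto
      finally show "(\<Sum>k<n. \<Sum>s<r. cnj (y p k) * hinner H (B p s) (f k s)) = \<dots>" .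
    qed
    also have "\<dots> = (\<Sum>(p, s)\<in>{..<m} \<times> {..<r}. hinner H (B p s) (W p s))"
      by (rule sum.cartesian_product)
    finally have "Y \<le> cmod (\<Sum>(p, s)\<in>{..<m} \<times> {..<r}. hinner H (B p s) (W p s))"
      by (rule subst) simp
    also have "\<dots> \<le> (\<Sum>(p, s)\<in>{..<m} \<times> {..<r}. \<bar>hnorm H (B p s)\<bar> * \<bar>hnorm H (W p s)\<bar>)"
      using B W by (intro sum_norm_le) (auto intro!: Cauchy_Schwarz)
    also have "\<dots> \<le> L2_set (\<lambda>(p, s). hnorm H (B p s)) ({..<m} \<times> {..<r}) *
        L2_set (\<lambda>(p, s). hnorm H (W p s)) ({..<m} \<times> {..<r})"
      using L2_set_mult_ineq[of "\<lambda>(p, s). hnorm H (B p s)" "\<lambda>(p, s). hnorm H (W p s)"]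
      by (simp add: case_prod_beta)
    also have "\<dots> \<le> 1 * sqrt Y"
    proof (intro mult_mono)
      have "(\<Sum>(p, s)\<in>{..<m} \<times> {..<r}. (hnorm H (B p s))\<^sup>2) = (\<Sum>s<r. \<Sum>p<m. (hnorm H (B p s))\<^sup>2)"
        by (subst sum.swap) (simp add: sum.cartesian_product)
      \<comment> \<open>The contraction is applied for each \<open>s\<close> separately; this is the
        amplification.\<close>
      also have "\<dots> \<le> (\<Sum>s<r. \<Sum>q<m. (hnorm H (F q s))\<^sup>2)"
        unfolding B_def using F by (intro sum_mono operator_mnorm_le_1D[OF Am le]) auto
      also have "\<dots> = (\<Sum>q<m. \<Sum>l<n. (cmod (z (q, l)))\<^sup>2)"
        by (subst sum.swap) (simp add: F_def sum_hnorm_combination)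
      also have "\<dots> \<le> 1"
        using z by (simp add: L2_set_def sum.cartesian_product)
      finally show "L2_set (\<lambda>(p, s). hnorm H (B p s)) ({..<m} \<times> {..<r}) \<le> 1"
        by (simp add: L2_set_def case_prod_beta)
      have "(\<Sum>(p, s)\<in>{..<m} \<times> {..<r}. (hnorm H (W p s))\<^sup>2) = Y"
        by (simp add: Y_def W_def sum_hnorm_combination flip: sum.cartesian_product)
      then show "L2_set (\<lambda>(p, s). hnorm H (W p s)) ({..<m} \<times> {..<r}) \<le> sqrt Y"
        by (simp add: L2_set_def case_prod_beta)
    qed (auto simp: L2_set_nonneg)
    finally have "Y \<le> sqrt Y" by simp
    moreover have "0 \<le> Y" by (simp add: Y_def sum_nonneg)
    ultimately have "Y * Y \<le> Y"
      using power_mono[of Y "sqrt Y" 2] by (simp add: power2_eq_square)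
    then have "Y \<le> 1"
      using mult_strict_left_mono[of 1 Y Y] by linarith
    moreover have "(\<Sum>i\<in>{..<m} \<times> {..<n}. (cmod (\<Sum>j\<in>{..<m} \<times> {..<n}.
           (case i of (p, k) \<Rightarrow> \<lambda>(q, l). mat n n (\<lambda>(k, l). \<phi> k l (A p q)) $$ (k, l)) j * z j))\<^sup>2) = Y"
      unfolding Y_def sum.cartesian_product
    proof (intro sum.cong refl)
      fix i assume i: "i \<in> {..<m} \<times> {..<n}"
      then obtain p k where [simp]: "i = (p, k)" and pk: "p < m" "k < n" by auto
      have "(\<Sum>j\<in>{..<m} \<times> {..<n}.
           (case i of (p, k) \<Rightarrow> \<lambda>(q, l). mat n n (\<lambda>(k, l). \<phi> k l (A p q)) $$ (k, l)) j * z j) = y p k"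
        unfolding y[OF pk, symmetric] using pk by (intro sum.cong refl) auto
      then show "(cmod (\<Sum>j\<in>{..<m} \<times> {..<n}.
           (case i of (p, k) \<Rightarrow> \<lambda>(q, l). mat n n (\<lambda>(k, l). \<phi> k l (A p q)) $$ (k, l)) j * z j))\<^sup>2 =
           (case i of (p, k) \<Rightarrow> (cmod (y p k))\<^sup>2)" by simp
    qed
    ultimately show ?thesis
      by (simp add: L2_set_def)
  qed
  moreover have "carr (operator_opspace H N) = N"
    by (simp add: operator_opspace_def)
  ultimately show ?thesis
    unfolding \<phi>_def[symmetric] predual_opspace_def cb_norm_def mat_opspace_def opnorm_def
      opspace.simps
    by (intro SUP_least) (auto simp flip: ennreal_1 intro!: ennreal_leI)
qed

end

end

section \<open>The predual as a vector space and its norms\<close>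

lemma sums_interleave:
  fixes f g :: "nat \<Rightarrow> 'a :: real_normed_vector"
  assumes "f sums a" "g sums b"
  shows "(\<lambda>i. if even i then f (i div 2) else g (i div 2)) sums (a + b)"
proof -
  have sm: "strict_mono (\<lambda>n::nat. 2 * n)" "strict_mono (\<lambda>n::nat. 2 * n + 1)"
    by (simp_all add: strict_mono_def)
  have "(\<lambda>i. if even i then f (i div 2) else 0) sums a"
    by (subst sums_mono_reindex[OF sm(1), symmetric]) (use assms(1) in \<open>auto elim!: evenE\<close>)
  moreover have "(\<lambda>i. if even i then 0 else g (i div 2)) sums b"
    by (subst sums_mono_reindex[OF sm(2), symmetric]) (use assms(2) in \<open>auto elim!: oddE\<close>)
  ultimately have "(\<lambda>i. (if even i then f (i div 2) else 0) + (if even i then 0 else g (i div 2))) sums (a + b)"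
    by (rule sums_add)
  then show ?thesis
    by (rule back_subst[of "\<lambda>h. h sums (a + b)"]) auto
qed

context inner_space
begin

lemma bounded_opE:
  assumes "A \<in> bounded_ops H"
  obtains C where "0 \<le> C" "\<forall>x\<in>carrier H. hnorm H (A x) \<le> C * hnorm H x"
proof -
  obtain C where C: "\<And>x. x \<in> carrier H \<Longrightarrow> hnorm H (A x) \<le> C * hnorm H x"
    using assms unfolding bounded_ops_def by blast
  have "hnorm H (A x) \<le> max C 0 * hnorm H x" if "x \<in> carrier H" for x
    using C[OF that] mult_right_mono[of C "max C 0" "hnorm H x"] that by simp
  then show thesis by (intro that[of "max C 0"]) auto
qed

lemma summable_hinner:
  assumes A: "A \<in> bounded_ops H" and xy: "\<forall>i. x i \<in> carrier H \<and> y i \<in> carrier H"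
    and s: "summable (\<lambda>i::nat. (hnorm H (x i))\<^sup>2)" "summable (\<lambda>i. (hnorm H (y i))\<^sup>2)"
  shows "summable (\<lambda>i. hinner H (A (x i)) (y i))"
proof -
  obtain C where C: "0 \<le> C" "\<forall>x\<in>carrier H. hnorm H (A x) \<le> C * hnorm H x"
    using A by (rule bounded_opE)
  have bound: "cmod (hinner H (A (x i)) (y i)) \<le> C * ((hnorm H (x i))\<^sup>2 + (hnorm H (y i))\<^sup>2)" for i
  proof -
    have "cmod (hinner H (A (x i)) (y i)) \<le> hnorm H (A (x i)) * hnorm H (y i)"
      using xy by (intro Cauchy_Schwarz bounded_op_closed[OF A]) auto
    also have "\<dots> \<le> (C * hnorm H (x i)) * hnorm H (y i)"
      using xy C(2) by (intro mult_right_mono) auto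
    also have "\<dots> = C * (hnorm H (x i) * hnorm H (y i))" by simp
    also have "\<dots> \<le> C * ((hnorm H (x i))\<^sup>2 + (hnorm H (y i))\<^sup>2)"
    proof (rule mult_left_mono[OF _ C(1)])
      have "0 \<le> hnorm H (x i) * hnorm H (y i)" using xy by simp
      then show "hnorm H (x i) * hnorm H (y i) \<le> (hnorm H (x i))\<^sup>2 + (hnorm H (y i))\<^sup>2"
        using sum_squares_bound[of "hnorm H (x i)" "hnorm H (y i)"] by linarith
    qed
    finally show ?thesis .
  qed
  have "summable (\<lambda>i. C * ((hnorm H (x i))\<^sup>2 + (hnorm H (y i))\<^sup>2))"
    by (intro summable_mult summable_add s)
  then show ?thesis
    by (rule summable_comparison_test'[where N = 0]) (rule bound)
qed

lemma predual_carrI: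
  assumes "\<forall>i. x i \<in> carrier H \<and> y i \<in> carrier H"
    and "summable (\<lambda>i::nat. (hnorm H (x i))\<^sup>2)" "summable (\<lambda>i. (hnorm H (y i))\<^sup>2)"
    and "\<phi> = (\<lambda>A\<in>N. \<Sum>i. hinner H (A (x i)) (y i))"
  shows "\<phi> \<in> carr (predual_opspace H N)"
  unfolding predual_opspace_def opspace.simps mem_Collect_eq
  using assms by (intro exI[of _ x] exI[of _ y]) simp

lemma predual_carrE:
  assumes "\<phi> \<in> carr (predual_opspace H N)"
  obtains x y where "\<forall>i. x i \<in> carrier H \<and> y i \<in> carrier H"
    and "summable (\<lambda>i::nat. (hnorm H (x i))\<^sup>2)" "summable (\<lambda>i. (hnorm H (y i))\<^sup>2)"
    and "\<phi> = (\<lambda>A\<in>N. \<Sum>i. hinner H (A (x i)) (y i))"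
  using assms unfolding predual_opspace_def by auto

text \<open>Two pairs of square-summable sequences are merged on even and odd indices, so the sum of
  two functionals is again given by a single pair of sequences.\<close>

lemma predual_add:
  assumes N: "N \<subseteq> bounded_ops H"
    and "\<phi> \<in> carr (predual_opspace H N)" "\<psi> \<in> carr (predual_opspace H N)"
  shows "(\<lambda>A\<in>N. \<phi> A + \<psi> A) \<in> carr (predual_opspace H N)"
proof -
  obtain x y where x: "\<forall>i. x i \<in> carrier H \<and> y i \<in> carrier H"
      "summable (\<lambda>i::nat. (hnorm H (x i))\<^sup>2)" "summable (\<lambda>i. (hnorm H (y i))\<^sup>2)"
    and \<phi>: "\<phi> = (\<lambda>A\<in>N. \<Sum>i. hinner H (A (x i)) (y i))"
    using assms(2) by (rule predual_carrE)
  obtain x' y' where x': "\<forall>i. x' i \<in> carrier H \<and> y' i \<in> carrier H"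
      "summable (\<lambda>i::nat. (hnorm H (x' i))\<^sup>2)" "summable (\<lambda>i. (hnorm H (y' i))\<^sup>2)"
    and \<psi>: "\<psi> = (\<lambda>A\<in>N. \<Sum>i. hinner H (A (x' i)) (y' i))"
    using assms(3) by (rule predual_carrE)
  let ?x = "\<lambda>i. if even i then x (i div 2) else x' (i div 2)"
  let ?y = "\<lambda>i. if even i then y (i div 2) else y' (i div 2)"
  show ?thesis
  proof (rule predual_carrI)
    show "\<forall>i. ?x i \<in> carrier H \<and> ?y i \<in> carrier H"
      using x(1) x'(1) by simp
    show "summable (\<lambda>i. (hnorm H (?x i))\<^sup>2)" "summable (\<lambda>i. (hnorm H (?y i))\<^sup>2)"
      by (rule back_subst[of summable, OF sums_summable[OF sums_interleave[OF summable_sums[OF x(2)] summable_sums[OF x'(2)]]]],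
          force, rule back_subst[of summable, OF sums_summable[OF sums_interleave[OF summable_sums[OF x(3)] summable_sums[OF x'(3)]]]],
          force)
    have "\<phi> A + \<psi> A = (\<Sum>i. hinner H (A (?x i)) (?y i))" if "A \<in> N" for A
    proof -
      have A: "A \<in> bounded_ops H" using N that by auto
      have "(\<lambda>i. if even i then hinner H (A (x (i div 2))) (y (i div 2)) else hinner H (A (x' (i div 2))) (y' (i div 2)))
          sums (\<phi> A + \<psi> A)"
        using that sums_interleave[OF summable_sums[OF summable_hinner[OF A x]] summable_sums[OF summable_hinner[OF A x']]]
        by (simp add: \<phi> \<psi>)
      then have "(\<lambda>i. hinner H (A (?x i)) (?y i)) sums (\<phi> A + \<psi> A)"
        by (rule back_subst[of "\<lambda>h. h sums (\<phi> A + \<psi> A)"]) auto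
      then show ?thesis by (rule sums_unique)
    qed
    then show "(\<lambda>A\<in>N. \<phi> A + \<psi> A) = (\<lambda>A\<in>N. \<Sum>i. hinner H (A (?x i)) (?y i))"
      by (intro restrict_ext) simp
  qed
qed

lemma predual_scale:
  assumes N: "N \<subseteq> bounded_ops H" and "\<phi> \<in> carr (predual_opspace H N)"
  shows "(\<lambda>A\<in>N. c * \<phi> A) \<in> carr (predual_opspace H N)"
proof -
  obtain x y where x: "\<forall>i. x i \<in> carrier H \<and> y i \<in> carrier H"
      "summable (\<lambda>i::nat. (hnorm H (x i))\<^sup>2)" "summable (\<lambda>i. (hnorm H (y i))\<^sup>2)"
    and \<phi>: "\<phi> = (\<lambda>A\<in>N. \<Sum>i. hinner H (A (x i)) (y i))"
    using assms(2) by (rule predual_carrE)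
  show ?thesis
  proof (rule predual_carrI)
    show "\<forall>i. c \<odot> x i \<in> carrier H \<and> y i \<in> carrier H"
      using x(1) by simp
    show "summable (\<lambda>i. (hnorm H (c \<odot> x i))\<^sup>2)"
      using x(1) summable_mult[OF x(2), of "(cmod c)\<^sup>2"] by (simp add: hnorm_smult power_mult_distrib)
    have "c * \<phi> A = (\<Sum>i. hinner H (A (c \<odot> x i)) (y i))" if "A \<in> N" for A
    proof -
      have A: "A \<in> bounded_ops H" using N that by auto
      have "hinner H (A (c \<odot> x i)) (y i) = c * hinner H (A (x i)) (y i)" for i
        using x(1) by (simp add: bounded_op_smult[OF A] hinner_smult_left bounded_op_closed[OF A])
      then show ?thesis
        using that suminf_mult[OF summable_hinner[OF A x], of c] by (simp add: \<phi>)
    qed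
    then show "(\<lambda>A\<in>N. c * \<phi> A) = (\<lambda>A\<in>N. \<Sum>i. hinner H (A (c \<odot> x i)) (y i))"
      by (intro restrict_ext) simp
  qed (rule x(3))
qed

text \<open>A contraction in \<open>N\<close> is a test element of size 1 for the completely bounded
  norm. For translations this bounds functions pointwise by their Fourier norm, which is the source
  of the lower bound for the cb-Helson constant.\<close>

lemma cmod_le_predual_mnorm:
  assumes N: "N \<subseteq> bounded_ops H" and A: "A \<in> N" and contr: "\<And>x. x \<in> carrier H \<Longrightarrow> hnorm H (A x) \<le> hnorm H x"
  shows "ennreal (cmod (\<phi> 0 0 A)) \<le> mnorm (predual_opspace H N) 1 \<phi>"
proof -
  have Ab: "A \<in> bounded_ops H" using N A by auto
  have "mnorm (operator_opspace H N) 1 (\<lambda>_ _. A) \<le> 1"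
    unfolding operator_opspace_def opspace.simps
  proof (intro SUP_least)
    fix x assume "x \<in> {x. (\<forall>q<1. x q \<in> carrier H) \<and> L2_set (\<lambda>q. hnorm H (x q)) {..<1::nat} \<le> 1}"
    then have x: "x 0 \<in> carrier H" "hnorm H (x 0) \<le> 1"
      by (auto simp: L2_set_def)
    have "(\<Oplus>q\<in>{..<1::nat}. A (x q)) = A (x 0)"
      using x(1) bounded_op_closed[OF Ab] by (simp add: lessThan_Suc)
    then have "L2_set (\<lambda>p. hnorm H (\<Oplus>q\<in>{..<1::nat}. A (x q))) {..<1::nat} \<le> 1"
      using contr[OF x(1)] x bounded_op_closed[OF Ab] by (simp add: L2_set_def)
    then show "ennreal (L2_set (\<lambda>p. hnorm H (\<Oplus>q\<in>{..<1::nat}. A (x q))) {..<1::nat}) \<le> 1"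
      by (simp only: ennreal_le_1)
  qed
  then have 1: "(\<lambda>_ _. A) \<in> {v \<in> mats 1 (carr (operator_opspace H N)). mnorm (operator_opspace H N) 1 v \<le> 1}"
    using A by (simp add: mats_def operator_opspace_def)
  let ?B = "\<lambda>i j. (case i of (p, k) \<Rightarrow> \<lambda>(q, l). mat 1 1 (\<lambda>(k, l). \<phi> k l A) $$ (k, l)) j"
  have "L2_set (\<lambda>i. cmod (\<Sum>j\<in>{..<1::nat} \<times> {..<1::nat}. ?B i j * 1)) ({..<1::nat} \<times> {..<1::nat}) = cmod (\<phi> 0 0 A)"
    by (simp add: L2_set_def lessThan_Suc)
  then have "ennreal (cmod (\<phi> 0 0 A)) \<le> opnorm ({..<1::nat} \<times> {..<1::nat}) ?B"
    unfolding opnorm_def by (intro SUP_upper2[where i = "\<lambda>_. 1"]) (simp_all add: L2_set_def lessThan_Suc)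
  also have "\<dots> = mnorm (mat_opspace 1) 1 (\<lambda>k l. mat 1 1 (\<lambda>(k, l). \<phi> k l A))"
    by (simp add: mat_opspace_def)
  also have "\<dots> \<le> mnorm (predual_opspace H N) 1 \<phi>"
    unfolding predual_opspace_def cb_norm_def opspace.simps
    by (rule SUP_upper2[where i = 1, OF UNIV_I], rule SUP_upper2[where i = "\<lambda>_ _. A", OF 1]) (rule order_refl)
  finally show ?thesis .
qed

lemma opnorm_scale_le:
  fixes a :: "'j \<Rightarrow> 'j \<Rightarrow> complex"
  assumes "0 \<le> t"
  shows "opnorm J (\<lambda>i j. of_real t * a i j) \<le> ennreal t * opnorm J a"
  unfolding opnorm_def
proof (rule SUP_least)
  fix z :: "'j \<Rightarrow> complex" assume z: "z \<in> {z. L2_set (\<lambda>l. cmod (z l)) J \<le> 1}"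
  have "(\<Sum>l\<in>J. of_real t * a k l * z l) = of_real t * (\<Sum>l\<in>J. a k l * z l)" for k
    by (simp add: sum_distrib_left mult.assoc)
  then have "L2_set (\<lambda>k. cmod (\<Sum>l\<in>J. of_real t * a k l * z l)) J = t * L2_set (\<lambda>k. cmod (\<Sum>l\<in>J. a k l * z l)) J"
    using assms by (simp add: norm_mult L2_set_right_distrib)
  then show "ennreal (L2_set (\<lambda>k. cmod (\<Sum>l\<in>J. of_real t * a k l * z l)) J) \<le>
      ennreal t * (SUP z\<in>{z. L2_set (\<lambda>l. cmod (z l)) J \<le> 1}. ennreal (L2_set (\<lambda>k. cmod (\<Sum>l\<in>J. a k l * z l)) J))"
    using z assms by (simp add: ennreal_mult L2_set_nonneg) (intro mult_left_mono SUP_upper; simp)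
qed

lemma opnorm_cong:
  assumes "\<And>i j. \<lbrakk>i \<in> J; j \<in> J\<rbrakk> \<Longrightarrow> a i j = b i j"
  shows "opnorm J a = opnorm J b"
  unfolding opnorm_def using assms by (intro SUP_cong refl arg_cong[of _ _ ennreal] L2_set_cong arg_cong[of _ _ cmod] sum.cong) auto

text \<open>Undoes the division by \<open>R\<close> that turns a matrix of functions into a strict
  contraction.\<close>

lemma predual_mnorm_scale_le:
  assumes t: "0 \<le> t"
  shows "mnorm (predual_opspace H N) n (\<lambda>k l. \<lambda>A\<in>N. of_real t * \<phi> k l A) \<le>
           ennreal t * mnorm (predual_opspace H N) n \<phi>"
  unfolding predual_opspace_def cb_norm_def opspace.simps
proof (intro SUP_least)
  fix m A assume A: "A \<in> {v \<in> mats m (carr (operator_opspace H N)). mnorm (operator_opspace H N) m v \<le> 1}"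
  then have AN: "A p q \<in> N" if "p < m" "q < m" for p q
    using that by (auto simp: mats_def operator_opspace_def)
  have "mnorm (mat_opspace n) m (\<lambda>p q. mat n n (\<lambda>(k, l). (\<lambda>A\<in>N. of_real t * \<phi> k l A) (A p q))) =
      opnorm ({..<m} \<times> {..<n}) (\<lambda>i j. of_real t * (case i of (p, k) \<Rightarrow> \<lambda>(q, l). mat n n (\<lambda>(k, l). \<phi> k l (A p q)) $$ (k, l)) j)"
    unfolding mat_opspace_def opspace.simps using AN by (intro opnorm_cong) auto
  also have "\<dots> \<le> ennreal t * mnorm (mat_opspace n) m (\<lambda>p q. mat n n (\<lambda>(k, l). \<phi> k l (A p q)))"
    unfolding mat_opspace_def opspace.simps by (rule opnorm_scale_le[OF t])
  also have "\<dots> \<le> ennreal t * (SUP m. SUP A\<in>{v \<in> mats m (carr (operator_opspace H N)). mnorm (operator_opspace H N) m v \<le> 1}.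
      mnorm (mat_opspace n) m (\<lambda>p q. mat n n (\<lambda>(k, l). \<phi> k l (A p q))))"
    by (intro mult_left_mono SUP_upper2[where i = m, OF UNIV_I] SUP_upper2[where i = A, OF A] order_refl zero_le)
  finally show "mnorm (mat_opspace n) m (\<lambda>p q. mat n n (\<lambda>(k, l). (\<lambda>A\<in>N. of_real t * \<phi> k l A) (A p q))) \<le> \<dots>" .
qed

end

section \<open>The space of square-integrable functions\<close>

lemma sq_integrableD:
  "f \<in> sq_integrable M \<Longrightarrow> f \<in> borel_measurable M"
  "f \<in> sq_integrable M \<Longrightarrow> integrable M (\<lambda>x. (cmod (f x))\<^sup>2)"
  by (auto simp: sq_integrable_def)

lemma sq_integrable_mult:
  assumes "f \<in> sq_integrable M" "g \<in> sq_integrable M"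
  shows "integrable M (\<lambda>x. f x * cnj (g x))"
proof (rule Bochner_Integration.integrable_bound)
  show "integrable M (\<lambda>x. (cmod (f x))\<^sup>2 + (cmod (g x))\<^sup>2)"
    using assms by (intro Bochner_Integration.integrable_add sq_integrableD)
  have cnj_meas: "(\<lambda>x. cnj (g x)) \<in> borel_measurable M"
    using sq_integrableD(1)[OF assms(2)]
    by (rule borel_measurable_continuous_on[OF continuous_on_cnj[OF continuous_on_id]])
  show "(\<lambda>x. f x * cnj (g x)) \<in> borel_measurable M"
    using sq_integrableD(1)[OF assms(1)] cnj_meas by (rule borel_measurable_times)
  have "cmod (f x * cnj (g x)) \<le> (cmod (f x))\<^sup>2 + (cmod (g x))\<^sup>2" for x
  proof -
    have "2 * (cmod (f x) * cmod (g x)) \<le> (cmod (f x))\<^sup>2 + (cmod (g x))\<^sup>2"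
      using sum_squares_bound[of "cmod (f x)" "cmod (g x)"] by (simp add: mult.assoc)
    moreover have "0 \<le> cmod (f x) * cmod (g x)" by simp
    ultimately show ?thesis unfolding norm_mult complex_mod_cnj by linarith
  qed
  then show "AE x in M. norm (f x * cnj (g x)) \<le> norm ((cmod (f x))\<^sup>2 + (cmod (g x))\<^sup>2)"
    by simp
qed

lemma sq_integrable_scale: "f \<in> sq_integrable M \<Longrightarrow> (\<lambda>x. c * f x) \<in> sq_integrable M"
  by (auto simp: sq_integrable_def norm_mult power_mult_distrib intro: borel_measurable_times)

lemma sq_integrable_zero: "(\<lambda>x. 0) \<in> sq_integrable M"
  by (simp add: sq_integrable_def)

lemma sq_integrable_add:
  assumes "f \<in> sq_integrable M" "g \<in> sq_integrable M"
  shows "(\<lambda>x. f x + g x) \<in> sq_integrable M"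
proof -
  note f = sq_integrableD[OF assms(1)] and g = sq_integrableD[OF assms(2)]
  have "integrable M (\<lambda>x. (cmod (f x + g x))\<^sup>2)"
  proof (rule Bochner_Integration.integrable_bound)
    show "integrable M (\<lambda>x. 2 * (cmod (f x))\<^sup>2 + 2 * (cmod (g x))\<^sup>2)"
      using f g by (intro Bochner_Integration.integrable_add integrable_mult_right)
    show "(\<lambda>x. (cmod (f x + g x))\<^sup>2) \<in> borel_measurable M"
      using f(1) g(1) by measurable
    have "(cmod (f x + g x))\<^sup>2 \<le> 2 * (cmod (f x))\<^sup>2 + 2 * (cmod (g x))\<^sup>2" for x
    proof -
      have "(cmod (f x + g x))\<^sup>2 \<le> (cmod (f x) + cmod (g x))\<^sup>2"
        by (intro power_mono norm_triangle_ineq) simp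
      also have "\<dots> \<le> 2 * (cmod (f x))\<^sup>2 + 2 * (cmod (g x))\<^sup>2"
        using sum_squares_bound[of "cmod (f x)" "cmod (g x)"] by (simp add: power2_sum)
      finally show ?thesis .
    qed
    then show "AE x in M. norm ((cmod (f x + g x))\<^sup>2) \<le> norm (2 * (cmod (f x))\<^sup>2 + 2 * (cmod (g x))\<^sup>2)"
      by simp
  qed
  then show ?thesis
    using f(1) g(1) by (simp add: sq_integrable_def)
qed

lemma sq_integrable_diff:
  assumes "f \<in> sq_integrable M" "g \<in> sq_integrable M"
  shows "(\<lambda>x. f x - g x) \<in> sq_integrable M"
  using sq_integrable_add[OF assms(1) sq_integrable_scale[OF assms(2), of "-1"]] by simp

lemma ae_class_eqI:
  assumes "AE x in M. f x = g x"
  shows "ae_class M f = ae_class M g"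
  unfolding ae_class_def using assms by (intro Collect_cong conj_cong refl AE_cong_simp iffI)
    (auto elim: AE_mp)

text \<open>\<open>rep\<close> picks a member by choice; all members agree almost everywhere, and
  the operations of \<open>L2_space\<close> see no more than that.\<close>

lemma rep_ae_class:
  assumes "f \<in> sq_integrable M"
  shows "rep (ae_class M f) \<in> sq_integrable M" "AE x in M. rep (ae_class M f) x = f x"
proof -
  have "f \<in> ae_class M f" using assms by (simp add: ae_class_def)
  then have "rep (ae_class M f) \<in> ae_class M f"
    unfolding rep_def by (rule someI[of "\<lambda>g. g \<in> ae_class M f"])
  then show "rep (ae_class M f) \<in> sq_integrable M" "AE x in M. rep (ae_class M f) x = f x"
    by (auto simp: ae_class_def)
qed

lemma ae_class_in_carrier [simp]:
  "f \<in> sq_integrable M \<Longrightarrow> ae_class M f \<in> carrier (L2_space M)"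
  by (simp add: L2_space_def)

lemma L2_carrierE:
  assumes "F \<in> carrier (L2_space M)"
  obtains f where "f \<in> sq_integrable M" "F = ae_class M f"
  using assms by (auto simp: L2_space_def)

lemma L2_add:
  assumes "f \<in> sq_integrable M" "g \<in> sq_integrable M"
  shows "ae_class M f \<oplus>\<^bsub>L2_space M\<^esub> ae_class M g = ae_class M (\<lambda>x. f x + g x)"
proof -
  have "AE x in M. rep (ae_class M f) x + rep (ae_class M g) x = f x + g x"
    using rep_ae_class(2)[OF assms(1)] rep_ae_class(2)[OF assms(2)] by eventually_elim simp
  then show ?thesis
    by (simp add: L2_space_def ae_class_eqI)
qed

lemma L2_smult:
  assumes "f \<in> sq_integrable M"
  shows "c \<odot>\<^bsub>L2_space M\<^esub> ae_class M f = ae_class M (\<lambda>x. c * f x)"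
proof -
  have "AE x in M. c * rep (ae_class M f) x = c * f x"
    using rep_ae_class(2)[OF assms] by eventually_elim simp
  then show ?thesis
    by (simp only: L2_space_def module.simps ae_class_eqI)
qed

lemma L2_zero: "\<zero>\<^bsub>L2_space M\<^esub> = ae_class M (\<lambda>x. 0)"
  by (simp add: L2_space_def)

lemma L2_hinner:
  assumes "f \<in> sq_integrable M" "g \<in> sq_integrable M"
  shows "hinner (L2_space M) (ae_class M f) (ae_class M g) = (LINT x|M. f x * cnj (g x))"
proof -
  let ?f = "rep (ae_class M f)" and ?g = "rep (ae_class M g)"
  have "(LINT x|M. ?f x * cnj (?g x)) = (LINT x|M. f x * cnj (g x))"
  proof (rule integral_cong_AE)
    show "(\<lambda>x. ?f x * cnj (?g x)) \<in> borel_measurable M" "(\<lambda>x. f x * cnj (g x)) \<in> borel_measurable M"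
      using assms rep_ae_class(1) by (auto intro!: borel_measurable_integrable sq_integrable_mult)
    show "AE x in M. ?f x * cnj (?g x) = f x * cnj (g x)"
      using rep_ae_class(2)[OF assms(1)] rep_ae_class(2)[OF assms(2)] by eventually_elim simp
  qed
  then show ?thesis by (simp add: L2_space_def)
qed

lemma L2_hnorm:
  assumes "f \<in> sq_integrable M"
  shows "hnorm (L2_space M) (ae_class M f) = sqrt (LINT x|M. (cmod (f x))\<^sup>2)"
proof -
  have "(LINT x|M. f x * cnj (f x)) = complex_of_real (LINT x|M. (cmod (f x))\<^sup>2)"
    by (simp only: complex_norm_square[symmetric] integral_complex_of_real[symmetric])
  then show ?thesis
    by (simp add: hnorm_def L2_hinner[OF assms assms])
qed

lemma inner_space_L2: "inner_space (L2_space M)"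
proof -
  interpret abelian_group "L2_space M"
  proof (rule abelian_groupI)
    fix x y z assume "x \<in> carrier (L2_space M)" "y \<in> carrier (L2_space M)" "z \<in> carrier (L2_space M)"
    then obtain f g h where [simp]: "x = ae_class M f" "y = ae_class M g" "z = ae_class M h"
      and [simp]: "f \<in> sq_integrable M" "g \<in> sq_integrable M" "h \<in> sq_integrable M"
      by (metis L2_carrierE)
    show "x \<oplus>\<^bsub>L2_space M\<^esub> y \<oplus>\<^bsub>L2_space M\<^esub> z = x \<oplus>\<^bsub>L2_space M\<^esub> (y \<oplus>\<^bsub>L2_space M\<^esub> z)"
      by (simp add: L2_add sq_integrable_add add.assoc)
  next
    fix x y assume "x \<in> carrier (L2_space M)" "y \<in> carrier (L2_space M)"
    then obtain f g where [simp]: "x = ae_class M f" "y = ae_class M g"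
      and [simp]: "f \<in> sq_integrable M" "g \<in> sq_integrable M"
      by (metis L2_carrierE)
    show "x \<oplus>\<^bsub>L2_space M\<^esub> y \<in> carrier (L2_space M)"
      by (simp add: L2_add sq_integrable_add)
    show "x \<oplus>\<^bsub>L2_space M\<^esub> y = y \<oplus>\<^bsub>L2_space M\<^esub> x"
      by (simp add: L2_add add.commute)
  next
    show "\<zero>\<^bsub>L2_space M\<^esub> \<in> carrier (L2_space M)"
      by (simp add: L2_zero sq_integrable_zero)
  next
    fix x assume "x \<in> carrier (L2_space M)"
    then obtain f where [simp]: "x = ae_class M f" and f [simp]: "f \<in> sq_integrable M"
      by (metis L2_carrierE)
    show "\<zero>\<^bsub>L2_space M\<^esub> \<oplus>\<^bsub>L2_space M\<^esub> x = x"
      by (simp add: L2_zero L2_add sq_integrable_zero)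
    have "ae_class M (\<lambda>x. - 1 * f x) \<oplus>\<^bsub>L2_space M\<^esub> x = \<zero>\<^bsub>L2_space M\<^esub>"
      using sq_integrable_scale[OF f, of "-1"] by (simp add: L2_zero L2_add)
    then show "\<exists>y\<in>carrier (L2_space M). y \<oplus>\<^bsub>L2_space M\<^esub> x = \<zero>\<^bsub>L2_space M\<^esub>"
      using sq_integrable_scale[OF f, of "-1"] by (intro bexI) auto
  qed
  show ?thesis
  proof
    fix c and x y z assume "x \<in> carrier (L2_space M)" "y \<in> carrier (L2_space M)" "z \<in> carrier (L2_space M)"
    then obtain f g h where [simp]: "x = ae_class M f" "y = ae_class M g" "z = ae_class M h"
      and [simp]: "f \<in> sq_integrable M" "g \<in> sq_integrable M" "h \<in> sq_integrable M"
      by (metis L2_carrierE)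
    show "hinner (L2_space M) (x \<oplus>\<^bsub>L2_space M\<^esub> y) z = hinner (L2_space M) x z + hinner (L2_space M) y z"
      by (simp add: L2_add L2_hinner sq_integrable_add distrib_right sq_integrable_mult)
  next
    fix c and x y assume "x \<in> carrier (L2_space M)" "y \<in> carrier (L2_space M)"
    then obtain f g where [simp]: "x = ae_class M f" "y = ae_class M g"
      and [simp]: "f \<in> sq_integrable M" "g \<in> sq_integrable M"
      by (metis L2_carrierE)
    show "c \<odot>\<^bsub>L2_space M\<^esub> (x \<oplus>\<^bsub>L2_space M\<^esub> y) = c \<odot>\<^bsub>L2_space M\<^esub> x \<oplus>\<^bsub>L2_space M\<^esub> c \<odot>\<^bsub>L2_space M\<^esub> y"
      by (simp add: L2_add L2_smult sq_integrable_add sq_integrable_scale distrib_left)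
    show "hinner (L2_space M) (c \<odot>\<^bsub>L2_space M\<^esub> x) y = c * hinner (L2_space M) x y"
      by (simp add: L2_smult L2_hinner sq_integrable_scale mult.assoc)
    have "(LINT t|M. g t * cnj (f t)) = (LINT t|M. cnj (f t * cnj (g t)))"
      by (simp add: mult.commute)
    then show "hinner (L2_space M) y x = cnj (hinner (L2_space M) x y)"
      by (simp add: L2_hinner del: complex_cnj_mult)
  next
    fix c and x assume "x \<in> carrier (L2_space M)"
    then obtain f where [simp]: "x = ae_class M f" and f [simp]: "f \<in> sq_integrable M"
      by (metis L2_carrierE)
    show "c \<odot>\<^bsub>L2_space M\<^esub> x \<in> carrier (L2_space M)"
      by (simp add: L2_smult sq_integrable_scale)
    have "(LINT t|M. f t * cnj (f t)) = complex_of_real (LINT t|M. (cmod (f t))\<^sup>2)"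
      by (simp only: complex_norm_square[symmetric] integral_complex_of_real[symmetric])
    then show "0 \<le> Re (hinner (L2_space M) x x)"
      by (simp add: L2_hinner)
  qed
qed

section \<open>Translations on a compact group\<close>

lemma continuous_map_metricI:
  fixes f :: "'a \<Rightarrow> 'b :: metric_space"
  assumes "\<And>x e. \<lbrakk>x \<in> topspace X; e > 0\<rbrakk> \<Longrightarrow> \<exists>U. openin X U \<and> x \<in> U \<and> (\<forall>y\<in>U. dist (f y) (f x) < e)"
  shows "continuous_map X euclidean f"
  unfolding continuous_map_def
proof (intro conjI allI impI)
  fix V :: "'b set" assume "openin euclidean V"
  then have V: "open V" by simp
  have "\<exists>U. openin X U \<and> x \<in> U \<and> U \<subseteq> {x \<in> topspace X. f x \<in> V}" if x: "x \<in> topspace X" "f x \<in> V" for x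
  proof -
    obtain e where "e > 0" "ball (f x) e \<subseteq> V"
      using V x(2) openE by blast
    moreover obtain U where "openin X U" "x \<in> U" "\<And>y. y \<in> U \<Longrightarrow> dist (f y) (f x) < e"
      using assms[OF x(1) \<open>e > 0\<close>] by blast
    ultimately show ?thesis
      using openin_subset[of X U] by (intro exI[of _ U]) (auto simp: dist_commute subset_iff)
  qed
  then show "openin X {x \<in> topspace X. f x \<in> V}"
    by (subst openin_subopen) simp
qed auto

text \<open>Applied with \<open>h = \<bar>f\<bar> f\<close>, this deduces continuity of translation on \<open>L\<^sup>2\<close> from that on \<open>L\<^sup>1\<close>.\<close>

lemma cmod_signed_square_diff:
  fixes a b :: complex
  shows "(cmod (a - b))\<^sup>2 \<le> 2 * cmod (of_real (cmod a) * a - of_real (cmod b) * b)"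
proof (cases "a = b")
  case False
  define d where "d = of_real (cmod a) * a - of_real (cmod b) * b"
  \<comment> \<open>Pairing \<open>d\<close> with \<open>a - b\<close> splits off the remainder
    \<open>(cmod a - cmod b)\<^sup>2 * (cmod a + cmod b)\<close>, which is nonnegative and can be
    discarded. Since \<open>cmod (a - b) \<le> cmod a + cmod b\<close>, the cube of
    \<open>cmod (a - b)\<close> is left on one side, and one factor cancels.\<close>
  have "2 * Re (d * cnj (a - b)) = (cmod a + cmod b) * (cmod (a - b))\<^sup>2
      + (cmod a - cmod b) * ((cmod a)\<^sup>2 - (cmod b)\<^sup>2)"
  proof -
    define p q where "p = cmod a" and "q = cmod b"
    have "2 * Re ((of_real p * a - of_real q * b) * cnj (a - b)) =
        (p + q) * ((Re (a - b))\<^sup>2 + (Im (a - b))\<^sup>2) +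
        (p - q) * ((Re a)\<^sup>2 + (Im a)\<^sup>2 - ((Re b)\<^sup>2 + (Im b)\<^sup>2))"
      by (simp add: algebra_simps power2_eq_square)
    then show ?thesis
      unfolding d_def p_def q_def cmod_power2[symmetric] .
  qed
  moreover have "(cmod a - cmod b) * ((cmod a)\<^sup>2 - (cmod b)\<^sup>2) = (cmod a - cmod b)\<^sup>2 * (cmod a + cmod b)"
    by (simp add: power2_eq_square algebra_simps)
  moreover have "0 \<le> (cmod a - cmod b)\<^sup>2 * (cmod a + cmod b)" by simp
  moreover have "cmod (a - b) * (cmod (a - b))\<^sup>2 \<le> (cmod a + cmod b) * (cmod (a - b))\<^sup>2"
    by (intro mult_right_mono norm_triangle_ineq4) simp
  moreover have "Re (d * cnj (a - b)) \<le> cmod d * cmod (a - b)"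
    by (metis complex_Re_le_cmod complex_mod_cnj norm_mult)
  ultimately have "cmod (a - b) * (cmod (a - b))\<^sup>2 \<le> 2 * (cmod d * cmod (a - b))"
    by linarith
  then have "cmod (a - b) * (cmod (a - b))\<^sup>2 \<le> cmod (a - b) * (2 * cmod d)"
    by (simp add: algebra_simps)
  then have "(cmod (a - b))\<^sup>2 \<le> 2 * cmod d"
    using False by (simp only: mult_le_cancel_left_pos zero_less_norm_iff right_minus_eq not_False_eq_True)
  then show ?thesis by (simp add: d_def)
qed auto

section \<open>Invariance of the Haar measure and the regular representation\<close>

locale compact_haar_group = group G for G :: "('g, 'b) monoid_scheme" (structure) +
  fixes T :: "'g topology" and \<mu> :: "'g measure"
  assumes topspace_eq: "topspace T = carrier G"
    and compact: "compact_space T"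
    and Hausdorff: "Hausdorff_space T"
    and continuous_mult: "continuous_map (prod_topology T T) T (\<lambda>(x, y). x \<otimes> y)"
    and haar: "left_haar_measure G T \<mu>"
begin

lemma space_haar [simp]: "space \<mu> = carrier G"
  using haar topspace_eq by (simp add: left_haar_measure_def)

lemma sets_haar: "sets \<mu> = sigma_sets (carrier G) {U. openin T U}"
  using haar topspace_eq by (simp add: left_haar_measure_def)

lemma openin_sets [intro]: "openin T U \<Longrightarrow> U \<in> sets \<mu>"
  by (auto simp: sets_haar)

lemma openin_carrier: "\<lbrakk>openin T U; x \<in> U\<rbrakk> \<Longrightarrow> x \<in> carrier G"
  using openin_subset topspace_eq by blast

lemma emeasure_lcoset: "\<lbrakk>x \<in> carrier G; A \<in> sets \<mu>\<rbrakk> \<Longrightarrow> emeasure \<mu> (x <# A) = emeasure \<mu> A"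
  using haar by (simp add: left_haar_measure_def)

sublocale finite_measure \<mu>
proof
  have "compactin T (carrier G)"
    using compact topspace_eq by (simp add: compact_space_def)
  moreover have "\<forall>K. compactin T K \<longrightarrow> emeasure \<mu> K < \<infinity>"
    using haar unfolding left_haar_measure_def by blast
  ultimately have "emeasure \<mu> (carrier G) < \<infinity>" by blast
  then show "emeasure \<mu> (space \<mu>) \<noteq> \<infinity>"
    by (simp only: space_haar)
qed

sublocale L2: inner_space "L2_space \<mu>"
  by (rule inner_space_L2)

lemma measure_pos: "0 < measure \<mu> (carrier G)"
proof -
  have "emeasure \<mu> (carrier G) \<noteq> 0"
    using haar space_haar by (auto simp: left_haar_measure_def)
  then show ?thesis
    by (simp add: emeasure_eq_measure zero_less_measure_iff)
qed

lemma continuous_translation: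
  assumes "a \<in> carrier G"
  shows "continuous_map T T (\<lambda>s. a \<otimes> s)"
proof -
  have "continuous_map T (prod_topology T T) (\<lambda>s. (a, s))"
    using assms topspace_eq by (intro continuous_map_pairedI) auto
  from continuous_map_compose[OF this continuous_mult] show ?thesis
    by (simp add: o_def)
qed

lemma measurable_of_continuous:
  fixes f :: "'g \<Rightarrow> 'c :: topological_space"
  assumes "continuous_map T euclidean f"
  shows "f \<in> borel_measurable \<mu>"
proof (rule borel_measurableI)
  fix S :: "'c set" assume "open S"
  then have "openin T {x \<in> topspace T. f x \<in> S}"
    using assms by (auto simp: continuous_map_def)
  then have "{x \<in> topspace T. f x \<in> S} \<in> sets \<mu>" by blast
  moreover have "f -` S \<inter> space \<mu> = {x \<in> topspace T. f x \<in> S}"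
    using topspace_eq by auto
  ultimately show "f -` S \<inter> space \<mu> \<in> sets \<mu>" by simp
qed

text \<open>Cosets as preimages under a translation: this carries invariance of the measure on
  cosets over to invariance under push-forward.\<close>

lemma lcoset_eq_vimage:
  assumes "a \<in> carrier G" "A \<subseteq> carrier G"
  shows "a <# A = (\<lambda>s. inv a \<otimes> s) -` A \<inter> carrier G"
proof
  show "a <# A \<subseteq> (\<lambda>s. inv a \<otimes> s) -` A \<inter> carrier G"
    using assms by (auto simp: l_coset_def m_assoc[symmetric])
  show "(\<lambda>s. inv a \<otimes> s) -` A \<inter> carrier G \<subseteq> a <# A"
  proof
    fix s assume "s \<in> (\<lambda>s. inv a \<otimes> s) -` A \<inter> carrier G"
    then have "s = a \<otimes> (inv a \<otimes> s)" "inv a \<otimes> s \<in> A"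
      using assms by (auto simp: m_assoc[symmetric])
    then show "s \<in> a <# A" by (auto simp: l_coset_def)
  qed
qed

lemma measurable_translation [measurable]:
  assumes "a \<in> carrier G"
  shows "(\<lambda>s. a \<otimes> s) \<in> measurable \<mu> \<mu>"
proof (rule measurable_sigma_sets[OF sets_haar])
  show "{U. openin T U} \<subseteq> Pow (carrier G)"
    using openin_subset topspace_eq by auto
  show "(\<lambda>s. a \<otimes> s) \<in> space \<mu> \<rightarrow> carrier G"
    using assms by auto
  fix U assume "U \<in> {U. openin T U}"
  then have "openin T {s \<in> topspace T. a \<otimes> s \<in> U}"
    using continuous_translation[OF assms] by (auto simp: continuous_map_def)
  moreover have "(\<lambda>s. a \<otimes> s) -` U \<inter> space \<mu> = {s \<in> topspace T. a \<otimes> s \<in> U}"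
    using topspace_eq by auto
  ultimately show "(\<lambda>s. a \<otimes> s) -` U \<inter> space \<mu> \<in> sets \<mu>"
    by auto
qed

lemma lcoset_sets:
  assumes "a \<in> carrier G" "A \<in> sets \<mu>"
  shows "a <# A \<in> sets \<mu>"
proof -
  have "A \<subseteq> carrier G" using sets.sets_into_space[OF assms(2)] by simp
  then show ?thesis
    using measurable_sets[OF measurable_translation[OF inv_closed[OF assms(1)]] assms(2)] assms(1)
    by (simp add: lcoset_eq_vimage)
qed

lemma measure_lcoset: "\<lbrakk>a \<in> carrier G; A \<in> sets \<mu>\<rbrakk> \<Longrightarrow> measure \<mu> (a <# A) = measure \<mu> A"
  by (simp add: measure_def emeasure_lcoset)

lemma distr_translation:
  assumes a: "a \<in> carrier G"
  shows "distr \<mu> \<mu> (\<lambda>s. a \<otimes> s) = \<mu>"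
proof (rule measure_eqI)
  fix A assume "A \<in> sets (distr \<mu> \<mu> (\<lambda>s. a \<otimes> s))"
  then have A: "A \<in> sets \<mu>" by simp
  have "A \<subseteq> carrier G" using sets.sets_into_space[OF A] by simp
  then have "(\<lambda>s. a \<otimes> s) -` A \<inter> space \<mu> = inv a <# A"
    using lcoset_eq_vimage[of "inv a" A] a by simp
  then show "emeasure (distr \<mu> \<mu> (\<lambda>s. a \<otimes> s)) A = emeasure \<mu> A"
    using a A by (simp add: emeasure_distr emeasure_lcoset)
qed simp

lemma integral_translation:
  fixes f :: "'g \<Rightarrow> 'c :: {banach, second_countable_topology}"
  assumes "a \<in> carrier G" "f \<in> borel_measurable \<mu>"
  shows "(LINT s|\<mu>. f (a \<otimes> s)) = (LINT s|\<mu>. f s)"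
  using integral_distr[OF measurable_translation[OF assms(1)] assms(2)]
  by (simp add: distr_translation[OF assms(1)])

lemma integrable_translation:
  fixes f :: "'g \<Rightarrow> 'c :: {banach, second_countable_topology}"
  assumes "a \<in> carrier G" "integrable \<mu> f"
  shows "integrable \<mu> (\<lambda>s. f (a \<otimes> s))"
  using integrable_distr[OF measurable_translation[OF assms(1)], of f] assms
  by (simp add: distr_translation)

lemma sq_integrable_translation:
  assumes "a \<in> carrier G" "f \<in> sq_integrable \<mu>"
  shows "(\<lambda>s. f (a \<otimes> s)) \<in> sq_integrable \<mu>"
  using assms measurable_compose[OF measurable_translation[OF assms(1)]]
    integrable_translation[OF assms(1), of "\<lambda>x. (cmod (f x))\<^sup>2"]
  by (auto simp: sq_integrable_def)

lemma AE_translation: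
  assumes "a \<in> carrier G" "AE s in \<mu>. P s"
  shows "AE s in \<mu>. P (a \<otimes> s)"
proof -
  have "AE s in distr \<mu> \<mu> (\<lambda>s. a \<otimes> s). P s"
    unfolding distr_translation[OF assms(1)] by (rule assms(2))
  then show ?thesis
    by (rule AE_distrD[OF measurable_translation[OF assms(1)]])
qed

abbreviation translate :: "'g \<Rightarrow> ('g \<Rightarrow> complex) set \<Rightarrow> ('g \<Rightarrow> complex) set" where
  "translate \<equiv> left_regular G \<mu>"

text \<open>\<open>left_regular\<close> acts on a chosen representative; translations preserve null
  sets, so any representative may be used instead.\<close>

lemma translate_ae_class:
  assumes "x \<in> carrier G" "f \<in> sq_integrable \<mu>"
  shows "translate x (ae_class \<mu> f) = ae_class \<mu> (\<lambda>s. f (inv x \<otimes> s))"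
proof -
  have "AE s in \<mu>. rep (ae_class \<mu> f) (inv x \<otimes> s) = f (inv x \<otimes> s)"
    using assms rep_ae_class(2) by (intro AE_translation) auto
  then show ?thesis
    using assms by (simp add: left_regular_def ae_class_eqI)
qed

lemma translate_closed:
  assumes "x \<in> carrier G" "F \<in> carrier (L2_space \<mu>)"
  shows "translate x F \<in> carrier (L2_space \<mu>)"
  using assms(2) by (elim L2_carrierE)
    (simp add: translate_ae_class[OF assms(1)] sq_integrable_translation assms(1))

lemma hnorm_translate:
  assumes "x \<in> carrier G" "F \<in> carrier (L2_space \<mu>)"
  shows "hnorm (L2_space \<mu>) (translate x F) = hnorm (L2_space \<mu>) F"
proof -
  obtain f where f: "f \<in> sq_integrable \<mu>" "F = ae_class \<mu> f"
    using assms(2) by (rule L2_carrierE)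
  have "(LINT s|\<mu>. (cmod (f (inv x \<otimes> s)))\<^sup>2) = (LINT s|\<mu>. (cmod (f s))\<^sup>2)"
    using assms(1) f(1) by (intro integral_translation[of "inv x" "\<lambda>s. (cmod (f s))\<^sup>2"])
      (auto simp: sq_integrable_def)
  then show ?thesis
    using assms(1) f by (simp add: translate_ae_class L2_hnorm sq_integrable_translation)
qed

lemma translate_bounded_op:
  assumes x: "x \<in> carrier G"
  shows "translate x \<in> bounded_ops (L2_space \<mu>)"
proof -
  have "translate x \<in> carrier (L2_space \<mu>) \<rightarrow>\<^sub>E carrier (L2_space \<mu>)"
    using translate_closed[OF x] by (auto simp: left_regular_def PiE_iff)
  moreover have "translate x (F \<oplus>\<^bsub>L2_space \<mu>\<^esub> K) = translate x F \<oplus>\<^bsub>L2_space \<mu>\<^esub> translate x K"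
    if "F \<in> carrier (L2_space \<mu>)" "K \<in> carrier (L2_space \<mu>)" for F K
    using that by (elim L2_carrierE)
      (simp add: L2_add sq_integrable_add translate_ae_class sq_integrable_translation x)
  moreover have "translate x (c \<odot>\<^bsub>L2_space \<mu>\<^esub> F) = c \<odot>\<^bsub>L2_space \<mu>\<^esub> translate x F"
    if "F \<in> carrier (L2_space \<mu>)" for c F
    using that by (elim L2_carrierE)
      (simp add: L2_smult sq_integrable_scale translate_ae_class sq_integrable_translation x)
  moreover have "\<exists>C. \<forall>F\<in>carrier (L2_space \<mu>). hnorm (L2_space \<mu>) (translate x F) \<le> C * hnorm (L2_space \<mu>) F"
    using hnorm_translate[OF x] by (intro exI[of _ 1]) simp
  ultimately show ?thesis
    by (simp add: bounded_ops_def)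
qed

text \<open>A set of bounded operators lies in its bicommutant.\<close>

lemma translate_in_VN: "x \<in> carrier G \<Longrightarrow> translate x \<in> VN G \<mu>"
  unfolding VN_def commutant_def by (auto simp: translate_bounded_op)

lemma VN_bounded_ops: "VN G \<mu> \<subseteq> bounded_ops (L2_space \<mu>)"
  by (auto simp: VN_def commutant_def)

section \<open>Regularity of the measure and continuity of translation in the mean\<close>

lemma outer_regular:
  assumes A: "A \<in> sets \<mu>" and e: "e > 0"
  obtains U where "openin T U" "A \<subseteq> U" "measure \<mu> U < measure \<mu> A + e"
proof -
  have "emeasure \<mu> A = (INF U\<in>{U. openin T U \<and> A \<subseteq> U}. emeasure \<mu> U)"
    using haar A by (simp add: left_haar_measure_def)
  moreover have "emeasure \<mu> A < ennreal (measure \<mu> A + e)"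
    using e by (simp add: emeasure_eq_measure ennreal_less_iff)
  ultimately obtain U where U: "openin T U" "A \<subseteq> U" "emeasure \<mu> U < ennreal (measure \<mu> A + e)"
    by (auto simp: INF_less_iff)
  then show thesis
    using that by (simp add: emeasure_eq_measure ennreal_less_iff)
qed

text \<open>Obtained for all measurable sets by applying outer regularity to the complement: closed
  sets are compact here, and the total mass is finite.\<close>

lemma inner_regular:
  assumes A: "A \<in> sets \<mu>" and e: "e > 0"
  obtains K where "compactin T K" "K \<subseteq> A" "K \<in> sets \<mu>" "measure \<mu> A < measure \<mu> K + e"
proof -
  have sub: "A \<subseteq> carrier G" using sets.sets_into_space[OF A] by simp
  have cA: "carrier G - A \<in> sets \<mu>"
    using sets.compl_sets[OF A] by simp
  then obtain W where W: "openin T W" "carrier G - A \<subseteq> W" "measure \<mu> W < measure \<mu> (carrier G - A) + e"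
    using e by (rule outer_regular)
  have "closedin T (carrier G - W)"
    using W(1) topspace_eq by (metis closedin_topspace openin_closedin_eq closedin_diff)
  then have "compactin T (carrier G - W)"
    using compact by (simp add: closedin_compact_space)
  moreover have "carrier G - W \<in> sets \<mu>"
    using sets.compl_sets[of W \<mu>] W(1) by auto
  moreover have "measure \<mu> (carrier G - W) = measure \<mu> (carrier G) - measure \<mu> W"
    using finite_measure_compl[of W] W(1) by auto
  moreover have "measure \<mu> (carrier G - A) = measure \<mu> (carrier G) - measure \<mu> A"
    using finite_measure_compl[OF A] by simp
  ultimately show thesis
    using W sub by (intro that[of "carrier G - W"]) auto
qed

text \<open>Continuity of the map from \<open>x\<close> to the left translate of \<open>h\<close> by
  \<open>x\<close>, with values in L1, spelled out on integrals.\<close>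

definition translation_continuous :: "('g \<Rightarrow> complex) \<Rightarrow> bool" where
  "translation_continuous h \<longleftrightarrow> (\<forall>x\<in>carrier G. \<forall>e>0. \<exists>V. openin T V \<and> x \<in> V \<and>
     (\<forall>y\<in>V. (LINT s|\<mu>. cmod (h (inv y \<otimes> s) - h (inv x \<otimes> s))) < e))"

text \<open>A compact \<open>K\<close> inside \<open>A\<close> and an open \<open>U\<close> around
  the coset of \<open>A\<close> by \<open>x\<close> are chosen with almost the same measure. For
  \<open>y\<close> near \<open>x\<close> the coset of \<open>K\<close> by \<open>y\<close> still
  lies in \<open>U\<close>, so the cosets of \<open>A\<close> by \<open>x\<close> and by
  \<open>y\<close> differ little.\<close>

lemma translation_continuous_indicator:
  assumes A: "A \<in> sets \<mu>"
  shows "translation_continuous (\<lambda>s. indicator A s *\<^sub>R c)"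
  unfolding translation_continuous_def
proof (intro ballI allI impI)
  fix x and e :: real assume x: "x \<in> carrier G" and e: "e > 0"
  \<comment> \<open>The three measures estimated below are less than \<open>d\<close>,
    \<open>d\<close> and \<open>2 * d\<close>, hence the 4. The \<open>+ 1\<close> covers
    \<open>c = 0\<close> and makes the final inequality strict.\<close>
  define d where "d = e / (4 * (cmod c + 1))"
  have "4 * (e / (4 * C)) * C = e" "e / (4 * C) > 0" if "C > 0" for C :: real
    using e that by simp_all
  from this[of "cmod c + 1"] have d: "d > 0" "4 * d * (cmod c + 1) = e"
    unfolding d_def by (simp_all add: add_nonneg_pos)
  obtain K where K: "compactin T K" "K \<subseteq> A" "K \<in> sets \<mu>" "measure \<mu> A < measure \<mu> K + d"
    using inner_regular[OF A d(1)] by metis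
  have xA: "x <# A \<in> sets \<mu>" using x A by (rule lcoset_sets)
  obtain U where U: "openin T U" "x <# A \<subseteq> U" "measure \<mu> U < measure \<mu> (x <# A) + d"
    using outer_regular[OF xA d(1)] by metis
  have AG: "A \<subseteq> carrier G" using sets.sets_into_space[OF A] by simp
  define W where "W = {p \<in> topspace (prod_topology T T). (case p of (a, b) \<Rightarrow> a \<otimes> b) \<in> U}"
  have "openin (prod_topology T T) W"
    unfolding W_def using continuous_mult U(1) by (auto simp: continuous_map_def)
  moreover have "{x} \<times> K \<subseteq> W"
    using K(2) U(2) AG x by (auto simp: W_def topspace_eq l_coset_def)
  moreover have "compactin T {x}"
    using x topspace_eq by simp
  \<comment> \<open>The tube lemma around \<open>{x} \<times> K\<close> inside the preimage of
    \<open>U\<close> under multiplication.\<close>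
  ultimately obtain V V' where V: "openin T V" "x \<in> V" "K \<subseteq> V'" "V \<times> V' \<subseteq> W"
    using Wallace_theorem_prod_topology[of T "{x}" T K W] K(1) by (metis insert_subset)
  have "(LINT s|\<mu>. cmod (indicator A (inv y \<otimes> s) *\<^sub>R c - indicator A (inv x \<otimes> s) *\<^sub>R c)) < e"
    if y: "y \<in> V" for y
  proof -
    have yG: "y \<in> carrier G" using y V(1) by (blast intro: openin_carrier)
    have "y \<otimes> k \<in> U" if "k \<in> K" for k
    proof -
      have "(y, k) \<in> W" using y V(3,4) that by blast
      then show ?thesis by (simp add: W_def)
    qed
    then have yK: "y <# K \<subseteq> U" by (auto simp: l_coset_def)
    have yKA: "y <# K \<subseteq> y <# A" using K(2) by (auto simp: l_coset_def)
    have yA: "y <# A \<in> sets \<mu>" and yKs: "y <# K \<in> sets \<mu>" and Us: "U \<in> sets \<mu>"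
      using yG A K(3) U(1) by (auto intro: lcoset_sets)
    \<comment> \<open>A point of \<open>y <# A\<close> outside \<open>x <# A\<close> lies in
      \<open>(y <# A) - (y <# K)\<close> or in \<open>U - (x <# A)\<close>; a point of
      \<open>x <# A\<close> outside \<open>y <# A\<close> lies in
      \<open>U - (y <# K)\<close>.\<close>
    let ?g = "\<lambda>s. cmod c * (indicator ((y <# A) - (y <# K)) s + indicator (U - (x <# A)) s + indicator (U - (y <# K)) s) :: real"
    have ind: "indicator A (inv a \<otimes> s) = (indicator (a <# A) s :: real)"
      if "a \<in> carrier G" "s \<in> carrier G" for a s
      using that lcoset_eq_vimage[OF that(1) AG] by (auto simp: indicator_def)
    have int: "integrable \<mu> ?g"
      using yA yKs Us xA by (intro integrable_mult_right Bochner_Integration.integrable_add)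
        (auto intro!: integrable_real_indicator simp: emeasure_eq_measure)
    have "(LINT s|\<mu>. cmod (indicator A (inv y \<otimes> s) *\<^sub>R c - indicator A (inv x \<otimes> s) *\<^sub>R c)) \<le> (LINT s|\<mu>. ?g s)"
    proof (rule integral_mono')
      show "integrable \<mu> ?g" by (rule int)
      fix s assume "s \<in> space \<mu>"
      then have s: "s \<in> carrier G" by simp
      show "cmod (indicator A (inv y \<otimes> s) *\<^sub>R c - indicator A (inv x \<otimes> s) *\<^sub>R c) \<le> ?g s"
        unfolding ind[OF yG s] ind[OF x s] using yKA yK U(2)
        by (auto simp: indicator_def)
    qed (simp add: mult_nonneg_nonneg)
    also have "\<dots> = cmod c * (measure \<mu> ((y <# A) - (y <# K)) + measure \<mu> (U - (x <# A)) + measure \<mu> (U - (y <# K)))"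
    proof -
      have "(y <# A) - (y <# K) \<in> sets \<mu>" "U - (x <# A) \<in> sets \<mu>" "U - (y <# K) \<in> sets \<mu>"
        using yA yKs Us xA by auto
      then have "has_bochner_integral \<mu> ?g (cmod c * (measure \<mu> ((y <# A) - (y <# K)) + measure \<mu> (U - (x <# A)) + measure \<mu> (U - (y <# K))))"
        by (intro has_bochner_integral_mult_right has_bochner_integral_add)
          (auto intro!: has_bochner_integral_real_indicator simp: emeasure_eq_measure)
      then show ?thesis by (rule has_bochner_integral_integral_eq)
    qed
    also have "measure \<mu> ((y <# A) - (y <# K)) = measure \<mu> A - measure \<mu> K"
      using finite_measure_Diff[OF yA yKs yKA] yG A K(3) by (simp add: measure_lcoset)
    also have "measure \<mu> (U - (x <# A)) = measure \<mu> U - measure \<mu> A"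
      using finite_measure_Diff[OF Us xA U(2)] x A by (simp add: measure_lcoset)
    also have "measure \<mu> (U - (y <# K)) = measure \<mu> U - measure \<mu> K"
      using finite_measure_Diff[OF Us yKs yK] yG K(3) by (simp add: measure_lcoset)
    also have "cmod c * (measure \<mu> A - measure \<mu> K + (measure \<mu> U - measure \<mu> A) + (measure \<mu> U - measure \<mu> K)) \<le> cmod c * (4 * d)"
      using K(4) U(3) x A by (intro mult_left_mono) (auto simp: measure_lcoset)
    also have "\<dots> < e"
      using d by (simp add: algebra_simps)
    finally show ?thesis .
  qed
  then show "\<exists>V. openin T V \<and> x \<in> V \<and>
      (\<forall>y\<in>V. (LINT s|\<mu>. cmod (indicator A (inv y \<otimes> s) *\<^sub>R c - indicator A (inv x \<otimes> s) *\<^sub>R c)) < e)"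
    using V by blast
qed

lemma integrable_translation_diff:
  assumes "integrable \<mu> h" "x \<in> carrier G" "y \<in> carrier G"
  shows "integrable \<mu> (\<lambda>s. cmod (h (inv y \<otimes> s) - h (inv x \<otimes> s)))"
  using assms by (intro Bochner_Integration.integrable_norm Bochner_Integration.integrable_diff integrable_translation) auto

text \<open>The property passes from indicators to sums and then to limits in L1, the latter because
  translation preserves L1 distances.\<close>

lemma translation_continuous_integrable:
  assumes "integrable \<mu> h"
  shows "translation_continuous h"
  using assms
proof (induction rule: integrable_induct)
  case (base A c)
  then show ?case by (intro translation_continuous_indicator)
next
  case (add f g)
  show ?case
    unfolding translation_continuous_def
  proof (intro ballI allI impI)
    fix x and e :: real assume x: "x \<in> carrier G" and "e > 0"
    then have e: "e / 2 > 0" by simp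
    obtain V where V: "openin T V" "x \<in> V"
        "\<And>y. y \<in> V \<Longrightarrow> (LINT s|\<mu>. cmod (f (inv y \<otimes> s) - f (inv x \<otimes> s))) < e / 2"
      using add.IH(1) x e unfolding translation_continuous_def by meson
    obtain W where W: "openin T W" "x \<in> W"
        "\<And>y. y \<in> W \<Longrightarrow> (LINT s|\<mu>. cmod (g (inv y \<otimes> s) - g (inv x \<otimes> s))) < e / 2"
      using add.IH(2) x e unfolding translation_continuous_def by meson
    have "(LINT s|\<mu>. cmod (f (inv y \<otimes> s) + g (inv y \<otimes> s) - (f (inv x \<otimes> s) + g (inv x \<otimes> s)))) < e"
      if y: "y \<in> V \<inter> W" for y
    proof -
      have yG: "y \<in> carrier G" using y V(1) by (blast intro: openin_carrier)
      note fi = integrable_translation_diff[OF add.hyps(1) x yG] and gi = integrable_translation_diff[OF add.hyps(2) x yG]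
      have "(LINT s|\<mu>. cmod (f (inv y \<otimes> s) + g (inv y \<otimes> s) - (f (inv x \<otimes> s) + g (inv x \<otimes> s)))) \<le>
          (LINT s|\<mu>. cmod (f (inv y \<otimes> s) - f (inv x \<otimes> s)) + cmod (g (inv y \<otimes> s) - g (inv x \<otimes> s)))"
        using fi gi by (intro integral_mono' Bochner_Integration.integrable_add norm_diff_triangle_ineq) auto
      also have "\<dots> = (LINT s|\<mu>. cmod (f (inv y \<otimes> s) - f (inv x \<otimes> s))) + (LINT s|\<mu>. cmod (g (inv y \<otimes> s) - g (inv x \<otimes> s)))"
        using fi gi by (rule Bochner_Integration.integral_add)
      also have "\<dots> < e"
        using V(3)[of y] W(3)[of y] y by auto
      finally show ?thesis .
    qed
    then show "\<exists>V. openin T V \<and> x \<in> V \<and>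
        (\<forall>y\<in>V. (LINT s|\<mu>. cmod (f (inv y \<otimes> s) + g (inv y \<otimes> s) - (f (inv x \<otimes> s) + g (inv x \<otimes> s)))) < e)"
      using V W by (intro exI[of _ "V \<inter> W"]) auto
  qed
next
  case (lim f h)
  show ?case
    unfolding translation_continuous_def
  proof (intro ballI allI impI)
    fix x and e :: real assume x: "x \<in> carrier G" and "e > 0"
    then have e: "e / 3 > 0" by simp
    have "(\<lambda>i. LINT s|\<mu>. cmod (h i s - f s)) \<longlonglongrightarrow> (LINT s|\<mu>. 0)"
    proof (rule integral_dominated_convergence)
      \<comment> \<open>The approximants satisfy \<open>cmod (h i s) \<le> 2 * cmod (f s)\<close>,
        hence the factor 3.\<close>
      show "integrable \<mu> (\<lambda>s. 3 * cmod (f s))"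
        using lim.hyps(4) by simp
      have "(\<lambda>i. cmod (h i s - f s)) \<longlonglongrightarrow> 0" if "s \<in> space \<mu>" for s
        using lim.hyps(2)[OF that] by (intro tendsto_norm_zero LIM_zero)
      then show "AE s in \<mu>. (\<lambda>i. cmod (h i s - f s)) \<longlonglongrightarrow> 0" by (rule AE_I2)
      have bound: "cmod (h i s - f s) \<le> 3 * cmod (f s)" if "s \<in> space \<mu>" for i s
        using lim.hyps(3)[OF that, of i] norm_triangle_ineq4[of "h i s" "f s"] by linarith
      show "AE s in \<mu>. norm (cmod (h i s - f s)) \<le> 3 * cmod (f s)" for i
        by (rule AE_I2) (simp only: real_norm_def abs_norm_cancel bound)
      show "(\<lambda>s. cmod (h i s - f s)) \<in> borel_measurable \<mu>" for i
        using lim.hyps(1)[of i] lim.hyps(4) by measurable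
    qed simp
    then have "\<forall>\<^sub>F i in sequentially. (LINT s|\<mu>. cmod (h i s - f s)) < e / 3"
      using e by (intro order_tendstoD(2)) auto
    then obtain i where i: "(LINT s|\<mu>. cmod (h i s - f s)) < e / 3"
      by (auto simp: eventually_sequentially)
    obtain V where V: "openin T V" "x \<in> V"
        "\<And>y. y \<in> V \<Longrightarrow> (LINT s|\<mu>. cmod (h i (inv y \<otimes> s) - h i (inv x \<otimes> s))) < e / 3"
      using lim.IH[of i] x e unfolding translation_continuous_def by meson
    have d: "integrable \<mu> (\<lambda>s. cmod (h i s - f s))"
      using lim.hyps(1)[of i] lim.hyps(4) by simp
    have "(LINT s|\<mu>. cmod (f (inv y \<otimes> s) - f (inv x \<otimes> s))) < e" if y: "y \<in> V" for y
    proof -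
      have yG: "y \<in> carrier G" using y V(1) by (blast intro: openin_carrier)
      have dt: "integrable \<mu> (\<lambda>s. cmod (h i (inv a \<otimes> s) - f (inv a \<otimes> s)))" if "a \<in> carrier G" for a
        by (rule integrable_translation[OF inv_closed[OF that] d])
      have dI: "(LINT s|\<mu>. cmod (h i (inv a \<otimes> s) - f (inv a \<otimes> s))) < e / 3" if "a \<in> carrier G" for a
        using i unfolding integral_translation[OF inv_closed[OF that] borel_measurable_integrable[OF d]] .
      note hi = integrable_translation_diff[OF lim.hyps(1)[of i] x yG]
      have "(LINT s|\<mu>. cmod (f (inv y \<otimes> s) - f (inv x \<otimes> s))) \<le>
          (LINT s|\<mu>. cmod (h i (inv y \<otimes> s) - f (inv y \<otimes> s)) + cmod (h i (inv x \<otimes> s) - f (inv x \<otimes> s))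
             + cmod (h i (inv y \<otimes> s) - h i (inv x \<otimes> s)))"
      proof (rule integral_mono')
        fix s
        have *: "cmod (- p + q + r) \<le> cmod p + cmod q + cmod r" for p q r
          using norm_triangle_ineq[of "- p + q" r] norm_triangle_ineq[of "- p" q] by simp
        show "cmod (f (inv y \<otimes> s) - f (inv x \<otimes> s)) \<le> cmod (h i (inv y \<otimes> s) - f (inv y \<otimes> s)) + cmod (h i (inv x \<otimes> s) - f (inv x \<otimes> s))
             + cmod (h i (inv y \<otimes> s) - h i (inv x \<otimes> s))"
          using *[of "h i (inv y \<otimes> s) - f (inv y \<otimes> s)" "h i (inv x \<otimes> s) - f (inv x \<otimes> s)" "h i (inv y \<otimes> s) - h i (inv x \<otimes> s)"]
          by simp
      qed (use hi dt[OF x] dt[OF yG] in auto)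
      also have "\<dots> = (LINT s|\<mu>. cmod (h i (inv y \<otimes> s) - f (inv y \<otimes> s))) + (LINT s|\<mu>. cmod (h i (inv x \<otimes> s) - f (inv x \<otimes> s)))
             + (LINT s|\<mu>. cmod (h i (inv y \<otimes> s) - h i (inv x \<otimes> s)))"
        using hi dt[OF x] dt[OF yG] by simp
      also have "\<dots> < e"
        using V(3)[OF y] dI[OF x] dI[OF yG] by linarith
      finally show ?thesis .
    qed
    then show "\<exists>V. openin T V \<and> x \<in> V \<and> (\<forall>y\<in>V. (LINT s|\<mu>. cmod (f (inv y \<otimes> s) - f (inv x \<otimes> s))) < e)"
      using V by blast
  qed
qed

end

section \<open>The Fourier algebra and its restriction to a closed set\<close>

context compact_haar_group
begin

text \<open>The squared L2 distance of two translates of \<open>f\<close> is at most twice the L1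
  distance of the translates of \<open>h\<close>; Cauchy-Schwarz passes from vectors to
  coefficients.\<close>

lemma coefficient_continuous:
  assumes F: "F \<in> carrier (L2_space \<mu>)" and K: "K \<in> carrier (L2_space \<mu>)"
  shows "continuous_map T euclidean (\<lambda>x. hinner (L2_space \<mu>) (translate x F) K)"
proof (rule continuous_map_metricI)
  fix x and e :: real assume "x \<in> topspace T" and e: "e > 0"
  then have x: "x \<in> carrier G" by (simp add: topspace_eq)
  obtain f where f: "f \<in> sq_integrable \<mu>" and Ff: "F = ae_class \<mu> f"
    using F by (rule L2_carrierE)
  obtain k where k: "k \<in> sq_integrable \<mu>" and Kk: "K = ae_class \<mu> k"
    using K by (rule L2_carrierE)
  define h where "h = (\<lambda>s. complex_of_real (cmod (f s)) * f s)"
  have h: "integrable \<mu> h"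
  proof (rule Bochner_Integration.integrable_bound)
    show "integrable \<mu> (\<lambda>s. (cmod (f s))\<^sup>2)" using f by (rule sq_integrableD)
    show "h \<in> borel_measurable \<mu>"
      unfolding h_def using sq_integrableD(1)[OF f] by measurable
    show "AE s in \<mu>. norm (h s) \<le> norm ((cmod (f s))\<^sup>2)"
      by (simp add: h_def norm_mult power2_eq_square)
  qed
  \<comment> \<open>The summand 1 keeps \<open>C\<close> positive when \<open>K\<close> has norm 0.
    The radius \<open>(e / C)\<^sup>2 / 2\<close> below then yields an L2 distance less than
    \<open>e / C\<close>.\<close>
  define C where "C = hnorm (L2_space \<mu>) K + 1"
  have C: "C > 0" "hnorm (L2_space \<mu>) K \<le> C"
    using L2.hnorm_nonneg[OF K] by (simp_all add: C_def)
  have "(e / C)\<^sup>2 / 2 > 0" using e C by simp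
  then obtain V where V: "openin T V" "x \<in> V"
      "\<And>y. y \<in> V \<Longrightarrow> (LINT s|\<mu>. cmod (h (inv y \<otimes> s) - h (inv x \<otimes> s))) < (e / C)\<^sup>2 / 2"
    using translation_continuous_integrable[OF h] x unfolding translation_continuous_def by meson
  have "dist (hinner (L2_space \<mu>) (translate y F) K) (hinner (L2_space \<mu>) (translate x F) K) < e"
    if y: "y \<in> V" for y
  proof -
    have yG: "y \<in> carrier G" using y V(1) by (blast intro: openin_carrier)
    have fy: "(\<lambda>s. f (inv y \<otimes> s)) \<in> sq_integrable \<mu>" and fx: "(\<lambda>s. f (inv x \<otimes> s)) \<in> sq_integrable \<mu>"
      using f x yG by (auto intro: sq_integrable_translation)
    let ?D = "\<lambda>s. f (inv y \<otimes> s) - f (inv x \<otimes> s)"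
    have D: "?D \<in> sq_integrable \<mu>" using fy fx by (rule sq_integrable_diff)
    have "hinner (L2_space \<mu>) (translate y F) K - hinner (L2_space \<mu>) (translate x F) K =
        hinner (L2_space \<mu>) (ae_class \<mu> ?D) K"
      using fx fy k D x yG f sq_integrable_mult[OF fx k] sq_integrable_mult[OF fy k]
      by (simp add: Ff Kk translate_ae_class L2_hinner left_diff_distrib)
    then have "dist (hinner (L2_space \<mu>) (translate y F) K) (hinner (L2_space \<mu>) (translate x F) K) =
        cmod (hinner (L2_space \<mu>) (ae_class \<mu> ?D) K)"
      by (simp add: dist_norm)
    also have "\<dots> \<le> hnorm (L2_space \<mu>) (ae_class \<mu> ?D) * hnorm (L2_space \<mu>) K"
      by (rule L2.Cauchy_Schwarz[OF ae_class_in_carrier[OF D] K])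
    also have "\<dots> \<le> hnorm (L2_space \<mu>) (ae_class \<mu> ?D) * C"
      using C(2) L2.hnorm_nonneg[OF ae_class_in_carrier[OF D]] by (rule mult_left_mono)
    also have "\<dots> < (e / C) * C"
    proof (rule mult_strict_right_mono[OF _ C(1)])
      have hi: "integrable \<mu> (\<lambda>s. 2 * cmod (h (inv y \<otimes> s) - h (inv x \<otimes> s)))"
        by (rule integrable_mult_right[OF integrable_translation_diff[OF h x yG]])
      have "(LINT s|\<mu>. (cmod (?D s))\<^sup>2) \<le> (LINT s|\<mu>. 2 * cmod (h (inv y \<otimes> s) - h (inv x \<otimes> s)))"
        by (rule integral_mono[OF sq_integrableD(2)[OF D] hi]) (simp only: h_def cmod_signed_square_diff)
      also have "\<dots> < (e / C)\<^sup>2"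
        using V(3)[OF y] by simp
      finally show "hnorm (L2_space \<mu>) (ae_class \<mu> ?D) < e / C"
        unfolding L2_hnorm[OF D] using e C(1) by (intro real_less_lsqrt) auto
    qed
    also have "\<dots> = e" using C(1) by simp
    finally show ?thesis .
  qed
  then show "\<exists>U. openin T U \<and> x \<in> U \<and> (\<forall>y\<in>U. dist (hinner (L2_space \<mu>) (translate y F) K) (hinner (L2_space \<mu>) (translate x F) K) < e)"
    using V by blast
qed

abbreviation fourier :: "('g \<Rightarrow> complex) set" where
  "fourier \<equiv> carr (fourier_algebra G \<mu>)"

lemma fourier_eq:
  "fourier = (\<lambda>\<phi>. \<lambda>x\<in>carrier G. \<phi> (translate x)) ` carr (predual_opspace (L2_space \<mu>) (VN G \<mu>))"
  by (simp add: fourier_algebra_def quotient_opspace_def)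

lemma fourier_add:
  assumes "u \<in> fourier" "v \<in> fourier"
  shows "(\<lambda>x\<in>carrier G. u x + v x) \<in> fourier"
proof -
  obtain \<phi> \<psi> where *: "\<phi> \<in> carr (predual_opspace (L2_space \<mu>) (VN G \<mu>))" "\<psi> \<in> carr (predual_opspace (L2_space \<mu>) (VN G \<mu>))"
    and [simp]: "u = (\<lambda>x\<in>carrier G. \<phi> (translate x))" "v = (\<lambda>x\<in>carrier G. \<psi> (translate x))"
    using assms by (auto simp: fourier_eq)
  show ?thesis
    unfolding fourier_eq
    by (rule image_eqI[OF _ L2.predual_add[OF VN_bounded_ops *]])
      (auto simp: translate_in_VN intro!: restrict_ext)
qed

lemma fourier_scale:
  assumes "u \<in> fourier"
  shows "(\<lambda>x\<in>carrier G. c * u x) \<in> fourier"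
proof -
  obtain \<phi> where *: "\<phi> \<in> carr (predual_opspace (L2_space \<mu>) (VN G \<mu>))"
    and [simp]: "u = (\<lambda>x\<in>carrier G. \<phi> (translate x))"
    using assms by (auto simp: fourier_eq)
  show ?thesis
    unfolding fourier_eq
    by (rule image_eqI[OF _ L2.predual_scale[OF VN_bounded_ops *, of c]])
      (auto simp: translate_in_VN intro!: restrict_ext)
qed

lemma fourier_extensional: "u \<in> fourier \<Longrightarrow> u \<in> extensional (carrier G)"
  by (auto simp: fourier_eq)

text \<open>A uniform limit of finite sums of coefficients. Uniformity holds because translations
  are isometries, so the majorants in the Weierstrass test do not depend on
  \<open>x\<close>.\<close>

lemma fourier_continuous:
  assumes "u \<in> fourier"
  shows "continuous_map T euclidean u"
proof -
  obtain \<phi> where "\<phi> \<in> carr (predual_opspace (L2_space \<mu>) (VN G \<mu>))" and u\<phi>: "u = (\<lambda>x\<in>carrier G. \<phi> (translate x))"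
    using assms by (auto simp: fourier_eq)
  then obtain X Y where XY: "\<forall>i. X i \<in> carrier (L2_space \<mu>) \<and> Y i \<in> carrier (L2_space \<mu>)"
      and s: "summable (\<lambda>i::nat. (hnorm (L2_space \<mu>) (X i))\<^sup>2)" "summable (\<lambda>i. (hnorm (L2_space \<mu>) (Y i))\<^sup>2)"
      and \<phi>: "\<phi> = (\<lambda>A\<in>VN G \<mu>. \<Sum>i. hinner (L2_space \<mu>) (A (X i)) (Y i))"
    by (elim L2.predual_carrE)
  let ?c = "\<lambda>i x. hinner (L2_space \<mu>) (translate x (X i)) (Y i)"
  have u: "u x = (\<Sum>i. ?c i x)" if "x \<in> carrier G" for x
    using that by (simp add: u\<phi> \<phi> translate_in_VN)
  have lim: "uniform_limit (carrier G) (\<lambda>n x. \<Sum>i<n. ?c i x) (\<lambda>x. \<Sum>i. ?c i x) sequentially"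
  proof (rule Weierstrass_m_test)
    show "summable (\<lambda>i. (hnorm (L2_space \<mu>) (X i))\<^sup>2 + (hnorm (L2_space \<mu>) (Y i))\<^sup>2)"
      by (intro summable_add s)
    fix i x assume x: "x \<in> carrier G"
    have "cmod (?c i x) \<le> hnorm (L2_space \<mu>) (X i) * hnorm (L2_space \<mu>) (Y i)"
      using L2.Cauchy_Schwarz[OF translate_closed[OF x], of "X i" "Y i"] XY hnorm_translate[OF x, of "X i"] by simp
    also have "\<dots> \<le> (hnorm (L2_space \<mu>) (X i))\<^sup>2 + (hnorm (L2_space \<mu>) (Y i))\<^sup>2"
    proof -
      have "0 \<le> hnorm (L2_space \<mu>) (X i) * hnorm (L2_space \<mu>) (Y i)" using XY by simp
      then show ?thesis
        using sum_squares_bound[of "hnorm (L2_space \<mu>) (X i)" "hnorm (L2_space \<mu>) (Y i)"] by linarith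
    qed
    finally show "cmod (?c i x) \<le> (hnorm (L2_space \<mu>) (X i))\<^sup>2 + (hnorm (L2_space \<mu>) (Y i))\<^sup>2" .
  qed
  show ?thesis
  proof (rule continuous_map_metricI)
    fix x and e :: real assume "x \<in> topspace T" and "e > 0"
    then have x: "x \<in> carrier G" and e: "e / 3 > 0" by (auto simp: topspace_eq)
    have "\<forall>\<^sub>F n in sequentially. \<forall>x\<in>carrier G. dist (\<Sum>i<n. ?c i x) (\<Sum>i. ?c i x) < e / 3"
      using uniform_limitD[OF lim e] .
    then obtain n where n: "\<And>x. x \<in> carrier G \<Longrightarrow> dist (\<Sum>i<n. ?c i x) (u x) < e / 3"
      using u by (auto simp: eventually_sequentially)
    have "continuous_map T euclidean (\<lambda>x. \<Sum>i<n. ?c i x)"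
      using XY by (intro continuous_map_sum coefficient_continuous) auto
    then have V: "openin T {y \<in> topspace T. (\<Sum>i<n. ?c i y) \<in> ball (\<Sum>i<n. ?c i x) (e / 3)}" (is "openin T ?V")
      by (rule openin_continuous_map_preimage) simp
    have "dist (u y) (u x) < e" if y: "y \<in> ?V" for y
    proof -
      have yG: "y \<in> carrier G" and d: "dist (\<Sum>i<n. ?c i x) (\<Sum>i<n. ?c i y) < e / 3"
        using y by (auto simp: topspace_eq)
      have "dist (u y) (u x) \<le> dist (\<Sum>i<n. ?c i y) (u y) + dist (\<Sum>i<n. ?c i x) (\<Sum>i<n. ?c i y) + dist (\<Sum>i<n. ?c i x) (u x)"
        by metric
      also have "\<dots> < e" using d n[OF x] n[OF yG] by linarith
      finally show ?thesis .
    qed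
    moreover have "x \<in> ?V" using x e by (simp add: topspace_eq)
    ultimately show "\<exists>U. openin T U \<and> x \<in> U \<and> (\<forall>y\<in>U. dist (u y) (u x) < e)"
      using V by blast
  qed
qed

lemma cmod_le_fourier_mnorm:
  assumes x: "x \<in> carrier G"
  shows "ennreal (cmod (w 0 0 x)) \<le> mnorm (fourier_algebra G \<mu>) 1 w"
  unfolding fourier_algebra_def quotient_opspace_def opspace.simps
proof (rule INF_greatest)
  fix \<phi> assume "\<phi> \<in> {v \<in> mats 1 (carr (predual_opspace (L2_space \<mu>) (VN G \<mu>))).
      \<forall>k<1. \<forall>l<1. (\<lambda>x\<in>carrier G. v k l (translate x)) = w k l}"
  then have "w 0 0 x = \<phi> 0 0 (translate x)"
    using x by (auto dest!: fun_cong[of _ _ x])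
  then show "ennreal (cmod (w 0 0 x)) \<le> mnorm (predual_opspace (L2_space \<mu>) (VN G \<mu>)) 1 \<phi>"
    using L2.cmod_le_predual_mnorm[OF VN_bounded_ops translate_in_VN[OF x], of \<phi>] hnorm_translate[OF x] by simp
qed

section \<open>Cosets of the vanishing ideal and restriction to a subset\<close>

context
  fixes E assumes E: "E \<subseteq> carrier G"
begin

abbreviation coset :: "('g \<Rightarrow> complex) \<Rightarrow> ('g \<Rightarrow> complex) set" where
  "coset u \<equiv> (\<lambda>v. \<lambda>x\<in>carrier G. u x + v x) ` vanishing_ideal G \<mu> E"

lemma carr_restricted: "carr (restricted_fourier_algebra G \<mu> E) = coset ` fourier"
  by (simp add: restricted_fourier_algebra_def quotient_opspace_def)

lemma self_in_coset:
  assumes u: "u \<in> fourier"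
  shows "u \<in> coset u"
proof (rule image_eqI)
  \<comment> \<open>The zero function of the Fourier algebra, obtained as a multiple of
    \<open>u\<close>.\<close>
  show "(\<lambda>x\<in>carrier G. 0 * u x) \<in> vanishing_ideal G \<mu> E"
    using fourier_scale[OF u, of 0] E by (auto simp: vanishing_ideal_def)
  show "u = (\<lambda>x\<in>carrier G. u x + (\<lambda>x\<in>carrier G. 0 * u x) x)"
    using fourier_extensional[OF u] by (auto simp: fun_eq_iff extensional_def)
qed

lemma restriction_inc_coset:
  assumes u: "u \<in> fourier"
  shows "restriction_inc E (coset u) = restrict u E"
proof -
  have "restrict w E = restrict u E" if "w \<in> coset u" for w
    using that E by (auto simp: vanishing_ideal_def intro!: restrict_ext)
  then have "(\<lambda>w. restrict w E) ` coset u = {restrict u E}"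
    using self_in_coset[OF u] by blast
  then show ?thesis by (simp add: restriction_inc_def)
qed

lemma coset_subset:
  assumes u: "u \<in> fourier" and w: "w \<in> fourier" and eq: "restrict u E = restrict w E"
  shows "coset u \<subseteq> coset w"
proof
  fix g assume "g \<in> coset u"
  then obtain v where v: "v \<in> vanishing_ideal G \<mu> E" and g: "g = (\<lambda>x\<in>carrier G. u x + v x)" by auto
  \<comment> \<open>This is \<open>u - w + v\<close>, written with the available operations; it
    vanishes on \<open>E\<close> because \<open>u\<close> and \<open>w\<close> agree there.\<close>
  define v' where "v' = (\<lambda>x\<in>carrier G. (\<lambda>x\<in>carrier G. u x + (\<lambda>x\<in>carrier G. - 1 * w x) x) x + v x)"
  have "v' \<in> fourier"
    unfolding v'_def using v by (intro fourier_add fourier_scale u w) (simp add: vanishing_ideal_def)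
  moreover have "v' x = 0" if "x \<in> E" for x
    using v that E fun_cong[OF eq, of x] by (auto simp: v'_def vanishing_ideal_def)
  ultimately have "v' \<in> vanishing_ideal G \<mu> E" by (simp add: vanishing_ideal_def)
  moreover have "g = (\<lambda>x\<in>carrier G. w x + v' x)"
    unfolding g v'_def by (intro restrict_ext) simp
  ultimately show "g \<in> coset w" by blast
qed

lemma coset_eqI:
  assumes "u \<in> fourier" "w \<in> fourier" "restrict u E = restrict w E"
  shows "coset u = coset w"
  using coset_subset[OF assms] coset_subset[OF assms(2,1) assms(3)[symmetric]] by (rule equalityI)

text \<open>Two cosets with the same restriction coincide, so the choice in \<open>inv_into\<close>
  is forced.\<close>

lemma restriction_inc_inv_restrict:
  assumes u: "u \<in> fourier"
  shows "restriction_inc_inv G \<mu> E (restrict u E) = coset u"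
proof -
  have "inj_on (restriction_inc E) (coset ` fourier)"
  proof (rule inj_onI)
    fix X Y assume "X \<in> coset ` fourier" "Y \<in> coset ` fourier"
    then obtain v w where v: "v \<in> fourier" "X = coset v" and w: "w \<in> fourier" "Y = coset w" by blast
    assume "restriction_inc E X = restriction_inc E Y"
    then have "restrict v E = restrict w E"
      unfolding v(2) w(2) restriction_inc_coset[OF v(1)] restriction_inc_coset[OF w(1)] .
    then show "X = Y"
      unfolding v(2) w(2) by (rule coset_eqI[OF v(1) w(1)])
  qed
  moreover have "coset u \<in> coset ` fourier" using u by blast
  ultimately have "inv_into (coset ` fourier) (restriction_inc E) (restriction_inc E (coset u)) = coset u"
    by (rule inv_into_f_f)
  then show ?thesis
    by (simp add: restriction_inc_inv_def carr_restricted restriction_inc_coset[OF u])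
qed

text \<open>The quotient norm is an infimum of infima, over lifts to the Fourier algebra and then to
  the predual, so every matrix of functionals that induces \<open>f\<close> on \<open>E\<close>
  gives an upper bound.\<close>

lemma mnorm_restriction_inc_inv_le:
  assumes \<phi>: "\<phi> \<in> mats n (carr (predual_opspace (L2_space \<mu>) (VN G \<mu>)))"
    and f: "\<And>k l. \<lbrakk>k < n; l < n\<rbrakk> \<Longrightarrow> f k l = (\<lambda>x\<in>E. \<phi> k l (translate x))"
  shows "mnorm (restricted_fourier_algebra G \<mu> E) n (\<lambda>k l. restriction_inc_inv G \<mu> E (f k l)) \<le>
           mnorm (predual_opspace (L2_space \<mu>) (VN G \<mu>)) n \<phi>"
proof -
  define u where "u = (\<lambda>k l. \<lambda>x\<in>carrier G. \<phi> k l (translate x))"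
  have u: "u k l \<in> fourier" if "k < n" "l < n" for k l
    using \<phi> that by (auto simp: u_def fourier_eq mats_def)
  have inv: "coset (u k l) = restriction_inc_inv G \<mu> E (f k l)" if "k < n" "l < n" for k l
  proof -
    have "f k l = restrict (u k l) E"
      unfolding f[OF that] u_def using E by (intro restrict_ext) auto
    then show ?thesis using restriction_inc_inv_restrict[OF u[OF that]] by simp
  qed
  have "mnorm (restricted_fourier_algebra G \<mu> E) n (\<lambda>k l. restriction_inc_inv G \<mu> E (f k l)) \<le>
      mnorm (fourier_algebra G \<mu>) n u"
    unfolding restricted_fourier_algebra_def quotient_opspace_def opspace.simps
    using u inv by (intro INF_lower) (simp add: mats_def)
  also have "\<dots> \<le> mnorm (predual_opspace (L2_space \<mu>) (VN G \<mu>)) n \<phi>"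
    unfolding fourier_algebra_def quotient_opspace_def opspace.simps
    using \<phi> by (intro INF_lower) (simp add: u_def)
  finally show ?thesis .
qed

text \<open>Every representative of the coset has the value \<open>u x\<close> at \<open>x\<close>,
  so the pointwise bound by the Fourier norm survives the infimum.\<close>

lemma cmod_le_mnorm_restriction_inc_inv:
  assumes u: "u \<in> fourier" and x: "x \<in> E"
  shows "ennreal (cmod (u x)) \<le>
           mnorm (restricted_fourier_algebra G \<mu> E) 1 (\<lambda>_ _. restriction_inc_inv G \<mu> E (restrict u E))"
  unfolding restricted_fourier_algebra_def quotient_opspace_def opspace.simps restriction_inc_inv_restrict[OF u]
proof (rule INF_greatest)
  fix w assume "w \<in> {v \<in> mats 1 fourier. \<forall>k<1. \<forall>l<1. coset (v k l) = coset u}"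
  then have w: "w 0 0 \<in> fourier" "coset (w 0 0) = coset u" by (auto simp: mats_def)
  then have "restrict (w 0 0) E = restrict u E"
    using restriction_inc_coset[OF u] restriction_inc_coset[OF w(1)] by simp
  then have "w 0 0 x = u x" using x by (metis restrict_apply')
  then show "ennreal (cmod (u x)) \<le> mnorm (fourier_algebra G \<mu>) 1 w"
    using cmod_le_fourier_mnorm[of x w] x E by auto
qed

text \<open>Vanishing at infinity is automatic, since the sets in question are closed in a compact
  group.\<close>

lemma restrict_fourier_in_C0:
  assumes cl: "closedin T E" and u: "u \<in> fourier"
  shows "restrict u E \<in> carr (C0_opspace T E)"
proof -
  have "continuous_map (subtopology T E) euclidean (restrict u E)"
    using continuous_map_from_subtopology[OF fourier_continuous[OF u], of E]
    by (rule continuous_map_eq) auto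
  moreover have "compactin T {x \<in> E. cmod (restrict u E x) \<ge> e}" for e
  proof -
    have "continuous_map T euclideanreal (\<lambda>x. cmod (u x))"
      using fourier_continuous[OF u] by (rule continuous_map_norm)
    then have "closedin T {x \<in> topspace T. cmod (u x) \<in> {e..}}"
      by (rule closedin_continuous_map_preimage) simp
    then have "closedin T (E \<inter> {x \<in> topspace T. cmod (u x) \<in> {e..}})"
      using cl by (rule closedin_Int[rotated])
    moreover have "E \<inter> {x \<in> topspace T. cmod (u x) \<in> {e..}} = {x \<in> E. cmod (restrict u E x) \<ge> e}"
      using E topspace_eq by auto
    ultimately show ?thesis
      using compact closedin_compact_space by metis
  qed
  ultimately show ?thesis by (simp add: C0_opspace_def)
qed

text \<open>Reduces the claim to lifting matrices over C(E) to matrices of functionals. The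
  hypothesis on \<open>R\<close> is strict, so the bound 1 is reached through
  \<open>R = 1 + e\<close>; the case of size 1 also yields surjectivity of the restriction.\<close>

lemma Hel_cb_eq_1:
  assumes cl: "closedin T E" and ne: "E \<noteq> {}"
    and ext: "\<And>n f R. \<lbrakk>f \<in> mats n (carr (C0_opspace T E)); mnorm (C0_opspace T E) n f < ennreal R\<rbrakk> \<Longrightarrow>
       \<exists>\<phi>\<in>mats n (carr (predual_opspace (L2_space \<mu>) (VN G \<mu>))).
         mnorm (predual_opspace (L2_space \<mu>) (VN G \<mu>)) n \<phi> \<le> ennreal R \<and>
         (\<forall>k<n. \<forall>l<n. f k l = (\<lambda>x\<in>E. \<phi> k l (translate x)))"
  shows "Hel_cb G T \<mu> E = 1"
proof -
  have le: "cb_norm (C0_opspace T E) (restricted_fourier_algebra G \<mu> E) (restriction_inc_inv G \<mu> E) \<le> 1"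
    unfolding cb_norm_def
  proof (intro SUP_least)
    fix n f assume f: "f \<in> {v \<in> mats n (carr (C0_opspace T E)). mnorm (C0_opspace T E) n v \<le> 1}"
    show "mnorm (restricted_fourier_algebra G \<mu> E) n (\<lambda>k l. restriction_inc_inv G \<mu> E (f k l)) \<le> 1"
    proof (rule ennreal_le_epsilon)
      fix e :: real assume "e > 0"
      then have "(1 :: ennreal) < ennreal (1 + e)"
        using ennreal_lessI[of "1 + e" 1] by simp
      then have "mnorm (C0_opspace T E) n f < ennreal (1 + e)"
        using f by (auto intro: le_less_trans)
      then obtain \<phi> where \<phi>: "\<phi> \<in> mats n (carr (predual_opspace (L2_space \<mu>) (VN G \<mu>)))"
          "mnorm (predual_opspace (L2_space \<mu>) (VN G \<mu>)) n \<phi> \<le> ennreal (1 + e)"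
          "\<forall>k<n. \<forall>l<n. f k l = (\<lambda>x\<in>E. \<phi> k l (translate x))"
        using ext[of f n "1 + e"] f by blast
      have "mnorm (restricted_fourier_algebra G \<mu> E) n (\<lambda>k l. restriction_inc_inv G \<mu> E (f k l)) \<le> ennreal (1 + e)"
        using mnorm_restriction_inc_inv_le[OF \<phi>(1), of f] \<phi>(2,3) by (auto intro: order_trans)
      then show "mnorm (restricted_fourier_algebra G \<mu> E) n (\<lambda>k l. restriction_inc_inv G \<mu> E (f k l)) \<le> 1 + ennreal e"
        using \<open>e > 0\<close> by simp
    qed
  qed
  \<comment> \<open>A continuous function on the compact \<open>E\<close> is bounded by some
    \<open>B\<close>, so \<open>ext\<close> applies in size 1 with \<open>R = B + 1\<close>.\<close>
  have ext1: "\<exists>u\<in>fourier. f = restrict u E" if f: "f \<in> carr (C0_opspace T E)" for f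
  proof -
    have "compactin T E" using cl compact by (simp add: closedin_compact_space)
    moreover have "continuous_map (subtopology T E) euclidean f" using f by (simp add: C0_opspace_def)
    ultimately have "compactin euclidean (f ` E)"
      using image_compactin[of "subtopology T E" E euclidean f] by (simp add: compactin_subtopology)
    then have "bounded (f ` E)" by (simp add: compact_imp_bounded compactin_euclidean_iff)
    then obtain B where B: "B > 0" "\<And>x. x \<in> E \<Longrightarrow> cmod (f x) \<le> B"
      by (auto simp: bounded_pos)
    have "mnorm (C0_opspace T E) 1 (\<lambda>_ _. f) \<le> ennreal B"
      unfolding C0_opspace_def opspace.simps opnorm_def
    proof (intro SUP_least ennreal_leI)
      fix x and z :: "nat \<Rightarrow> complex" assume "x \<in> E" and "z \<in> {z. L2_set (\<lambda>l. cmod (z l)) {..<1} \<le> 1}"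
      then have "cmod (f x) \<le> B" "cmod (z 0) \<le> 1" using B(2) by (auto simp: L2_set_def)
      then have "cmod (f x) * cmod (z 0) \<le> B * 1" using B(1) by (intro mult_mono) auto
      then show "L2_set (\<lambda>k. cmod (\<Sum>l<1. f x * z l)) {..<1::nat} \<le> B"
        by (simp add: L2_set_def norm_mult)
    qed
    also have "\<dots> < ennreal (B + 1)" using B(1) by (simp add: ennreal_less_iff)
    finally obtain \<phi> where \<phi>: "\<phi> \<in> mats 1 (carr (predual_opspace (L2_space \<mu>) (VN G \<mu>)))"
        "f = (\<lambda>x\<in>E. \<phi> 0 0 (translate x))"
      using ext[of "\<lambda>_ _. f" 1 "B + 1"] f by (auto simp: mats_def)
    have "(\<lambda>x\<in>carrier G. \<phi> 0 0 (translate x)) \<in> fourier"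
      using \<phi>(1) by (auto simp: fourier_eq mats_def)
    moreover have "f = restrict (\<lambda>x\<in>carrier G. \<phi> 0 0 (translate x)) E"
      unfolding \<phi>(2) using E by (intro restrict_ext) auto
    ultimately show ?thesis by blast
  qed
  have surj: "restriction_inc E ` carr (restricted_fourier_algebra G \<mu> E) = carr (C0_opspace T E)"
  proof
    show "restriction_inc E ` carr (restricted_fourier_algebra G \<mu> E) \<subseteq> carr (C0_opspace T E)"
      by (auto simp: carr_restricted restriction_inc_coset restrict_fourier_in_C0[OF cl])
    show "carr (C0_opspace T E) \<subseteq> restriction_inc E ` carr (restricted_fourier_algebra G \<mu> E)"
    proof
      fix f assume "f \<in> carr (C0_opspace T E)"
      then obtain u where "u \<in> fourier" "f = restrict u E" using ext1 by blast
      then show "f \<in> restriction_inc E ` carr (restricted_fourier_algebra G \<mu> E)"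
        unfolding carr_restricted using restriction_inc_coset by force
    qed
  qed
  have ge: "1 \<le> cb_norm (C0_opspace T E) (restricted_fourier_algebra G \<mu> E) (restriction_inc_inv G \<mu> E)"
  proof -
    let ?f = "\<lambda>x\<in>E. 1 :: complex"
    \<comment> \<open>At this point every lift of the constant function has the value 1, hence norm
      at least 1.\<close>
    obtain x where x: "x \<in> E" using ne by blast
    have "compactin T {x \<in> E. e \<le> cmod (?f x)}" for e :: real
    proof -
      have "{x \<in> E. e \<le> cmod (?f x)} = (if e \<le> 1 then E else {})" by auto
      then show ?thesis using cl compact by (simp add: closedin_compact_space)
    qed
    moreover have "continuous_map (subtopology T E) euclidean ?f"
      by (rule continuous_map_eq[OF continuous_map_canonical_const]) auto
    ultimately have fC: "?f \<in> carr (C0_opspace T E)"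
      by (simp add: C0_opspace_def)
    then obtain u where u: "u \<in> fourier" "?f = restrict u E" using ext1 by blast
    have "mnorm (C0_opspace T E) 1 (\<lambda>_ _. ?f) \<le> 1"
      unfolding C0_opspace_def opspace.simps opnorm_def
    proof (intro SUP_least)
      fix x and z :: "nat \<Rightarrow> complex" assume "x \<in> E" and "z \<in> {z. L2_set (\<lambda>l. cmod (z l)) {..<1} \<le> 1}"
      then show "ennreal (L2_set (\<lambda>k. cmod (\<Sum>l<1. ?f x * z l)) {..<1::nat}) \<le> 1"
        by (simp add: L2_set_def)
    qed
    then have f1: "(\<lambda>_ _. ?f) \<in> {v \<in> mats 1 (carr (C0_opspace T E)). mnorm (C0_opspace T E) 1 v \<le> 1}"
      using fC by (simp add: mats_def)
    have "u x = 1" using fun_cong[OF u(2), of x] x by simp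
    then have "1 \<le> mnorm (restricted_fourier_algebra G \<mu> E) 1 (\<lambda>_ _. restriction_inc_inv G \<mu> E ?f)"
      using cmod_le_mnorm_restriction_inc_inv[OF u(1) x] by (simp add: u(2))
    also have "\<dots> \<le> cb_norm (C0_opspace T E) (restricted_fourier_algebra G \<mu> E) (restriction_inc_inv G \<mu> E)"
      unfolding cb_norm_def
      by (rule SUP_upper2[where i = 1, OF UNIV_I], rule SUP_upper2[where i = "\<lambda>_ _. ?f", OF f1]) (rule order_refl)
    finally show ?thesis .
  qed
  have eq: "cb_norm (C0_opspace T E) (restricted_fourier_algebra G \<mu> E) (restriction_inc_inv G \<mu> E) = 1"
    using le ge by (rule antisym)
  then show ?thesis
    using cl surj by (simp add: Hel_cb_def cb_Helson_def)
qed

end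

end

section \<open>Products of unitary groups contain every compact space as a cb-Helson set\<close>

text \<open>Homogenised and squared, the operator norm bound takes the form of the contractivity
  hypothesis of the dilation.\<close>

lemma opnorm_le_imp_sum_le:
  fixes a :: "'j \<Rightarrow> 'j \<Rightarrow> complex"
  assumes J: "finite J" and le: "opnorm J a \<le> ennreal b" and b: "0 \<le> b"
  shows "(\<Sum>k\<in>J. (cmod (\<Sum>l\<in>J. a k l * z l))\<^sup>2) \<le> b\<^sup>2 * (\<Sum>l\<in>J. (cmod (z l))\<^sup>2)"
proof -
  define s where "s = L2_set (\<lambda>l. cmod (z l)) J"
  have s2: "s\<^sup>2 = (\<Sum>l\<in>J. (cmod (z l))\<^sup>2)"
    by (simp add: s_def L2_set_def sum_nonneg)
  show ?thesis
  proof (cases "s = 0")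
    case True
    then have "z l = 0" if "l \<in> J" for l
      using that J by (simp add: s_def L2_set_eq_0_iff)
    then show ?thesis by simp
  next
    case False
    then have s: "s > 0"
      using L2_set_nonneg[of "\<lambda>l. cmod (z l)" J] unfolding s_def by linarith
    let ?z = "\<lambda>l. z l / complex_of_real s"
    have "L2_set (\<lambda>l. cmod (?z l)) J = L2_set (\<lambda>l. (1 / s) * cmod (z l)) J"
      using s by (simp add: norm_divide)
    also have "\<dots> = (1 / s) * s"
      unfolding s_def by (rule L2_set_right_distrib[symmetric]) (simp add: L2_set_nonneg)
    also have "\<dots> = 1" using s by simp
    finally have z1: "?z \<in> {z. L2_set (\<lambda>l. cmod (z l)) J \<le> 1}" by simp
    have "ennreal (L2_set (\<lambda>k. cmod (\<Sum>l\<in>J. a k l * ?z l)) J) \<le> opnorm J a"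
      unfolding opnorm_def by (rule SUP_upper[OF z1])
    then have "ennreal (L2_set (\<lambda>k. cmod (\<Sum>l\<in>J. a k l * ?z l)) J) \<le> ennreal b"
      using le by (rule order_trans)
    then have "L2_set (\<lambda>k. cmod (\<Sum>l\<in>J. a k l * ?z l)) J \<le> b"
      using b by (simp only: ennreal_le_iff)
    then have "(L2_set (\<lambda>k. cmod (\<Sum>l\<in>J. a k l * ?z l)) J)\<^sup>2 \<le> b\<^sup>2"
      by (rule power_mono) (rule L2_set_nonneg)
    then have "(\<Sum>k\<in>J. (cmod (\<Sum>l\<in>J. a k l * ?z l))\<^sup>2) \<le> b\<^sup>2"
      by (simp only: L2_set_def real_sqrt_pow2 sum_nonneg zero_le_power2)
    moreover have "(\<Sum>k\<in>J. (cmod (\<Sum>l\<in>J. a k l * ?z l))\<^sup>2) = (\<Sum>k\<in>J. (cmod (\<Sum>l\<in>J. a k l * z l))\<^sup>2) / s\<^sup>2"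
      using s by (simp add: sum_divide_distrib[symmetric] norm_divide power_divide)
    ultimately show ?thesis
      using s by (simp add: s2[symmetric] divide_le_eq)
  qed
qed

lemma compact_haar_unitary_product_group:
  assumes "left_haar_measure (unitary_product_group I n) (unitary_product_topology I n) \<mu>"
  shows "compact_haar_group (unitary_product_group I n) (unitary_product_topology I n) \<mu>"
  by (intro compact_haar_group.intro compact_haar_group_axioms.intro group_unitary_product_group
      topspace_unitary_product_topology compact_unitary_product_topology Hausdorff_unitary_product_topology
      continuous_map_unitary_product_mult assms)

text \<open>Only the corner of size \<open>m\<close> is turned into functionals, but
  \<open>s\<close> runs over the full size \<open>n i\<close>: the rows of the corner are
  orthonormal only at full length.\<close>

lemma unitary_coordinate_functionals:
  fixes I :: "'i set" and n :: "'i \<Rightarrow> nat"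
  defines "G \<equiv> unitary_product_group I n"
  assumes haar: "left_haar_measure G (unitary_product_topology I n) \<mu>" and i: "i \<in> I" and m: "m \<le> n i"
  shows "\<exists>\<phi>\<in>mats m (carr (predual_opspace (L2_space \<mu>) (VN G \<mu>))).
           mnorm (predual_opspace (L2_space \<mu>) (VN G \<mu>)) m \<phi> \<le> 1 \<and>
           (\<forall>k<m. \<forall>l<m. \<forall>x\<in>carrier G. \<phi> k l (left_regular G \<mu> x) = x i $$ (k, l))"
proof -
  interpret compact_haar_group G "unitary_product_topology I n" \<mu>
    using compact_haar_unitary_product_group haar unfolding G_def by blast
  define M where "M = measure \<mu> (carrier G)"
  have M: "M > 0" using measure_pos by (simp add: M_def)
  \<comment> \<open>Two such factors contribute \<open>1 / M\<close>, which cancels the total mass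
    in the integral.\<close>
  define c where "c = complex_of_real (1 / sqrt M)"
  have c: "cnj c = c" "c * c = complex_of_real (1 / M)" "(cmod c)\<^sup>2 = 1 / M"
    using M by (simp_all add: c_def norm_divide power_divide flip: of_real_mult)
  define g where "g = (\<lambda>l s x. c * cnj (x i $$ (l, s)))"
  define f where "f = (\<lambda>l s. ae_class \<mu> (g l s))"
  have xi: "x i \<in> carrier (unitary_group (n i))" if "x \<in> carrier G" for x
    using that i by (auto simp: G_def unitary_product_group_def)
  have g: "g l s \<in> sq_integrable \<mu>" if "l < n i" "s < n i" for l s
  proof -
    have "continuous_map (unitary_product_topology I n) (unitary_topology (n i)) (\<lambda>x. x i)"
      unfolding unitary_product_topology_def using i by (rule continuous_map_product_projection)
    from continuous_map_compose[OF this continuous_map_unitary_entry[OF that]]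
    have "continuous_map (unitary_product_topology I n) euclidean (g l s)"
      unfolding g_def o_def
      by (intro continuous_map_mult_complex continuous_map_cnj continuous_map_canonical_const)
    then have meas: "g l s \<in> borel_measurable \<mu>" by (rule measurable_of_continuous)
    have "integrable \<mu> (\<lambda>x. (cmod (g l s x))\<^sup>2)"
    proof (rule integrable_const_bound)
      have "(cmod (g l s x))\<^sup>2 \<le> 1 / M" if x: "x \<in> carrier G" for x
      proof -
        have "(cmod (x i $$ (l, s)))\<^sup>2 \<le> 1"
          using cmod_unitary_entry_le_1[OF xi[OF x], of l s] \<open>l < n i\<close> \<open>s < n i\<close> by (simp add: power_le_one)
        then show ?thesis
          using M by (simp add: g_def norm_mult power_mult_distrib c(3) divide_right_mono)
      qed
      then show "AE x in \<mu>. norm ((cmod (g l s x))\<^sup>2) \<le> 1 / M"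
        by (intro AE_I2) simp
      show "(\<lambda>x. (cmod (g l s x))\<^sup>2) \<in> borel_measurable \<mu>"
        using meas by measurable
    qed
    then show ?thesis using meas by (simp add: sq_integrable_def)
  qed
  have fc: "f l s \<in> carrier (L2_space \<mu>)" if "l < n i" "s < n i" for l s
    using g[OF that] by (simp add: f_def)
  have inner: "(\<Sum>s<n i. hinner (L2_space \<mu>) (translate x (f l s)) (f k s)) = x i $$ (k, l)"
    if x: "x \<in> carrier G" and k: "k < n i" and l: "l < n i" for x k l
  proof -
    have gt: "(\<lambda>t. g l s (inv\<^bsub>G\<^esub> x \<otimes>\<^bsub>G\<^esub> t)) \<in> sq_integrable \<mu>" if "s < n i" for s
      using sq_integrable_translation[OF inv_closed[OF x] g[OF l that]] .
    have "(\<Sum>s<n i. hinner (L2_space \<mu>) (translate x (f l s)) (f k s)) =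
        (\<Sum>s<n i. LINT t|\<mu>. g l s (inv\<^bsub>G\<^esub> x \<otimes>\<^bsub>G\<^esub> t) * cnj (g k s t))"
      using g k l gt by (intro sum.cong refl) (simp add: f_def translate_ae_class[OF x] L2_hinner)
    \<comment> \<open>With the sum moved under the integral, the integrand becomes constant in
      \<open>t\<close> by \<open>unitary_coordinate_translate\<close>.\<close>
    also have "\<dots> = (LINT t|\<mu>. (\<Sum>s<n i. g l s (inv\<^bsub>G\<^esub> x \<otimes>\<^bsub>G\<^esub> t) * cnj (g k s t)))"
      using g[OF k] gt by (intro Bochner_Integration.integral_sum[symmetric] sq_integrable_mult) auto
    also have "\<dots> = (LINT t|\<mu>. complex_of_real (1 / M) * x i $$ (k, l))"
    proof (rule Bochner_Integration.integral_cong[OF refl])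
      fix t assume "t \<in> space \<mu>"
      then have t: "t \<in> carrier G" by simp
      have "g l s (inv\<^bsub>G\<^esub> x \<otimes>\<^bsub>G\<^esub> t) * cnj (g k s t) =
          (c * c) * (cnj ((inv\<^bsub>G\<^esub> x \<otimes>\<^bsub>G\<^esub> t) i $$ (l, s)) * t i $$ (k, s))" for s
        unfolding g_def by (simp only: complex_cnj_mult complex_cnj_cnj c(1) mult_ac)
      then have "(\<Sum>s<n i. g l s (inv\<^bsub>G\<^esub> x \<otimes>\<^bsub>G\<^esub> t) * cnj (g k s t)) =
          complex_of_real (1 / M) * (\<Sum>s<n i. cnj ((inv\<^bsub>G\<^esub> x \<otimes>\<^bsub>G\<^esub> t) i $$ (l, s)) * t i $$ (k, s))"
        by (simp only: sum_distrib_left c(2))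
      also have "\<dots> = complex_of_real (1 / M) * x i $$ (k, l)"
        using unitary_coordinate_translate[OF x[unfolded G_def] t[unfolded G_def] i k l] by (simp add: G_def)
      finally show "(\<Sum>s<n i. g l s (inv\<^bsub>G\<^esub> x \<otimes>\<^bsub>G\<^esub> t) * cnj (g k s t)) = complex_of_real (1 / M) * x i $$ (k, l)" .
    qed
    also have "\<dots> = x i $$ (k, l)"
      using M by (simp add: lebesgue_integral_const M_def[symmetric] scaleR_conv_of_real)
    finally show ?thesis .
  qed
  have one: "translate \<one>\<^bsub>G\<^esub> (f l s) = f l s" if "l < n i" "s < n i" for l s
    unfolding f_def translate_ae_class[OF one_closed g[OF that]]
    by (intro ae_class_eqI AE_I2) simp
  \<comment> \<open>Orthonormality is the coefficient formula at the identity, whose coordinate is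
    the identity matrix.\<close>
  have orth: "(\<Sum>s<n i. hinner (L2_space \<mu>) (f l s) (f k s)) = (if k = l then 1 else 0)"
    if "k < m" "l < m" for k l
  proof -
    have kl: "k < n i" "l < n i" using that m by auto
    have "\<one>\<^bsub>G\<^esub> i $$ (k, l) = (if k = l then 1 else 0)"
      using i kl by (simp add: G_def unitary_product_group_def unitary_group_def)
    then show ?thesis
      using inner[OF one_closed kl] kl(2) by (simp add: one)
  qed
  define \<phi> where "\<phi> = (\<lambda>k l. \<lambda>A\<in>VN G \<mu>. \<Sum>s<n i. hinner (L2_space \<mu>) (A (f l s)) (f k s))"
  have "\<phi> \<in> mats m (carr (predual_opspace (L2_space \<mu>) (VN G \<mu>)))"
    unfolding mats_def \<phi>_def using fc m by (auto intro!: L2.finite_sum_in_predual VN_bounded_ops)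
  moreover have "mnorm (predual_opspace (L2_space \<mu>) (VN G \<mu>)) m \<phi> \<le> 1"
    unfolding \<phi>_def using fc m by (intro L2.predual_mnorm_le_1 VN_bounded_ops orth) auto
  moreover have "\<phi> k l (translate x) = x i $$ (k, l)" if "k < m" "l < m" "x \<in> carrier G" for k l x
    using inner[OF that(3), of k l] that m by (simp add: \<phi>_def translate_in_VN)
  ultimately show ?thesis by blast
qed

lemma opnorm_empty [simp]: "opnorm {} a = 0"
  by (simp add: opnorm_def)

theorem theorem4p1:
  fixes \<Omega> :: "'a topology"
  assumes "compact_space \<Omega>" and "Hausdorff_space \<Omega>" and "topspace \<Omega> \<noteq> {}"
  shows "\<exists>(I :: (nat \<times> ('a \<Rightarrow> complex mat)) set) (n :: nat \<times> ('a \<Rightarrow> complex mat) \<Rightarrow> nat) j.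
           (\<forall>i\<in>I. 0 < n i) \<and>
           continuous_map \<Omega> (unitary_product_topology I n) j \<and>
           inj_on j (topspace \<Omega>) \<and>
           (\<forall>\<mu>. left_haar_measure (unitary_product_group I n) (unitary_product_topology I n) \<mu> \<longrightarrow>
              Hel_cb (unitary_product_group I n) (unitary_product_topology I n) \<mu>
                (j ` topspace \<Omega>) = 1)"
proof -
  \<comment> \<open>Admitting all continuous unitary-valued maps at once lets the same coordinates
    separate points and carry every dilation. Maps that differ only off the space merely repeat a
    coordinate.\<close>
  define I :: "(nat \<times> ('a \<Rightarrow> complex mat)) set" where
    "I = {(N, U). 0 < N \<and> continuous_map \<Omega> (unitary_topology N) U}"
  define n :: "nat \<times> ('a \<Rightarrow> complex mat) \<Rightarrow> nat" where "n = fst"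
  define j where "j = (\<lambda>w. \<lambda>i\<in>I. snd i w)"
  let ?G = "unitary_product_group I n" and ?T = "unitary_product_topology I n"
  have j: "continuous_map \<Omega> ?T j"
    unfolding unitary_product_topology_def continuous_map_componentwise
    by (auto simp: j_def I_def n_def)
  have dilate: "\<exists>U. (2 * m + m, U) \<in> I \<and> (\<forall>k<m. \<forall>l<m. \<forall>w\<in>topspace \<Omega>. U w $$ (k, l) = F k l w)"
    if m: "0 < m" and F: "\<And>k l. \<lbrakk>k < m; l < m\<rbrakk> \<Longrightarrow> continuous_map \<Omega> euclidean (F k l)" and r: "r < 1"
      and contr: "\<And>w z. w \<in> topspace \<Omega> \<Longrightarrow>
          (\<Sum>k<m. (cmod (\<Sum>l<m. F k l w * z l))\<^sup>2) \<le> r * (\<Sum>l<m. (cmod (z l))\<^sup>2)"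
    for m r and F :: "nat \<Rightarrow> nat \<Rightarrow> 'a \<Rightarrow> complex"
  proof -
    obtain U where U: "\<And>w. w \<in> topspace \<Omega> \<Longrightarrow> U w \<in> carrier (unitary_group (2 * m + m))"
        "\<And>i j. \<lbrakk>i < 2 * m + m; j < 2 * m + m\<rbrakk> \<Longrightarrow> continuous_map \<Omega> euclidean (\<lambda>w. U w $$ (i, j))"
        "\<And>k l w. \<lbrakk>k < m; l < m; w \<in> topspace \<Omega>\<rbrakk> \<Longrightarrow> U w $$ (k, l) = F k l w"
      using continuous_unitary_dilation[OF F r contr] by blast
    have "continuous_map \<Omega> (unitary_topology (2 * m + m)) U"
      using U(1,2) by (rule continuous_map_into_unitary)
    then show ?thesis
      using m U(3) by (intro exI[of _ U]) (simp add: I_def)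
  qed
  have inj: "inj_on j (topspace \<Omega>)"
  proof (rule inj_onI, rule ccontr)
    fix w w' assume w: "w \<in> topspace \<Omega>" "w' \<in> topspace \<Omega>" "j w = j w'" "w \<noteq> w'"
    have "normal_space \<Omega>"
      using assms(1,2) compact_Hausdorff_or_regular_imp_normal_space by blast
    moreover have "closedin \<Omega> {w}" "closedin \<Omega> {w'}"
      using w assms(2) by (auto simp: closedin_Hausdorff_singleton)
    \<comment> \<open>The top value 1/2 keeps the function a strict contraction, as
      \<open>dilate\<close> demands, so it appears as an entry of some coordinate and separates the
      two points.\<close>
    ultimately obtain h where h: "continuous_map \<Omega> (top_of_set {0..1/2::real}) h" "h ` {w} \<subseteq> {0}" "h ` {w'} \<subseteq> {1/2}"
      using w(4) by (elim Urysohn_lemma[of \<Omega> "{w}" "{w'}" 0 "1/2"]) (auto simp: disjnt_def)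
    have hb: "0 \<le> h v \<and> h v \<le> 1/2" if "v \<in> topspace \<Omega>" for v
      using continuous_map_image_subset_topspace[OF h(1)] that by auto
    have "\<exists>U. (2 * 1 + 1, U) \<in> I \<and> (\<forall>k<1. \<forall>l<1. \<forall>v\<in>topspace \<Omega>. U v $$ (k, l) = (\<lambda>k l v. complex_of_real (h v)) k l v)"
    proof (rule dilate)
      show "continuous_map \<Omega> euclidean (\<lambda>v. complex_of_real (h v))"
        using h(1) by (intro continuous_map_complex_of_real) (simp add: continuous_map_in_subtopology)
      fix v and z :: "nat \<Rightarrow> complex" assume "v \<in> topspace \<Omega>"
      then have "(h v)\<^sup>2 \<le> (1/2)\<^sup>2" using hb by (intro power_mono) auto
      then have "(h v)\<^sup>2 * (cmod (z 0))\<^sup>2 \<le> (1/2)\<^sup>2 * (cmod (z 0))\<^sup>2" by (rule mult_right_mono) simp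
      then show "(\<Sum>k<1::nat. (cmod (\<Sum>l<1. complex_of_real (h v) * z l))\<^sup>2) \<le> (1/2)\<^sup>2 * (\<Sum>l<1. (cmod (z l))\<^sup>2)"
        by (simp add: norm_mult power_mult_distrib)
    qed (auto simp: power2_eq_square)
    then obtain U where U: "(3, U) \<in> I" "\<And>v. v \<in> topspace \<Omega> \<Longrightarrow> U v $$ (0, 0) = complex_of_real (h v)"
      by auto
    have "U w = U w'" using fun_cong[OF w(3), of "(3, U)"] U(1) by (simp add: j_def)
    then show False using U(2)[of w] U(2)[of w'] w h(2,3) by simp
  qed
  have "Hel_cb ?G ?T \<mu> (j ` topspace \<Omega>) = 1" if haar: "left_haar_measure ?G ?T \<mu>" for \<mu>
  proof -
    interpret compact_haar_group ?G ?T \<mu>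
      by (rule compact_haar_unitary_product_group[OF haar])
    let ?E = "j ` topspace \<Omega>"
    have E: "?E \<subseteq> carrier ?G"
      using continuous_map_image_subset_topspace[OF j] topspace_eq by simp
    show ?thesis
    proof (rule Hel_cb_eq_1[OF E])
      have "compactin ?T ?E"
        using assms(1) image_compactin[OF _ j] by (simp add: compact_space_def)
      then show "closedin ?T ?E"
        using Hausdorff by (rule compactin_imp_closedin[rotated])
      show "?E \<noteq> {}" using assms(3) by simp
      fix m f R
      assume f: "f \<in> mats m (carr (C0_opspace ?T ?E))" and less: "mnorm (C0_opspace ?T ?E) m f < ennreal R"
      show "\<exists>\<phi>\<in>mats m (carr (predual_opspace (L2_space \<mu>) (VN ?G \<mu>))).
         mnorm (predual_opspace (L2_space \<mu>) (VN ?G \<mu>)) m \<phi> \<le> ennreal R \<and>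
         (\<forall>k<m. \<forall>l<m. f k l = (\<lambda>x\<in>?E. \<phi> k l (translate x)))"
      proof (cases "m = 0")
        case True
        \<comment> \<open>Size 0 is treated apart because coordinates have positive size; the output
          matrices are empty, so any entries do.\<close>
        have "mnorm (predual_opspace (L2_space \<mu>) (VN ?G \<mu>)) m (\<lambda>_ _. undefined) \<le> ennreal R"
          unfolding True predual_opspace_def cb_norm_def mat_opspace_def opspace.simps
          by (intro SUP_least) simp
        then show ?thesis
          by (intro bexI[of _ "\<lambda>_ _. undefined"]) (auto simp: True mats_def)
      next
        case False
        have R: "R > 0"
          using less by (metis ennreal_neg not_less not_less_zero)
        obtain b where b: "0 \<le> b" "mnorm (C0_opspace ?T ?E) m f = ennreal b" "b < R"
          using less by (cases "mnorm (C0_opspace ?T ?E) m f") (auto simp: ennreal_less_iff)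
        \<comment> \<open>The strict inequality \<open>b < R\<close> survives as the uniform bound
          \<open>b / R < 1\<close> for \<open>F\<close>, which is what \<open>dilate\<close>
          needs.\<close>
        define F where "F = (\<lambda>k l w. f k l (j w) / complex_of_real R)"
        have "\<exists>U. (2 * m + m, U) \<in> I \<and> (\<forall>k<m. \<forall>l<m. \<forall>w\<in>topspace \<Omega>. U w $$ (k, l) = F k l w)"
        proof (rule dilate)
          show "0 < m" using False by simp
          have "b / R < 1" using b R by simp
          then show "(b / R)\<^sup>2 < 1" using b R by (simp add: power_less_one_iff)
          show "continuous_map \<Omega> euclidean (F k l)" if "k < m" "l < m" for k l
          proof -
            have "continuous_map (subtopology ?T ?E) euclidean (f k l)"
              using f that by (simp add: mats_def C0_opspace_def)
            moreover have "continuous_map \<Omega> (subtopology ?T ?E) j"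
              using j by (simp add: continuous_map_in_subtopology)
            ultimately have "continuous_map \<Omega> euclidean (\<lambda>w. f k l (j w))"
              using continuous_map_compose by (force simp: o_def)
            then show ?thesis
              unfolding F_def divide_inverse
              by (intro continuous_map_mult_complex continuous_map_canonical_const)
          qed
          fix w and z :: "nat \<Rightarrow> complex" assume w: "w \<in> topspace \<Omega>"
          have "opnorm {..<m} (\<lambda>k l. f k l (j w)) \<le> ennreal b"
            unfolding b(2)[symmetric] C0_opspace_def opspace.simps using w by (intro SUP_upper) auto
          then have "(\<Sum>k<m. (cmod (\<Sum>l<m. f k l (j w) * z l))\<^sup>2) \<le> b\<^sup>2 * (\<Sum>l<m. (cmod (z l))\<^sup>2)"
            using b(1) by (intro opnorm_le_imp_sum_le) auto
          then have "(\<Sum>k<m. (cmod (\<Sum>l<m. f k l (j w) * z l))\<^sup>2) / R\<^sup>2 \<le> b\<^sup>2 * (\<Sum>l<m. (cmod (z l))\<^sup>2) / R\<^sup>2"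
            by (rule divide_right_mono) simp
          moreover have "(\<Sum>k<m. (cmod (\<Sum>l<m. F k l w * z l))\<^sup>2) = (\<Sum>k<m. (cmod (\<Sum>l<m. f k l (j w) * z l))\<^sup>2) / R\<^sup>2"
            using R by (simp add: F_def sum_divide_distrib[symmetric] norm_divide power_divide)
          ultimately show "(\<Sum>k<m. (cmod (\<Sum>l<m. F k l w * z l))\<^sup>2) \<le> (b / R)\<^sup>2 * (\<Sum>l<m. (cmod (z l))\<^sup>2)"
            by (simp add: power_divide)
        qed
        then obtain U where U: "(2 * m + m, U) \<in> I" "\<forall>k<m. \<forall>l<m. \<forall>w\<in>topspace \<Omega>. U w $$ (k, l) = F k l w"
          by blast
        \<comment> \<open>\<open>F\<close> is the upper left corner of this coordinate; its
          functionals are multiplied by \<open>R\<close> afterwards to recover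
          \<open>f\<close>.\<close>
        have "m \<le> n (2 * m + m, U)" by (simp add: n_def)
        then obtain \<psi> where \<psi>: "\<psi> \<in> mats m (carr (predual_opspace (L2_space \<mu>) (VN ?G \<mu>)))"
            "mnorm (predual_opspace (L2_space \<mu>) (VN ?G \<mu>)) m \<psi> \<le> 1"
            "\<forall>k<m. \<forall>l<m. \<forall>x\<in>carrier ?G. \<psi> k l (translate x) = x (2 * m + m, U) $$ (k, l)"
          using unitary_coordinate_functionals[OF haar U(1)] by blast
        define \<phi> where "\<phi> = (\<lambda>k l. \<lambda>A\<in>VN ?G \<mu>. complex_of_real R * \<psi> k l A)"
        have "\<phi> \<in> mats m (carr (predual_opspace (L2_space \<mu>) (VN ?G \<mu>)))"
          using \<psi>(1) by (auto simp: mats_def \<phi>_def intro!: L2.predual_scale VN_bounded_ops)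
        moreover have "mnorm (predual_opspace (L2_space \<mu>) (VN ?G \<mu>)) m \<phi> \<le> ennreal R"
        proof -
          have "mnorm (predual_opspace (L2_space \<mu>) (VN ?G \<mu>)) m \<phi> \<le>
              ennreal R * mnorm (predual_opspace (L2_space \<mu>) (VN ?G \<mu>)) m \<psi>"
            unfolding \<phi>_def using R by (intro L2.predual_mnorm_scale_le) simp
          also have "\<dots> \<le> ennreal R * 1"
            using \<psi>(2) by (rule mult_left_mono) simp
          finally show ?thesis by simp
        qed
        moreover have "f k l = (\<lambda>x\<in>?E. \<phi> k l (translate x))" if kl: "k < m" "l < m" for k l
        proof
          fix x
          show "f k l x = (\<lambda>x\<in>?E. \<phi> k l (translate x)) x"
          proof (cases "x \<in> ?E")
            case True
            then obtain w where w: "w \<in> topspace \<Omega>" "x = j w" by blast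
            have xG: "x \<in> carrier ?G" using True E by blast
            have "\<phi> k l (translate x) = complex_of_real R * \<psi> k l (translate x)"
              using translate_in_VN[OF xG] by (simp add: \<phi>_def)
            also have "\<psi> k l (translate x) = x (2 * m + m, U) $$ (k, l)"
              using \<psi>(3) kl xG by blast
            also have "\<dots> = F k l w"
              using U kl w by (simp add: j_def)
            also have "complex_of_real R * F k l w = f k l x"
              using R by (simp add: F_def w(2))
            finally show ?thesis using True by simp
          next
            case False
            \<comment> \<open>Off the set both sides are \<open>undefined\<close>.\<close>
            have "f k l \<in> extensional ?E"
              using f kl by (simp add: mats_def C0_opspace_def)
            then show ?thesis using False by (simp add: extensional_def)
          qed
        qed
        ultimately show ?thesis by blast
      qed
    qed
  qed
  moreover have "\<forall>i\<in>I. 0 < n i" by (auto simp: I_def n_def)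
  ultimately show ?thesis using j inj by blast
qed

end
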